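(* Let $h_1,h_2\in \mathrm{Supp}_{BV}(Q)$ and let $F\in\mathcal S(L_2(Q))$ be given by $F(x)=\int_{L_2(Q)}\exp\{i\langle u,x\rangle\}\,df(u)$ with $f\in\mathcal M(L_2(Q))$. Then, for any nonzero real number $q$, the iterated analytic Yeh--Feynman integral of $F$ below exists and is given by $$I_{h_2,x_2}^{\mathrm{an.}yf_q}\Big[I_{h_1,x_1}^{\mathrm{an.}yf_q}\big[F\big(\mathcal Y_{h_1}(x_1;\cdot,\cdot)+\mathcal Y_{h_2}(x_2;\cdot,\cdot)\big)\big]\Big]=\int_{L_2(Q)}\exp\Big\{-\frac{i}{2q}\sum_{j=1}^2\|uh_j\|_2^2\Big\}\,df(u).$$ Furthermore, if $\mathbf s=\mathbf s(h_1,h_2)$ is a function in $\mathrm{Supp}_{BV}(Q)$ satisfying $\mathbf s^2=h_1^2+h_2^2$ $m_L^2$-a.e. on $Q$, then $$I_{h_2,x_2}^{\mathrm{an.}yf_q}\Big[I_{h_1,x_1}^{\mathrm{an.}yf_q}\big[F\big(\mathcal Y_{h_1}(x_1;\cdot,\cdot)+\mathcal Y_{h_2}(x_2;\cdot,\cdot)\big)\big]\Big]=I_{\mathbf s,x}^{\mathrm{an.}yf_q}\big[F\big(\mathcal Y_{\mathbf s}(x;\cdot,\cdot)\big)\big].$$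
   Context: Fix $S,T>0$, let $Q=[0,S]\times[0,T]$, $m_L^2$ = Lebesgue measure on $Q$, and $L_2(Q)$ the real Hilbert space with inner product $(\cdot,\cdot)_2$ and norm $\|\cdot\|_2$. $C_0(Q)$ is the space of real continuous $x$ on $Q$ with $x(s,0)=x(0,t)=0$, with (completed) Yeh--Wiener measure $m_{\mathrm y}$, i.e. the centered Gaussian measure with $\int x(s,t)x(s',t')\,dm_{\mathrm y}(x)=\min(s,s')\min(t,t')$. A set $E$ is scale-invariant measurable if $\rho E$ is measurable for every $\rho>0$, a scale-invariant measurable set $N$ is scale-invariant null if $m_{\mathrm y}(\rho N)=0$ for every $\rho>0$; "s-a.e." means off a scale-invariant null set. A functional $F$ is scale-invariant measurable if it is defined on a scale-invariant measurable set and $F(\rho\,\cdot)$ is measurable for every $\rho>0$. PWZ integral: fix a complete orthonormal set $\{\phi_n\}$ of $L_2(Q)$ consisting of functions of bounded variation (Hardy--Krause sense); for $v\in L_2(Q)$, $\langle v,x\rangle=\lim_{n}\int_Q\sum_{j=1}^n(v,\phi_j)_2\phi_j\,dx$ where the limit exists (it exists for s-a.e. $x$ and is essentially independent of $\{\phi_n\}$). $\mathrm{Supp}_{BV}(Q)$ is the set of real functions $h$ on $Q$ of bounded variation (Hardy--Krause sense) with $h\neq0$ $m_L^2$-a.e. For such $h$, $\mathcal Y_h(x;s,t)=\langle\chi_{[0,s]\times[0,t]}h,x\rangle$; its sample paths $\mathcal Y_h(x;\cdot,\cdot)$ lie in $C_0(Q)$. $\mathcal M(L_2(Q))$ is the space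 of complex countably additive Borel measures on $L_2(Q)$. $\mathcal S(L_2(Q))$ is the set of functionals $F$ on $C_0(Q)$ of the form $F(x)=\int_{L_2(Q)}\exp\{i\langle u,x\rangle\}df(u)$ for s-a.e. $x$, for some $f\in\mathcal M(L_2(Q))$. Evaluation along Gaussian paths uses this formula together with $\langle u,\mathcal Y_h(x;\cdot,\cdot)\rangle=\langle uh,x\rangle$, i.e. for real $c_j$, $F(y+\sum_jc_j\mathcal Y_{h_j}(x_j;\cdot,\cdot))=\int\exp\{i\langle u,y\rangle+i\sum_jc_j\langle uh_j,x_j\rangle\}df(u)$. Analytic integrals: $\mathbb C_+=\{\mathrm{Re}\,\lambda>0\}$. For $h\in\mathrm{Supp}_{BV}(Q)$ suppose $J_F(h;\lambda)=\int_{C_0(Q)}F(\lambda^{-1/2}\mathcal Y_h(x;\cdot,\cdot))dm_{\mathrm y}(x)$ is finite for all $\lambda>0$ and has an analytic extension $J_F^*(h;\cdot)$ to $\mathbb C_+$. Then $I_{h,x}^{\mathrm{an.}yw_\lambda}[F(\mathcal Y_h(x;\cdot,\cdot))]=J^*_F(h;\lambda)$ for $\lambda\in\mathbb C_+$, and for real $q\ne0$, $I_{h,x}^{\mathrm{an.}yf_q}[F(\mathcal Y_h(x;\cdot,\cdot))]=\lim_{\lambda\to-iq,\,\lambda\in\mathbb C_+}J_F^*(h;\lambda)$ if the limit exists. In an iterated integral, the inner integral is the functional $z\mapsto I_{h_1,x_1}^{\mathrm{an.}yf_q}[F(\mathcal Y_{h_1}(x_1;\cdot,\cdot)+z)]$,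 and the outer integral is the analytic integral of this functional along $\mathcal Y_{h_2}(x_2;\cdot,\cdot)$. *)

theory Defs
  imports "HOL-Probability.Probability" "HOL-Complex_Analysis.Complex_Analysis"
begin

type_synonym pt = "real \<times> real"

section \<open>The rectangle and the Hilbert space \<open>L\<^sub>2(Q)\<close>\<close>

definition Qrect :: "real \<Rightarrow> real \<Rightarrow> pt set" where
  "Qrect S T = {0..S} \<times> {0..T}"

abbreviation leb_Q :: "real \<Rightarrow> real \<Rightarrow> pt measure" where
  "leb_Q S T \<equiv> lebesgue_on (Qrect S T)"

definition L2fun :: "real \<Rightarrow> real \<Rightarrow> (pt \<Rightarrow> real) set" where
  "L2fun S T = {v. v \<in> borel_measurable (leb_Q S T) \<and> integrable (leb_Q S T) (\<lambda>p. (v p)\<^sup>2)}"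

definition L2inner :: "real \<Rightarrow> real \<Rightarrow> (pt \<Rightarrow> real) \<Rightarrow> (pt \<Rightarrow> real) \<Rightarrow> real" where
  "L2inner S T v w = (LINT p | leb_Q S T. v p * w p)"

definition L2norm :: "real \<Rightarrow> real \<Rightarrow> (pt \<Rightarrow> real) \<Rightarrow> real" where
  "L2norm S T v = sqrt (L2inner S T v v)"

text \<open>Elements of \<open>L\<^sub>2(Q)\<close> are classes of functions modulo equality almost everywhere on \<open>Q\<close>
  (values outside \<open>Q\<close> are irrelevant); \<open>L2rep\<close> picks a representative.\<close>

definition L2eq :: "real \<Rightarrow> real \<Rightarrow> ((pt \<Rightarrow> real) \<times> (pt \<Rightarrow> real)) set" where
  "L2eq S T = {(v, w). v \<in> L2fun S T \<and> w \<in> L2fun S T \<and> (AE p in leb_Q S T. v p = w p)}"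

definition L2 :: "real \<Rightarrow> real \<Rightarrow> (pt \<Rightarrow> real) set set" where
  "L2 S T = L2fun S T // L2eq S T"

definition L2rep :: "(pt \<Rightarrow> real) set \<Rightarrow> pt \<Rightarrow> real" where
  "L2rep u = (SOME v. v \<in> u)"

definition L2dist :: "real \<Rightarrow> real \<Rightarrow> (pt \<Rightarrow> real) set \<Rightarrow> (pt \<Rightarrow> real) set \<Rightarrow> real" where
  "L2dist S T u w = L2norm S T (\<lambda>p. L2rep u p - L2rep w p)"

definition L2borel :: "real \<Rightarrow> real \<Rightarrow> (pt \<Rightarrow> real) set measure" where
  "L2borel S T = sigma (L2 S T) {U. openin (Metric_space.mtopology (L2 S T) (L2dist S T)) U}"


section \<open>Complex measures\<close>

definition complex_measures :: "'a measure \<Rightarrow> ('a set \<Rightarrow> complex) set" where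
  "complex_measures M = {f. \<forall>A :: nat \<Rightarrow> 'a set. range A \<subseteq> sets M \<longrightarrow> disjoint_family A \<longrightarrow>
     (\<lambda>n. f (A n)) sums f (\<Union>n. A n)}"

text \<open>The upper variation \<open>\<nu>\<^sup>+(A) = sup {\<nu>(B) | B \<subseteq> A}\<close> of a signed measure. Since \<open>B = {}\<close>
  is allowed, truncation of negative values by \<open>ennreal\<close> is harmless. The lower variation of
  \<open>\<nu>\<close> is the upper variation of \<open>-\<nu>\<close>.\<close>

definition upper_variation :: "'a measure \<Rightarrow> ('a set \<Rightarrow> real) \<Rightarrow> 'a measure" where
  "upper_variation M \<nu> =
     measure_of (space M) (sets M) (\<lambda>A. SUP B \<in> {B \<in> sets M. B \<subseteq> A}. ennreal (\<nu> B))"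

text \<open>Integration against a complex measure, by the Jordan decomposition of its real and
  imaginary parts.\<close>

definition cm_integral :: "'a measure \<Rightarrow> ('a set \<Rightarrow> complex) \<Rightarrow> ('a \<Rightarrow> complex) \<Rightarrow> complex" where
  "cm_integral M f g =
     (integral\<^sup>L (upper_variation M (\<lambda>A. Re (f A))) g
        - integral\<^sup>L (upper_variation M (\<lambda>A. - Re (f A))) g)
     + \<i> * (integral\<^sup>L (upper_variation M (\<lambda>A. Im (f A))) g
        - integral\<^sup>L (upper_variation M (\<lambda>A. - Im (f A))) g)"

text \<open>Validity off a set of total variation zero, i.e. off a measurable set all of whose
  measurable subsets have measure zero.\<close>

definition cm_AE :: "'a measure \<Rightarrow> ('a set \<Rightarrow> complex) \<Rightarrow> ('a \<Rightarrow> bool) \<Rightarrow> bool" where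
  "cm_AE M f P \<longleftrightarrow> (\<exists>N \<in> sets M. (\<forall>B \<in> sets M. B \<subseteq> N \<longrightarrow> f B = 0) \<and> {u \<in> space M. \<not> P u} \<subseteq> N)"


section \<open>Bounded variation and Riemann--Stieltjes integration on \<open>Q\<close>\<close>

definition is_partition :: "real \<Rightarrow> nat \<Rightarrow> (nat \<Rightarrow> real) \<Rightarrow> bool" where
  "is_partition L n s \<longleftrightarrow> s 0 = 0 \<and> s n = L \<and> (\<forall>i<n. s i \<le> s (Suc i))"

definition rect_incr :: "(pt \<Rightarrow> real) \<Rightarrow> real \<Rightarrow> real \<Rightarrow> real \<Rightarrow> real \<Rightarrow> real" where
  "rect_incr g a b c d = g (b, d) - g (a, d) - g (b, c) + g (a, c)"

definition bv_1d :: "real \<Rightarrow> (real \<Rightarrow> real) \<Rightarrow> bool" where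
  "bv_1d L g \<longleftrightarrow> (\<exists>C. \<forall>n s. is_partition L n s \<longrightarrow> (\<Sum>i<n. \<bar>g (s (Suc i)) - g (s i)\<bar>) \<le> C)"

definition bv_vitali :: "real \<Rightarrow> real \<Rightarrow> (pt \<Rightarrow> real) \<Rightarrow> bool" where
  "bv_vitali S T g \<longleftrightarrow> (\<exists>C. \<forall>m n s t. is_partition S m s \<longrightarrow> is_partition T n t \<longrightarrow>
     (\<Sum>i<m. \<Sum>j<n. \<bar>rect_incr g (s i) (s (Suc i)) (t j) (t (Suc j))\<bar>) \<le> C)"

text \<open>Hardy--Krause: bounded Vitali variation, and all sections of bounded variation.\<close>

definition bv_hk :: "real \<Rightarrow> real \<Rightarrow> (pt \<Rightarrow> real) \<Rightarrow> bool" where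
  "bv_hk S T g \<longleftrightarrow> bv_vitali S T g \<and> (\<forall>s\<in>{0..S}. bv_1d T (\<lambda>t. g (s, t)))
     \<and> (\<forall>t\<in>{0..T}. bv_1d S (\<lambda>s. g (s, t)))"

definition Supp_BV :: "real \<Rightarrow> real \<Rightarrow> (pt \<Rightarrow> real) set" where
  "Supp_BV S T = {h. bv_hk S T h \<and> (AE p in leb_Q S T. h p \<noteq> 0)}"

text \<open>The Riemann--Stieltjes integral of \<open>g\<close> with respect to \<open>x\<close> over \<open>Q\<close>. The tag in the cell
  \<open>(i, j)\<close> is \<open>(\<sigma> i, \<tau> j)\<close> (the restricted integral): tags chosen freely in every cell would make
  the limit fail for integrands of bounded variation and continuous integrators.\<close>

definition has_rs_integral :: "real \<Rightarrow> real \<Rightarrow> (pt \<Rightarrow> real) \<Rightarrow> (pt \<Rightarrow> real) \<Rightarrow> real \<Rightarrow> bool" where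
  "has_rs_integral S T g x I \<longleftrightarrow> (\<forall>\<epsilon>>0. \<exists>\<delta>>0. \<forall>m n s t \<sigma> \<tau>.
     is_partition S m s \<longrightarrow> is_partition T n t \<longrightarrow>
     (\<forall>i<m. s (Suc i) - s i < \<delta> \<and> \<sigma> i \<in> {s i..s (Suc i)}) \<longrightarrow>
     (\<forall>j<n. t (Suc j) - t j < \<delta> \<and> \<tau> j \<in> {t j..t (Suc j)}) \<longrightarrow>
     \<bar>(\<Sum>i<m. \<Sum>j<n. g (\<sigma> i, \<tau> j) * rect_incr x (s i) (s (Suc i)) (t j) (t (Suc j))) - I\<bar> < \<epsilon>)"

definition rs_integral :: "real \<Rightarrow> real \<Rightarrow> (pt \<Rightarrow> real) \<Rightarrow> (pt \<Rightarrow> real) \<Rightarrow> real" where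
  "rs_integral S T g x = (THE I. has_rs_integral S T g x I)"


section \<open>Yeh--Wiener space\<close>

text \<open>A function on \<open>Q\<close> is represented by its extension by zero to the plane.\<close>

definition C0 :: "real \<Rightarrow> real \<Rightarrow> (pt \<Rightarrow> real) set" where
  "C0 S T = {x. continuous_on (Qrect S T) x \<and> (\<forall>s\<in>{0..S}. x (s, 0) = 0)
     \<and> (\<forall>t\<in>{0..T}. x (0, t) = 0) \<and> (\<forall>p. p \<notin> Qrect S T \<longrightarrow> x p = 0)}"

definition centered_normal :: "'a measure \<Rightarrow> ('a \<Rightarrow> real) \<Rightarrow> bool" where
  "centered_normal M X \<longleftrightarrow>
     (AE x in M. X x = 0) \<or> (\<exists>\<sigma>>0. distributed M lborel X (normal_density 0 \<sigma>))"

text \<open>The completed Yeh--Wiener measure: the completion of the centered Gaussian probability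
  measure with covariance \<open>min(s,s') min(t,t')\<close> on the \<open>\<sigma>\<close>-algebra generated by the point
  evaluations (which is the Borel \<open>\<sigma>\<close>-algebra of the uniform norm).\<close>

definition yeh_wiener :: "real \<Rightarrow> real \<Rightarrow> (pt \<Rightarrow> real) measure \<Rightarrow> bool" where
  "yeh_wiener S T m \<longleftrightarrow> (\<exists>W. m = completion W \<and> prob_space W \<and> space W = C0 S T
     \<and> sets W = sigma_sets (C0 S T) {{x \<in> C0 S T. x p \<in> B} | p B. p \<in> Qrect S T \<and> B \<in> sets borel}
     \<and> (\<forall>J c. finite J \<longrightarrow> J \<subseteq> Qrect S T \<longrightarrow> centered_normal W (\<lambda>x. \<Sum>p\<in>J. c p * x p))
     \<and> (\<forall>(s, t)\<in>Qrect S T. \<forall>(s', t')\<in>Qrect S T.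
          (LINT x | W. x (s, t) * x (s', t')) = min s s' * min t t'))"

definition scale_set :: "real \<Rightarrow> (pt \<Rightarrow> real) set \<Rightarrow> (pt \<Rightarrow> real) set" where
  "scale_set \<rho> E = (\<lambda>x p. \<rho> * x p) ` E"

definition scale_null :: "(pt \<Rightarrow> real) measure \<Rightarrow> (pt \<Rightarrow> real) set \<Rightarrow> bool" where
  "scale_null m N \<longleftrightarrow> (\<forall>\<rho>>0. scale_set \<rho> N \<in> sets m \<and> emeasure m (scale_set \<rho> N) = 0)"

definition s_AE :: "(pt \<Rightarrow> real) measure \<Rightarrow> ((pt \<Rightarrow> real) \<Rightarrow> bool) \<Rightarrow> bool" where
  "s_AE m P \<longleftrightarrow> (\<exists>N. scale_null m N \<and> {x \<in> space m. \<not> P x} \<subseteq> N)"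


section \<open>The Paley--Wiener--Zygmund integral and Gaussian paths\<close>

definition complete_orthonormal_bv :: "real \<Rightarrow> real \<Rightarrow> (nat \<Rightarrow> pt \<Rightarrow> real) \<Rightarrow> bool" where
  "complete_orthonormal_bv S T \<phi> \<longleftrightarrow>
     (\<forall>n. \<phi> n \<in> L2fun S T \<and> bv_hk S T (\<phi> n))
     \<and> (\<forall>i j. L2inner S T (\<phi> i) (\<phi> j) = (if i = j then 1 else 0))
     \<and> (\<forall>v\<in>L2fun S T. (\<forall>n. L2inner S T v (\<phi> n) = 0) \<longrightarrow> (AE p in leb_Q S T. v p = 0))"

definition pwz_seq ::
  "real \<Rightarrow> real \<Rightarrow> (nat \<Rightarrow> pt \<Rightarrow> real) \<Rightarrow> (pt \<Rightarrow> real) \<Rightarrow> (pt \<Rightarrow> real) \<Rightarrow> nat \<Rightarrow> real" where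
  "pwz_seq S T \<phi> v x n = rs_integral S T (\<lambda>p. \<Sum>j<n. L2inner S T v (\<phi> j) * \<phi> j p) x"

definition pwz ::
  "real \<Rightarrow> real \<Rightarrow> (nat \<Rightarrow> pt \<Rightarrow> real) \<Rightarrow> (pt \<Rightarrow> real) \<Rightarrow> (pt \<Rightarrow> real) \<Rightarrow> real" where
  "pwz S T \<phi> v x = lim (pwz_seq S T \<phi> v x)"

definition pwz_exists ::
  "real \<Rightarrow> real \<Rightarrow> (nat \<Rightarrow> pt \<Rightarrow> real) \<Rightarrow> (pt \<Rightarrow> real) \<Rightarrow> (pt \<Rightarrow> real) \<Rightarrow> bool" where
  "pwz_exists S T \<phi> v x \<longleftrightarrow> convergent (pwz_seq S T \<phi> v x)"

text \<open>\<open>Y h x\<close> is the path \<open>(s, t) \<mapsto> \<langle>\<chi>\<^bsub>[0,s]\<times>[0,t]\<^esub> h, x\<rangle>\<close>. For each \<open>(s, t)\<close> the right-hand side is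
  determined only for s-a.e. \<open>x\<close>; \<open>Y\<close> is a version of this process with all sample paths
  in \<open>C\<^sub>0(Q)\<close>.\<close>

definition gaussian_paths ::
  "real \<Rightarrow> real \<Rightarrow> (nat \<Rightarrow> pt \<Rightarrow> real) \<Rightarrow> (pt \<Rightarrow> real) measure
     \<Rightarrow> ((pt \<Rightarrow> real) \<Rightarrow> (pt \<Rightarrow> real) \<Rightarrow> (pt \<Rightarrow> real)) \<Rightarrow> bool" where
  "gaussian_paths S T \<phi> m Y \<longleftrightarrow> (\<forall>h\<in>Supp_BV S T.
     (\<forall>x\<in>C0 S T. Y h x \<in> C0 S T)
     \<and> (\<forall>(s, t)\<in>Qrect S T.
          s_AE m (\<lambda>x. Y h x (s, t) = pwz S T \<phi> (\<lambda>p. indicator ({0..s} \<times> {0..t}) p * h p) x)))"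


section \<open>The class \<open>\<S>(L\<^sub>2(Q))\<close>\<close>

definition fourier_functional ::
  "real \<Rightarrow> real \<Rightarrow> (nat \<Rightarrow> pt \<Rightarrow> real) \<Rightarrow> ((pt \<Rightarrow> real) set set \<Rightarrow> complex)
     \<Rightarrow> (pt \<Rightarrow> real) \<Rightarrow> complex" where
  "fourier_functional S T \<phi> f x =
     cm_integral (L2borel S T) f (\<lambda>u. exp (\<i> * of_real (pwz S T \<phi> (L2rep u) x)))"

definition S_class ::
  "real \<Rightarrow> real \<Rightarrow> (nat \<Rightarrow> pt \<Rightarrow> real) \<Rightarrow> (pt \<Rightarrow> real) measure \<Rightarrow> ((pt \<Rightarrow> real) \<Rightarrow> complex) set" where
  "S_class S T \<phi> m = {F. \<exists>f\<in>complex_measures (L2borel S T).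
     s_AE m (\<lambda>x. F x = fourier_functional S T \<phi> f x)}"

text \<open>\<open>F\<close> is given by the formula \<open>F(x) = \<integral> exp{i\<langle>u,x\<rangle>} df(u)\<close> at every path \<open>x\<close> at which the right-hand
  side makes sense, that is, at which \<open>\<langle>u,x\<rangle>\<close> exists for \<open>f\<close>-almost every \<open>u\<close>. Equality merely for
  s-a.e. \<open>x\<close> would not determine \<open>F\<close> along \<open>Y h x\<close>, since the law of \<open>Y h\<close> is in general
  singular to the Yeh--Wiener measure and to all its scalings.\<close>

definition given_by ::
  "real \<Rightarrow> real \<Rightarrow> (nat \<Rightarrow> pt \<Rightarrow> real) \<Rightarrow> ((pt \<Rightarrow> real) set set \<Rightarrow> complex)
     \<Rightarrow> ((pt \<Rightarrow> real) \<Rightarrow> complex) \<Rightarrow> bool" where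
  "given_by S T \<phi> f F \<longleftrightarrow> (\<forall>x\<in>C0 S T.
     cm_AE (L2borel S T) f (\<lambda>u. pwz_exists S T \<phi> (L2rep u) x) \<longrightarrow>
     F x = fourier_functional S T \<phi> f x)"


section \<open>Analytic Yeh--Feynman integrals\<close>

text \<open>In this section \<open>Z\<close> stands for a path transformation \<open>x \<mapsto> Y h x\<close>, and \<open>\<lambda>\<^sup>-\<^sup>1\<^sup>/\<^sup>2\<close> is \<open>1 / sqrt \<lambda>\<close>.\<close>

definition J_fun ::
  "(pt \<Rightarrow> real) measure \<Rightarrow> ((pt \<Rightarrow> real) \<Rightarrow> (pt \<Rightarrow> real)) \<Rightarrow> ((pt \<Rightarrow> real) \<Rightarrow> complex)
     \<Rightarrow> real \<Rightarrow> complex" where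
  "J_fun m Z F lam = (LINT x | m. F (\<lambda>p. Z x p / sqrt lam))"

definition analytic_extension_J ::
  "(pt \<Rightarrow> real) measure \<Rightarrow> ((pt \<Rightarrow> real) \<Rightarrow> (pt \<Rightarrow> real)) \<Rightarrow> ((pt \<Rightarrow> real) \<Rightarrow> complex)
     \<Rightarrow> (complex \<Rightarrow> complex) \<Rightarrow> bool" where
  "analytic_extension_J m Z F g \<longleftrightarrow>
     (\<forall>lam>0. integrable m (\<lambda>x. F (\<lambda>p. Z x p / sqrt lam)))
     \<and> g holomorphic_on {z. Re z > 0}
     \<and> (\<forall>lam>0. g (of_real lam) = J_fun m Z F lam)"

definition has_feynman ::
  "(pt \<Rightarrow> real) measure \<Rightarrow> ((pt \<Rightarrow> real) \<Rightarrow> (pt \<Rightarrow> real)) \<Rightarrow> real \<Rightarrow> ((pt \<Rightarrow> real) \<Rightarrow> complex)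
     \<Rightarrow> complex \<Rightarrow> bool" where
  "has_feynman m Z q F w \<longleftrightarrow> (\<exists>g. analytic_extension_J m Z F g
     \<and> (g \<longlongrightarrow> w) (at (- \<i> * of_real q) within {z. Re z > 0}))"

definition feynman ::
  "(pt \<Rightarrow> real) measure \<Rightarrow> ((pt \<Rightarrow> real) \<Rightarrow> (pt \<Rightarrow> real)) \<Rightarrow> real \<Rightarrow> ((pt \<Rightarrow> real) \<Rightarrow> complex)
     \<Rightarrow> complex" where
  "feynman m Z q F = (THE w. has_feynman m Z q F w)"

definition inner_feynman ::
  "(pt \<Rightarrow> real) measure \<Rightarrow> ((pt \<Rightarrow> real) \<Rightarrow> (pt \<Rightarrow> real)) \<Rightarrow> real \<Rightarrow> ((pt \<Rightarrow> real) \<Rightarrow> complex)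
     \<Rightarrow> (pt \<Rightarrow> real) \<Rightarrow> complex" where
  "inner_feynman m Z1 q F z = feynman m Z1 q (\<lambda>y. F (\<lambda>p. y p + z p))"

text \<open>The iterated integral exists with value \<open>w\<close>: the inner integral exists at almost all the
  paths on which the outer integral evaluates it (so that junk values of \<open>feynman\<close> play no role),
  and the outer integral of the resulting functional exists with value \<open>w\<close>.\<close>

definition has_iterated_feynman ::
  "(pt \<Rightarrow> real) measure \<Rightarrow> ((pt \<Rightarrow> real) \<Rightarrow> (pt \<Rightarrow> real)) \<Rightarrow> ((pt \<Rightarrow> real) \<Rightarrow> (pt \<Rightarrow> real)) \<Rightarrow> real
     \<Rightarrow> ((pt \<Rightarrow> real) \<Rightarrow> complex) \<Rightarrow> complex \<Rightarrow> bool" where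
  "has_iterated_feynman m Z1 Z2 q F w \<longleftrightarrow>
     (\<forall>lam>0. AE x in m. \<exists>v. has_feynman m Z1 q (\<lambda>y. F (\<lambda>p. y p + Z2 x p / sqrt lam)) v)
     \<and> has_feynman m Z2 q (inner_feynman m Z1 q F) w"

definition iterated_feynman ::
  "(pt \<Rightarrow> real) measure \<Rightarrow> ((pt \<Rightarrow> real) \<Rightarrow> (pt \<Rightarrow> real)) \<Rightarrow> ((pt \<Rightarrow> real) \<Rightarrow> (pt \<Rightarrow> real)) \<Rightarrow> real
     \<Rightarrow> ((pt \<Rightarrow> real) \<Rightarrow> complex) \<Rightarrow> complex" where
  "iterated_feynman m Z1 Z2 q F = feynman m Z2 q (inner_feynman m Z1 q F)"

end

theory Submission
  imports Defs
begin

text \<open>A path functional that is an \<open>L\<^sup>4\<close>-limit of linear combinations of point evaluations is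
  Gaussian, with variance the squared \<open>L\<^sub>2(Q)\<close>-norm of its kernel. For \<open>\<phi>\<close> of bounded variation the
  Riemann--Stieltjes integral of \<open>\<phi>\<close> against \<open>Y h x\<close> is such a limit, with kernel \<open>\<phi> h\<close>; so the partial
  sums defining \<open>\<langle>u, Y h x\<rangle>\<close> have kernels \<open>(P\<^sub>n u) h \<rightarrow> u h\<close>. Unlike in the classical case \<open>h = 1\<close> the
  summands are not independent, and almost sure convergence comes from Moricz's maximal inequality:
  the fourth moments of the increments are at most a constant times the square of an increment of
  \<open>\<Sum> (u, \<phi>\<^sub>j)\<^sup>2\<close>. Hence \<open>\<langle>u, Y h x\<rangle>\<close> is centered Gaussian with variance \<open>\<parallel>u h\<parallel>\<^sup>2\<close>, and by Fubini
  integrating \<open>b(u) exp(i \<langle>u, Y h x\<rangle> / sqrt \<lambda>)\<close> over \<open>x\<close> multiplies the density \<open>b\<close> by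
  \<open>exp(- \<parallel>u h\<parallel>\<^sup>2 / (2 \<lambda>))\<close>. This is a Laplace transform in \<open>1 / \<lambda>\<close>, analytic for \<open>Re \<lambda> > 0\<close> and continuous
  up to \<open>\<lambda> = - i q\<close>. Doing this for \<open>h1\<close> and then for \<open>h2\<close> adds the exponents.\<close>

section \<open>The Hilbert space of square integrable functions\<close>

text \<open>The products \<open>\<phi> j * h\<close> are in general not orthogonal, so the terms are
  jointly Gaussian but correlated. Second moments, linear in the increments of
  \<open>\<tau>\<close>, would bring the logarithmic loss of Rademacher and Menshov; fourth moments
  of Gaussian variables are squares of variances, and the exponent 2 > 1 lets a bisection close
  without it. The null set of paths where \<open><u, Y h x>\<close> fails to exist depends on
  \<open>u\<close>, and there are uncountably many \<open>u\<close>. Fubini turns this around: for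
  almost every path, the limit exists for \<open>f\<close>-almost every \<open>u\<close>, which is
  the condition under which \<open>given_by\<close> determines \<open>F\<close>, and it survives
  linear combinations of two such paths. Measurability of the integrands in \<open>x\<close> comes
  from completeness of \<open>m\<close>, since they are identified only almost everywhere.\<close>

lemma Qrect_cbox: "Qrect S T = cbox (0,0) (S,T)"
  by (auto simp: Qrect_def cbox_Pair_eq)

lemma Qrect_sets [measurable]: "Qrect S T \<in> sets lebesgue"
  by (simp add: Qrect_cbox)

lemma finite_measure_leb_Q: "finite_measure (leb_Q S T)"
  by (rule finite_measureI)
    (auto simp: emeasure_restrict_space Qrect_cbox emeasure_lborel_cbox_eq)

lemma L2fun_measurable: "v \<in> L2fun S T \<Longrightarrow> v \<in> borel_measurable (leb_Q S T)"
  by (simp add: L2fun_def)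

lemma L2fun_square_integrable: "v \<in> L2fun S T \<Longrightarrow> integrable (leb_Q S T) (\<lambda>p. (v p)\<^sup>2)"
  by (simp add: L2fun_def)

lemma abs_mult_le_sum_squares: "\<bar>a * b\<bar> \<le> a\<^sup>2 + (b::real)\<^sup>2"
proof -
  have "2 * (\<bar>a\<bar> * \<bar>b\<bar>) \<le> a\<^sup>2 + b\<^sup>2" "0 \<le> \<bar>a\<bar> * \<bar>b\<bar>"
    using sum_squares_bound[of "\<bar>a\<bar>" "\<bar>b\<bar>"] by auto
  then show ?thesis unfolding abs_mult by linarith
qed

lemma L2fun_mult_integrable:
  assumes "v \<in> L2fun S T" "w \<in> L2fun S T"
  shows "integrable (leb_Q S T) (\<lambda>p. v p * w p)"
proof (rule Bochner_Integration.integrable_bound)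
  show "integrable (leb_Q S T) (\<lambda>p. (v p)\<^sup>2 + (w p)\<^sup>2)"
    using assms by (auto intro: L2fun_square_integrable)
  show "AE p in leb_Q S T. norm (v p * w p) \<le> norm ((v p)\<^sup>2 + (w p)\<^sup>2)"
    using abs_mult_le_sum_squares by auto
  show "(\<lambda>p. v p * w p) \<in> borel_measurable (leb_Q S T)"
    using assms[THEN L2fun_measurable] by measurable
qed

lemma L2fun_add [intro]:
  assumes "v \<in> L2fun S T" "w \<in> L2fun S T"
  shows "(\<lambda>p. v p + w p) \<in> L2fun S T"
proof -
  have "integrable (leb_Q S T) (\<lambda>p. (v p)\<^sup>2 + 2 * (v p * w p) + (w p)\<^sup>2)"
    using assms by (intro Bochner_Integration.integrable_add integrable_mult_right
        L2fun_square_integrable L2fun_mult_integrable)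
  then show ?thesis
    using assms by (auto simp: L2fun_def power2_sum algebra_simps)
qed

lemma L2fun_scale [intro]: "v \<in> L2fun S T \<Longrightarrow> (\<lambda>p. c * v p) \<in> L2fun S T"
  by (auto simp: L2fun_def power_mult_distrib)

lemma L2fun_diff [intro]:
  "v \<in> L2fun S T \<Longrightarrow> w \<in> L2fun S T \<Longrightarrow> (\<lambda>p. v p - w p) \<in> L2fun S T"
  using L2fun_add[of v S T "\<lambda>p. (-1) * w p"] L2fun_scale[of w S T "-1"] by simp

lemma L2fun_zero [intro, simp]: "(\<lambda>p. 0) \<in> L2fun S T"
  by (simp add: L2fun_def)

lemma L2fun_sum [intro]:
  "(\<And>i. i \<in> A \<Longrightarrow> v i \<in> L2fun S T) \<Longrightarrow> (\<lambda>p. \<Sum>i\<in>A. v i p) \<in> L2fun S T"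
  by (induction A rule: infinite_finite_induct) auto

lemma L2fun_bounded_mult:
  assumes "v \<in> L2fun S T" "h \<in> borel_measurable (leb_Q S T)"
    "\<And>p. p \<in> Qrect S T \<Longrightarrow> \<bar>h p\<bar> \<le> B"
  shows "(\<lambda>p. v p * h p) \<in> L2fun S T"
proof -
  have "integrable (leb_Q S T) (\<lambda>p. (v p * h p)\<^sup>2)"
  proof (rule Bochner_Integration.integrable_bound)
    show "integrable (leb_Q S T) (\<lambda>p. B\<^sup>2 * (v p)\<^sup>2)"
      using assms(1) by (auto intro: L2fun_square_integrable)
    show "(\<lambda>p. (v p * h p)\<^sup>2) \<in> borel_measurable (leb_Q S T)"
      using assms(2) L2fun_measurable[OF assms(1)] by measurable
    have "(h p)\<^sup>2 \<le> B\<^sup>2" if "p \<in> Qrect S T" for p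
      using assms(3)[OF that] by (metis abs_ge_zero power2_abs power_mono)
    then show "AE p in leb_Q S T. norm ((v p * h p)\<^sup>2) \<le> norm (B\<^sup>2 * (v p)\<^sup>2)"
      by (auto simp: power_mult_distrib mult.commute[of "B\<^sup>2"] intro!: mult_left_mono)
  qed
  then show ?thesis
    using assms(2) L2fun_measurable[OF assms(1)] by (auto simp: L2fun_def)
qed

lemma L2fun_bounded:
  assumes "h \<in> borel_measurable (leb_Q S T)" "\<And>p. p \<in> Qrect S T \<Longrightarrow> \<bar>h p\<bar> \<le> B"
  shows "h \<in> L2fun S T"
proof -
  interpret finite_measure "leb_Q S T" by (rule finite_measure_leb_Q)
  have "(\<lambda>p. 1) \<in> L2fun S T" by (simp add: L2fun_def)
  from L2fun_bounded_mult[OF this assms] show ?thesis by simp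
qed

lemma L2inner_commute: "L2inner S T v w = L2inner S T w v"
  by (simp add: L2inner_def mult.commute)

lemma L2inner_add_left:
  "v \<in> L2fun S T \<Longrightarrow> v' \<in> L2fun S T \<Longrightarrow> w \<in> L2fun S T \<Longrightarrow>
    L2inner S T (\<lambda>p. v p + v' p) w = L2inner S T v w + L2inner S T v' w"
  by (simp add: L2inner_def distrib_right Bochner_Integration.integral_add L2fun_mult_integrable)

lemma L2inner_diff_left:
  "v \<in> L2fun S T \<Longrightarrow> v' \<in> L2fun S T \<Longrightarrow> w \<in> L2fun S T \<Longrightarrow>
    L2inner S T (\<lambda>p. v p - v' p) w = L2inner S T v w - L2inner S T v' w"
  by (simp add: L2inner_def left_diff_distrib Bochner_Integration.integral_diff L2fun_mult_integrable)

lemma L2inner_scale_left: "L2inner S T (\<lambda>p. c * v p) w = c * L2inner S T v w"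
  by (simp add: L2inner_def mult.assoc)

lemma L2inner_sum_left:
  "(\<And>i. i \<in> A \<Longrightarrow> v i \<in> L2fun S T) \<Longrightarrow> w \<in> L2fun S T \<Longrightarrow>
    L2inner S T (\<lambda>p. \<Sum>i\<in>A. v i p) w = (\<Sum>i\<in>A. L2inner S T (v i) w)"
proof (induction A rule: infinite_finite_induct)
  case (insert x F)
  then show ?case by (simp add: L2inner_add_left L2fun_sum)
qed (auto simp: L2inner_def)

lemma L2inner_self_nonneg: "0 \<le> L2inner S T v v"
  by (auto simp: L2inner_def intro!: integral_nonneg_AE)

lemma L2norm_nonneg [simp]: "0 \<le> L2norm S T v"
  by (simp add: L2norm_def L2inner_self_nonneg)

lemma L2norm_sq: "(L2norm S T v)\<^sup>2 = L2inner S T v v"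
  by (simp add: L2norm_def L2inner_self_nonneg)

lemma L2norm_sq_eq: "(L2norm S T v)\<^sup>2 = (LINT p|leb_Q S T. (v p)\<^sup>2)"
  unfolding L2norm_sq L2inner_def by (simp add: power2_eq_square)

lemma L2norm_sq_diff:
  assumes "v \<in> L2fun S T" "w \<in> L2fun S T"
  shows "(L2norm S T (\<lambda>p. v p - w p))\<^sup>2 =
    (L2norm S T v)\<^sup>2 - 2 * L2inner S T v w + (L2norm S T w)\<^sup>2"
proof -
  have "L2inner S T (\<lambda>p. v p - w p) (\<lambda>p. v p - w p) =
      L2inner S T v (\<lambda>p. v p - w p) - L2inner S T w (\<lambda>p. v p - w p)"
    using assms by (intro L2inner_diff_left) auto
  also have "\<dots> = L2inner S T v v - L2inner S T w v - (L2inner S T v w - L2inner S T w w)"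
    using assms by (simp add: L2inner_commute[of S T _ "\<lambda>p. v p - w p"] L2inner_diff_left)
  finally show ?thesis by (simp add: L2norm_sq L2inner_commute[of S T w v])
qed

lemma L2norm_minus_commute: "L2norm S T (\<lambda>p. v p - w p) = L2norm S T (\<lambda>p. w p - v p)"
proof -
  have "(v p - w p) * (v p - w p) = (w p - v p) * (w p - v p)" for p by algebra
  then show ?thesis by (simp only: L2norm_def L2inner_def)
qed

lemma L2norm_scale: "L2norm S T (\<lambda>p. c * v p) = \<bar>c\<bar> * L2norm S T v"
proof -
  have "L2inner S T (\<lambda>p. c * v p) (\<lambda>p. c * v p) = c\<^sup>2 * L2inner S T v v"
    by (simp add: L2inner_scale_left L2inner_commute[of S T v "\<lambda>p. c * v p"] power2_eq_square)
  then show ?thesis by (simp add: L2norm_def real_sqrt_mult)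
qed

lemma L2norm_cong_AE:
  assumes "v \<in> L2fun S T" "w \<in> L2fun S T" "AE p in leb_Q S T. v p = w p"
  shows "L2norm S T v = L2norm S T w"
  unfolding L2norm_def L2inner_def
  using assms(1,2)[THEN L2fun_measurable] assms(3)
  by (intro arg_cong[where f=sqrt] integral_cong_AE) auto

lemma L2norm_eq_0_iff:
  assumes "v \<in> L2fun S T"
  shows "L2norm S T v = 0 \<longleftrightarrow> (AE p in leb_Q S T. v p = 0)"
proof -
  have "L2norm S T v = 0 \<longleftrightarrow> (LINT p|leb_Q S T. (v p)\<^sup>2) = 0"
    using L2norm_sq_eq[of S T v] by (metis power2_eq_iff_nonneg power_zero_numeral zero_eq_power2)
  also have "\<dots> \<longleftrightarrow> (AE p in leb_Q S T. (v p)\<^sup>2 = 0)"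
    using assms by (intro integral_nonneg_eq_0_iff_AE) (auto intro: L2fun_square_integrable)
  finally show ?thesis by simp
qed

lemma L2_Cauchy_Schwarz:
  assumes v: "v \<in> L2fun S T" and w: "w \<in> L2fun S T"
  shows "\<bar>L2inner S T v w\<bar> \<le> L2norm S T v * L2norm S T w"
proof -
  let ?a = "L2inner S T v v" and ?b = "L2inner S T v w" and ?c = "L2inner S T w w"
  have *: "0 \<le> x\<^sup>2 * ?a - 2 * x * y * ?b + y\<^sup>2 * ?c" for x y
  proof -
    have "0 \<le> (L2norm S T (\<lambda>p. x * v p - y * w p))\<^sup>2" by simp
    also have "\<dots> = (L2norm S T (\<lambda>p. x * v p))\<^sup>2 - 2 * L2inner S T (\<lambda>p. x * v p) (\<lambda>p. y * w p)
        + (L2norm S T (\<lambda>p. y * w p))\<^sup>2"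
      using v w by (intro L2norm_sq_diff) auto
    also have "\<dots> = x\<^sup>2 * ?a - 2 * x * y * ?b + y\<^sup>2 * ?c"
      by (simp add: L2norm_scale power_mult_distrib L2inner_scale_left
          L2inner_commute[of S T v "\<lambda>p. y * w p"] L2inner_commute[of S T w v] L2norm_sq)
    finally show ?thesis .
  qed
  have "?b\<^sup>2 \<le> ?a * ?c"
  proof (cases "?a = 0")
    case True
    have "?b = 0"
    proof (rule ccontr)
      assume b: "?b \<noteq> 0"
      \<comment> \<open>With \<open>?a = 0\<close> the quadratic form is affine in \<open>x\<close>;
        at this \<open>x\<close> and \<open>y = 1\<close> it would take the value -1.\<close>
      have "2 * ((?c + 1) / (2 * ?b)) * ?b = ?c + 1"
        using b by (simp add: field_simps)
      moreover have "0 \<le> - (2 * ((?c + 1) / (2 * ?b)) * ?b) + ?c"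
        using *[of "(?c + 1) / (2 * ?b)" 1] unfolding True by (simp only: mult_zero_right power_one mult_1_left mult_1_right)
      ultimately show False by linarith
    qed
    then show ?thesis using True by simp
  next
    case False
    then have a: "?a > 0" using L2inner_self_nonneg[of S T v] by simp
    have "0 \<le> ?b\<^sup>2 * ?a - 2 * ?b * ?a * ?b + ?a\<^sup>2 * ?c" using *[of ?b ?a] .
    also have "\<dots> = ?a * (?a * ?c - ?b\<^sup>2)" by (simp add: power2_eq_square algebra_simps)
    finally show ?thesis using a by (simp add: zero_le_mult_iff)
  qed
  then show ?thesis
    by (metis L2norm_def real_sqrt_abs real_sqrt_le_mono real_sqrt_mult)
qed

lemma L2norm_triangle:
  assumes v: "v \<in> L2fun S T" and w: "w \<in> L2fun S T"
  shows "L2norm S T (\<lambda>p. v p + w p) \<le> L2norm S T v + L2norm S T w"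
proof (rule power2_le_imp_le)
  have "(L2norm S T (\<lambda>p. v p - (-1) * w p))\<^sup>2 =
      (L2norm S T v)\<^sup>2 + 2 * L2inner S T v w + (L2norm S T w)\<^sup>2"
    using L2norm_sq_diff[OF v L2fun_scale[OF w, of "-1"]]
    by (simp add: L2inner_commute[of S T v] L2inner_scale_left[of S T "-1", simplified]
        L2norm_scale[of S T "-1", simplified])
  also have "\<dots> \<le> (L2norm S T v + L2norm S T w)\<^sup>2"
    using L2_Cauchy_Schwarz[OF v w] by (simp add: power2_sum)
  finally show "(L2norm S T (\<lambda>p. v p + w p))\<^sup>2 \<le> (L2norm S T v + L2norm S T w)\<^sup>2" by simp
qed simp

lemma L2norm_diff_triangle:
  assumes "u \<in> L2fun S T" "v \<in> L2fun S T" "w \<in> L2fun S T"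
  shows "L2norm S T (\<lambda>p. u p - w p) \<le> L2norm S T (\<lambda>p. u p - v p) + L2norm S T (\<lambda>p. v p - w p)"
  using L2norm_triangle[of "\<lambda>p. u p - v p" S T "\<lambda>p. v p - w p"] assms by auto

lemma L2norm_reverse_triangle:
  assumes "v \<in> L2fun S T" "w \<in> L2fun S T"
  shows "\<bar>L2norm S T v - L2norm S T w\<bar> \<le> L2norm S T (\<lambda>p. v p - w p)"
proof -
  have "L2norm S T (\<lambda>p. a p) \<le> L2norm S T (\<lambda>p. a p - b p) + L2norm S T b"
    if "a \<in> L2fun S T" "b \<in> L2fun S T" for a b
    using L2norm_triangle[of "\<lambda>p. a p - b p" S T b] that by auto
  from this[OF assms] this[OF assms(2,1)] show ?thesis
    by (simp add: L2norm_minus_commute[of S T w v])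
qed

lemma L2norm_bounded_mult:
  assumes "v \<in> L2fun S T" "h \<in> borel_measurable (leb_Q S T)"
    "\<And>p. p \<in> Qrect S T \<Longrightarrow> \<bar>h p\<bar> \<le> B" "0 \<le> B"
  shows "L2norm S T (\<lambda>p. v p * h p) \<le> B * L2norm S T v"
proof (rule power2_le_imp_le)
  have "(v p * h p)\<^sup>2 \<le> B\<^sup>2 * (v p)\<^sup>2" if "p \<in> Qrect S T" for p
  proof -
    have "(h p)\<^sup>2 \<le> B\<^sup>2" using assms(3)[OF that] by (metis abs_ge_zero power2_abs power_mono)
    then show ?thesis
      by (simp add: power_mult_distrib mult.commute[of "B\<^sup>2"] mult_left_mono)
  qed
  then have "(LINT p|leb_Q S T. (v p * h p)\<^sup>2) \<le> (LINT p|leb_Q S T. B\<^sup>2 * (v p)\<^sup>2)"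
    using assms by (intro integral_mono integrable_mult_right L2fun_square_integrable
        L2fun_bounded_mult) auto
  then show "(L2norm S T (\<lambda>p. v p * h p))\<^sup>2 \<le> (B * L2norm S T v)\<^sup>2"
    by (simp add: L2norm_sq_eq power_mult_distrib)
qed (use assms in simp)

lemma nn_integral_square_L2:
  assumes "v \<in> L2fun S T"
  shows "(\<integral>\<^sup>+p. ennreal ((v p)\<^sup>2) \<partial>leb_Q S T) = ennreal ((L2norm S T v)\<^sup>2)"
  unfolding L2norm_sq_eq
  by (rule nn_integral_eq_integral) (use assms in \<open>auto intro: L2fun_square_integrable\<close>)

lemma L2fun_nn_integralI:
  assumes "v \<in> borel_measurable (leb_Q S T)" "(\<integral>\<^sup>+p. ennreal ((v p)\<^sup>2) \<partial>leb_Q S T) < \<infinity>"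
  shows "v \<in> L2fun S T"
  using assms by (auto simp: L2fun_def intro!: integrableI_bounded)

text \<open>Riesz--Fischer. A subsequence with increments below \<open>(1/2)^k\<close> in norm has
  summable increments in \<open>L^1\<close>, because \<open>Q\<close> has finite measure, and so
  converges almost everywhere. Fatou's lemma then bounds the distance of every late
  \<open>w n\<close> to this limit.\<close>

lemma L2_complete:
  assumes w: "\<And>n. w n \<in> L2fun S T"
    and cauchy: "\<And>e. e > 0 \<Longrightarrow> \<exists>N. \<forall>m\<ge>N. \<forall>n\<ge>N. L2norm S T (\<lambda>p. w m p - w n p) < e"
  shows "\<exists>v\<in>L2fun S T. (\<lambda>n. L2norm S T (\<lambda>p. w n p - v p)) \<longlonglongrightarrow> 0"
proof -
  interpret finite_measure "leb_Q S T" by (rule finite_measure_leb_Q)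
  let ?M = "leb_Q S T" and ?N = "L2norm S T"
  note wm [measurable] = w[THEN L2fun_measurable]
  have one: "(\<lambda>p. 1) \<in> L2fun S T" by (simp add: L2fun_def)
  have "\<exists>N. \<forall>m\<ge>N. \<forall>n\<ge>N. ?N (\<lambda>p. w m p - w n p) < (1/2)^k" for k :: nat
    using cauchy[of "(1/2)^k"] by simp
  then obtain N where N: "\<And>k m n. m \<ge> N k \<Longrightarrow> n \<ge> N k \<Longrightarrow> ?N (\<lambda>p. w m p - w n p) < (1/2)^k"
    by metis
  \<comment> \<open>The sum makes \<open>r\<close> monotone and at least \<open>N k\<close>; the
    extra \<open>k\<close> drives it to infinity, so that Fatou's lemma can use any threshold
    \<open>n0\<close>.\<close>
  define r where "r k = (\<Sum>i\<le>k. N i) + k" for k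
  have rN: "r k \<ge> N k" for k
    unfolding r_def by (simp add: le_add1 member_le_sum trans_le_add1)
  have rmono: "r k \<le> r (Suc k)" for k by (simp add: r_def)
  have rk: "r k \<ge> k" for k by (simp add: r_def)
  let ?D = "\<lambda>k p. w (r (Suc k)) p - w (r k) p"
  have D: "(\<integral>\<^sup>+p. ennreal \<bar>?D k p\<bar> \<partial>?M) \<le> ennreal (?N (\<lambda>p. 1) * (1/2)^k)" for k
  proof -
    have i: "(\<lambda>p. \<bar>?D k p\<bar>) \<in> L2fun S T"
      using L2fun_diff[OF w[of "r (Suc k)"] w[of "r k"]] by (auto simp: L2fun_def)
    have "(\<integral>\<^sup>+p. ennreal \<bar>?D k p\<bar> \<partial>?M) = ennreal (LINT p|?M. \<bar>?D k p\<bar>)"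
      using L2fun_mult_integrable[OF i one] by (intro nn_integral_eq_integral) auto
    also have "(LINT p|?M. \<bar>?D k p\<bar>) \<le> ?N (\<lambda>p. \<bar>?D k p\<bar>) * ?N (\<lambda>p. 1)"
      using L2_Cauchy_Schwarz[OF i one] by (simp add: L2inner_def)
    also have "?N (\<lambda>p. \<bar>?D k p\<bar>) = ?N (?D k)" by (simp add: L2norm_def L2inner_def)
    also have "?N (?D k) * ?N (\<lambda>p. 1) \<le> (1/2)^k * ?N (\<lambda>p. 1)"
      using N[where k=k, of "r (Suc k)" "r k"] rN[of k] rmono[of k]
      by (intro mult_right_mono) auto
    finally show ?thesis by (simp add: mult.commute ennreal_leI)
  qed
  have "(\<integral>\<^sup>+p. (\<Sum>k. ennreal \<bar>?D k p\<bar>) \<partial>?M) = (\<Sum>k. \<integral>\<^sup>+p. ennreal \<bar>?D k p\<bar> \<partial>?M)"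
    by (rule nn_integral_suminf) measurable
  also have "\<dots> \<le> (\<Sum>k. ennreal (?N (\<lambda>p. 1) * (1/2)^k))"
    using D by (intro suminf_le) auto
  also have "\<dots> = ennreal (\<Sum>k. ?N (\<lambda>p. 1) * (1/2)^k)"
    by (intro suminf_ennreal_eq summable_sums summable_mult) auto
  also have "\<dots> < \<infinity>" by simp
  finally have fin: "(\<integral>\<^sup>+p. (\<Sum>k. ennreal \<bar>?D k p\<bar>) \<partial>?M) \<noteq> \<infinity>" by simp
  have "AE p in ?M. (\<Sum>k. ennreal \<bar>?D k p\<bar>) \<noteq> \<infinity>"
    using fin by (intro nn_integral_PInf_AE) measurable
  then have conv: "AE p in ?M. convergent (\<lambda>k. w (r k) p)"
  proof eventually_elim
    case (elim p)
    have "summable (\<lambda>k. \<bar>?D k p\<bar>)"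
      using elim by (intro summable_suminf_not_top) auto
    then have "summable (\<lambda>k. ?D k p)" by (rule summable_rabs_cancel)
    then have "convergent (\<lambda>n. \<Sum>k<n. ?D k p)" by (simp add: summable_iff_convergent)
    also have "(\<lambda>n. \<Sum>k<n. ?D k p) = (\<lambda>n. w (r n) p - w (r 0) p)"
      by (rule ext) (rule sum_lessThan_telescope)
    finally have "convergent (\<lambda>n. (w (r n) p - w (r 0) p) + w (r 0) p)"
      by (intro convergent_add convergent_const)
    then show ?case by simp
  qed
  define v where "v p = lim (\<lambda>k. w (r k) p)" for p
  have vm [measurable]: "v \<in> borel_measurable ?M"
    unfolding v_def by measurable
  have fatou: "(\<integral>\<^sup>+p. ennreal ((w n p - v p)\<^sup>2) \<partial>?M) \<le> ennreal (e\<^sup>2)"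
    if "e > 0" and le: "\<And>m. m \<ge> n0 \<Longrightarrow> ?N (\<lambda>p. w n p - w m p) < e" for n n0 e
  proof -
    have "(\<integral>\<^sup>+p. ennreal ((w n p - v p)\<^sup>2) \<partial>?M) =
        (\<integral>\<^sup>+p. liminf (\<lambda>k. ennreal ((w n p - w (r k) p)\<^sup>2)) \<partial>?M)"
    proof (intro nn_integral_cong_AE, use conv in eventually_elim)
      case (elim p)
      then have "(\<lambda>k. w (r k) p) \<longlonglongrightarrow> v p" by (simp add: v_def convergent_LIMSEQ_iff)
      then have "(\<lambda>k. ennreal ((w n p - w (r k) p)\<^sup>2)) \<longlonglongrightarrow> ennreal ((w n p - v p)\<^sup>2)"
        by (intro tendsto_ennrealI tendsto_intros)
      then show ?case by (intro lim_imp_Liminf[symmetric]) auto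
    qed
    also have "\<dots> \<le> liminf (\<lambda>k. \<integral>\<^sup>+p. ennreal ((w n p - w (r k) p)\<^sup>2) \<partial>?M)"
      by (rule nn_integral_liminf) measurable
    also have "\<dots> \<le> liminf (\<lambda>k. ennreal (e\<^sup>2))"
    proof (rule Liminf_mono, rule eventually_sequentiallyI[of n0])
      fix k assume "n0 \<le> k"
      then have "?N (\<lambda>p. w n p - w (r k) p) < e" using le[of "r k"] rk[of k] by simp
      then have "(?N (\<lambda>p. w n p - w (r k) p))\<^sup>2 \<le> e\<^sup>2" by (intro power_mono) auto
      then show "(\<integral>\<^sup>+p. ennreal ((w n p - w (r k) p)\<^sup>2) \<partial>?M) \<le> ennreal (e\<^sup>2)"
        using nn_integral_square_L2[OF L2fun_diff[OF w w], of n "r k"] by (simp add: ennreal_leI)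
    qed
    also have "\<dots> = ennreal (e\<^sup>2)" by (simp add: Liminf_const)
    finally show ?thesis .
  qed
  have diffL2: "(\<lambda>p. w n p - v p) \<in> L2fun S T" if "n \<ge> N 0" for n
    using fatou[of 1 "N 0" n] N[where k=0, OF that]
    by (intro L2fun_nn_integralI) (measurable, auto intro: le_less_trans)
  have v: "v \<in> L2fun S T"
    using L2fun_diff[OF w diffL2[of "N 0"], of "N 0"] by simp
  moreover have "(\<lambda>n. ?N (\<lambda>p. w n p - v p)) \<longlonglongrightarrow> 0"
  proof (rule LIMSEQ_I)
    fix e :: real assume e: "e > 0"
    then obtain N' where N': "\<And>m n. m \<ge> N' \<Longrightarrow> n \<ge> N' \<Longrightarrow> ?N (\<lambda>p. w m p - w n p) < e/2"
      using cauchy[of "e/2"] by auto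
    have "?N (\<lambda>p. w n p - v p) < e" if "n \<ge> N'" for n
    proof -
      have "ennreal ((?N (\<lambda>p. w n p - v p))\<^sup>2) \<le> ennreal ((e/2)\<^sup>2)"
        using fatou[of "e/2" N' n] N'[OF that] e
          nn_integral_square_L2[OF L2fun_diff[OF w v], of n] by auto
      then have "(?N (\<lambda>p. w n p - v p))\<^sup>2 \<le> (e/2)\<^sup>2" by (simp add: ennreal_le_iff)
      then have "?N (\<lambda>p. w n p - v p) \<le> e/2" using e power2_le_imp_le[of _ "e/2"] by simp
      then show ?thesis using e by simp
    qed
    then show "\<exists>no. \<forall>n\<ge>no. norm (?N (\<lambda>p. w n p - v p) - 0) < e" by auto
  qed
  ultimately show ?thesis by blast
qed

section \<open>Orthonormal expansions in \<open>L^2(Q)\<close>\<close>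

context
  fixes S T :: real and \<phi> :: "nat \<Rightarrow> pt \<Rightarrow> real"
  assumes onb: "complete_orthonormal_bv S T \<phi>"
begin

lemma onb_L2 [intro]: "\<phi> n \<in> L2fun S T"
  using onb by (simp add: complete_orthonormal_bv_def)

lemma onb_bv: "bv_hk S T (\<phi> n)"
  using onb by (simp add: complete_orthonormal_bv_def)

lemma onb_inner: "L2inner S T (\<phi> i) (\<phi> j) = (if i = j then 1 else 0)"
  using onb unfolding complete_orthonormal_bv_def by blast

lemma onb_complete:
  "v \<in> L2fun S T \<Longrightarrow> (\<And>n. L2inner S T v (\<phi> n) = 0) \<Longrightarrow> AE p in leb_Q S T. v p = 0"
  using onb unfolding complete_orthonormal_bv_def by blast

lemma L2norm_onb_sum:
  assumes "finite A"
  shows "(L2norm S T (\<lambda>p. \<Sum>j\<in>A. c j * \<phi> j p))\<^sup>2 = (\<Sum>j\<in>A. (c j)\<^sup>2)"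
proof -
  have mem: "(\<lambda>p. \<Sum>j\<in>A. c j * \<phi> j p) \<in> L2fun S T"
    by (intro L2fun_sum L2fun_scale onb_L2)
  have "L2inner S T (\<lambda>p. \<Sum>j\<in>A. c j * \<phi> j p) (\<phi> i) = (if i \<in> A then c i else 0)" for i
    using assms by (simp add: L2inner_sum_left L2fun_scale onb_L2 L2inner_scale_left onb_inner
        if_distrib[of "\<lambda>x. _ * x"] cong: if_cong)
  then show ?thesis
    using mem unfolding L2norm_sq
    by (subst L2inner_sum_left) (auto simp: L2inner_scale_left power2_eq_square
        L2inner_commute[of S T "\<phi> _"] intro!: sum.cong)
qed

lemma bessel:
  assumes v: "v \<in> L2fun S T"
  shows "(\<Sum>j<n. (L2inner S T v (\<phi> j))\<^sup>2) \<le> (L2norm S T v)\<^sup>2"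
proof -
  let ?c = "\<lambda>j. L2inner S T v (\<phi> j)"
  let ?P = "\<lambda>p. \<Sum>j<n. ?c j * \<phi> j p"
  have "L2inner S T ?P v = (\<Sum>j<n. (?c j)\<^sup>2)"
    using v by (subst L2inner_sum_left)
      (auto simp: L2inner_scale_left power2_eq_square L2inner_commute[of S T "\<phi> _"])
  moreover have "?P \<in> L2fun S T" by (intro L2fun_sum L2fun_scale onb_L2)
  moreover have "L2inner S T v ?P = L2inner S T ?P v" by (rule L2inner_commute)
  ultimately have "(L2norm S T (\<lambda>p. v p - ?P p))\<^sup>2 = (L2norm S T v)\<^sup>2 - (\<Sum>j<n. (?c j)\<^sup>2)"
    using L2norm_sq_diff[OF v, of ?P] by (simp add: L2norm_onb_sum)
  then show ?thesis
    using zero_le_power2[of "L2norm S T (\<lambda>p. v p - ?P p)"] by linarith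
qed

lemma summable_fourier_coeffs:
  assumes "v \<in> L2fun S T"
  shows "summable (\<lambda>j. (L2inner S T v (\<phi> j))\<^sup>2)"
  using bessel[OF assms] by (intro summableI_nonneg_bounded) auto

text \<open>The partial sums are Cauchy by Bessel's inequality and have a limit \<open>w\<close> by
  completeness of the space. Since \<open>v\<close> and \<open>w\<close> have the same coefficients,
  completeness of the system identifies them almost everywhere.\<close>

lemma fourier_converges:
  assumes v: "v \<in> L2fun S T"
  shows "(\<lambda>n. L2norm S T (\<lambda>p. (\<Sum>j<n. L2inner S T v (\<phi> j) * \<phi> j p) - v p)) \<longlonglongrightarrow> 0"
proof -
  let ?c = "\<lambda>j. L2inner S T v (\<phi> j)"
  let ?P = "\<lambda>n p. \<Sum>j<n. ?c j * \<phi> j p"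
  have P: "?P n \<in> L2fun S T" for n by (intro L2fun_sum L2fun_scale onb_L2)
  have diff: "(L2norm S T (\<lambda>p. ?P n p - ?P m p))\<^sup>2 = (\<Sum>j=m..<n. (?c j)\<^sup>2)" if "m \<le> n" for m n
  proof -
    have "(\<lambda>p. ?P n p - ?P m p) = (\<lambda>p. \<Sum>j\<in>{m..<n}. ?c j * \<phi> j p)"
      using that by (auto simp: fun_eq_iff lessThan_atLeast0 sum_diff_nat_ivl)
    then show ?thesis by (simp add: L2norm_onb_sum)
  qed
  have cauchy: "\<exists>N. \<forall>m\<ge>N. \<forall>n\<ge>N. L2norm S T (\<lambda>p. ?P m p - ?P n p) < e" if "e > 0" for e
  proof -
    obtain N where N: "\<And>m n. m \<ge> N \<Longrightarrow> norm (\<Sum>j=m..<n. (?c j)\<^sup>2) < e\<^sup>2"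
      using summable_fourier_coeffs[OF v] \<open>e > 0\<close> unfolding summable_Cauchy
      by (metis zero_less_power)
    have *: "L2norm S T (\<lambda>p. ?P n p - ?P m p) < e" if "N \<le> m" "m \<le> n" for m n
    proof -
      have "(L2norm S T (\<lambda>p. ?P n p - ?P m p))\<^sup>2 < e\<^sup>2"
        using N[OF that(1), of n] diff[OF that(2)] by simp
      then show ?thesis using \<open>e > 0\<close> by (simp add: power2_less_imp_less)
    qed
    show ?thesis
    proof (intro exI[of _ N] allI impI)
      fix m n assume "N \<le> m" "N \<le> n"
      then show "L2norm S T (\<lambda>p. ?P m p - ?P n p) < e"
        using *[of m n] *[of n m] L2norm_minus_commute[of S T "?P m" "?P n"]
        by (cases "m \<le> n") auto
    qed
  qed
  obtain w where w: "w \<in> L2fun S T" and lim: "(\<lambda>n. L2norm S T (\<lambda>p. ?P n p - w p)) \<longlonglongrightarrow> 0"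
    using L2_complete[OF P cauchy] by blast
  have "L2inner S T (\<lambda>p. v p - w p) (\<phi> i) = 0" for i
  proof -
    have "(\<lambda>n. L2inner S T (\<lambda>p. ?P n p - w p) (\<phi> i)) \<longlonglongrightarrow> 0"
    proof (rule Lim_null_comparison[OF always_eventually])
      show "\<forall>n. norm (L2inner S T (\<lambda>p. ?P n p - w p) (\<phi> i)) \<le> L2norm S T (\<lambda>p. ?P n p - w p) * L2norm S T (\<phi> i)"
        using P w by (auto intro!: L2_Cauchy_Schwarz)
      show "(\<lambda>n. L2norm S T (\<lambda>p. ?P n p - w p) * L2norm S T (\<phi> i)) \<longlonglongrightarrow> 0"
        using lim by (rule tendsto_mult_left_zero)
    qed
    \<comment> \<open>From index \<open>Suc i\<close> on, the partial sum contains
      \<open>\<phi> i\<close>, so its \<open>i\<close>-th coefficient is already that of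
      \<open>v\<close>.\<close>
    moreover have "\<forall>\<^sub>F n in sequentially. L2inner S T (\<lambda>p. ?P n p - w p) (\<phi> i) = L2inner S T (\<lambda>p. v p - w p) (\<phi> i)"
    proof (rule eventually_sequentiallyI[of "Suc i"])
      fix n assume "Suc i \<le> n"
      then have "L2inner S T (?P n) (\<phi> i) = ?c i"
        by (simp add: L2inner_sum_left L2fun_scale onb_L2 L2inner_scale_left onb_inner
            if_distrib[of "\<lambda>x. _ * x"] cong: if_cong)
      then show "L2inner S T (\<lambda>p. ?P n p - w p) (\<phi> i) = L2inner S T (\<lambda>p. v p - w p) (\<phi> i)"
        using P v w by (simp add: L2inner_diff_left onb_L2)
    qed
    ultimately have "(\<lambda>n::nat. L2inner S T (\<lambda>p. v p - w p) (\<phi> i)) \<longlonglongrightarrow> 0"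
      by (rule Lim_transform_eventually)
    then show ?thesis by (simp add: LIMSEQ_const_iff)
  qed
  then have "AE p in leb_Q S T. v p - w p = 0"
    using v w by (intro onb_complete) auto
  then have "L2norm S T (\<lambda>p. ?P n p - w p) = L2norm S T (\<lambda>p. ?P n p - v p)" for n
    using P v w by (intro L2norm_cong_AE) auto
  then show ?thesis using lim by simp
qed

end

section \<open>Classes modulo null sets: metric and Borel structure\<close>

lemma equiv_L2eq: "equiv (L2fun S T) (L2eq S T)"
proof (rule equivI)
  show "L2eq S T \<subseteq> L2fun S T \<times> L2fun S T" "refl_on (L2fun S T) (L2eq S T)"
    by (auto simp: L2eq_def refl_on_def)
  show "sym (L2eq S T)"
    by (rule symI) (auto simp: L2eq_def elim: eventually_mono)
  show "trans (L2eq S T)"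
  proof (rule transI)
    fix u v w assume "(u, v) \<in> L2eq S T" "(v, w) \<in> L2eq S T"
    then have ae: "AE p in leb_Q S T. u p = v p" "AE p in leb_Q S T. v p = w p"
      and m: "u \<in> L2fun S T" "w \<in> L2fun S T"
      by (simp_all add: L2eq_def)
    from ae have "AE p in leb_Q S T. u p = w p" by eventually_elim simp
    with m show "(u, w) \<in> L2eq S T" by (simp add: L2eq_def)
  qed
qed

lemma L2rep_mem: "u \<in> L2 S T \<Longrightarrow> L2rep u \<in> u"
  unfolding L2rep_def L2_def using in_quotient_imp_non_empty[OF equiv_L2eq]
  by (metis ex_in_conv someI)

lemma L2rep_L2fun: "u \<in> L2 S T \<Longrightarrow> L2rep u \<in> L2fun S T"
  using L2rep_mem[of u S T] in_quotient_imp_subset[OF equiv_L2eq, of u S T] by (auto simp: L2_def)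

lemma L2_eq_iff:
  assumes "u \<in> L2 S T" "w \<in> L2 S T"
  shows "u = w \<longleftrightarrow> (AE p in leb_Q S T. L2rep u p = L2rep w p)"
  using quotient_eq_iff[OF equiv_L2eq, of u S T w "L2rep u" "L2rep w"] assms
    L2rep_mem[OF assms(1)] L2rep_mem[OF assms(2)] L2rep_L2fun[OF assms(1)] L2rep_L2fun[OF assms(2)]
  by (auto simp: L2_def L2eq_def)

lemma Metric_space_L2: "Metric_space (L2 S T) (L2dist S T)"
proof
  fix u w z
  show "0 \<le> L2dist S T u w" by (simp add: L2dist_def)
  show "L2dist S T u w = L2dist S T w u" unfolding L2dist_def by (rule L2norm_minus_commute)
  assume u: "u \<in> L2 S T" and w: "w \<in> L2 S T"
  show "L2dist S T u w = 0 \<longleftrightarrow> u = w"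
    using L2norm_eq_0_iff[OF L2fun_diff[OF L2rep_L2fun[OF u] L2rep_L2fun[OF w]]]
    by (simp add: L2dist_def L2_eq_iff[OF u w])
  assume z: "z \<in> L2 S T"
  show "L2dist S T u z \<le> L2dist S T u w + L2dist S T w z"
    unfolding L2dist_def using u w z by (intro L2norm_diff_triangle L2rep_L2fun)
qed

lemma space_L2borel [simp]: "space (L2borel S T) = L2 S T"
  by (simp add: L2borel_def space_measure_of_conv)

text \<open>The representative \<open>L2rep\<close> is an arbitrary choice, so measurability in
  \<open>u\<close> has to come from quantities that respect the metric of the quotient. Fourier
  coefficients and the norm of \<open>u h\<close> are Lipschitz, and everything else is built from
  these.\<close>

lemma L2borel_measurable_Lipschitz:
  fixes k :: "(pt \<Rightarrow> real) set \<Rightarrow> real"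
  assumes "\<And>u w. u \<in> L2 S T \<Longrightarrow> w \<in> L2 S T \<Longrightarrow> \<bar>k u - k w\<bar> \<le> C * L2dist S T u w"
  shows "k \<in> borel_measurable (L2borel S T)"
proof (rule borel_measurableI)
  interpret Metric_space "L2 S T" "L2dist S T" by (rule Metric_space_L2)
  fix U :: "real set" assume U: "open U"
  have "openin mtopology (k -` U \<inter> L2 S T)"
    unfolding openin_mtopology
  proof (intro conjI allI impI)
    fix u assume u: "u \<in> k -` U \<inter> L2 S T"
    then obtain e where e: "e > 0" "ball (k u) e \<subseteq> U" using U by (auto simp: open_contains_ball)
    \<comment> \<open>The denominator is positive whatever the sign of \<open>C\<close>, and also
      for \<open>C = 0\<close>.\<close>
    have "mball u (e / (\<bar>C\<bar> + 1)) \<subseteq> k -` U \<inter> L2 S T"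
    proof
      fix w assume w: "w \<in> mball u (e / (\<bar>C\<bar> + 1))"
      then have wL: "w \<in> L2 S T" and d: "L2dist S T u w < e / (\<bar>C\<bar> + 1)" by auto
      have "\<bar>k u - k w\<bar> \<le> C * L2dist S T u w" using assms u wL by auto
      also have "\<dots> \<le> (\<bar>C\<bar> + 1) * L2dist S T u w" by (intro mult_right_mono) auto
      also have "\<dots> < e" using d by (simp add: pos_less_divide_eq mult.commute)
      finally have "k w \<in> ball (k u) e" by (simp add: dist_real_def)
      then show "w \<in> k -` U \<inter> L2 S T" using e wL by auto
    qed
    moreover have "e / (\<bar>C\<bar> + 1) > 0" using e by (intro divide_pos_pos) auto
    ultimately show "\<exists>r>0. mball u r \<subseteq> k -` U \<inter> L2 S T" by blast
  qed auto
  then show "k -` U \<inter> space (L2borel S T) \<in> sets (L2borel S T)"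
    unfolding space_L2borel unfolding L2borel_def
    by (subst sets_measure_of) (auto intro: sigma_sets.Basic dest: openin_subset[THEN subsetD])
qed

lemma measurable_L2inner_rep [measurable]:
  assumes "w \<in> L2fun S T"
  shows "(\<lambda>u. L2inner S T (L2rep u) w) \<in> borel_measurable (L2borel S T)"
proof (rule L2borel_measurable_Lipschitz[where C="L2norm S T w"])
  fix u v assume u: "u \<in> L2 S T" "v \<in> L2 S T"
  have "\<bar>L2inner S T (L2rep u) w - L2inner S T (L2rep v) w\<bar> =
      \<bar>L2inner S T (\<lambda>p. L2rep u p - L2rep v p) w\<bar>"
    using u assms by (simp add: L2inner_diff_left L2rep_L2fun)
  also have "\<dots> \<le> L2norm S T w * L2dist S T u v"
    using L2_Cauchy_Schwarz[OF L2fun_diff[OF u[THEN L2rep_L2fun]] assms]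
    by (simp add: L2dist_def mult.commute)
  finally show "\<bar>L2inner S T (L2rep u) w - L2inner S T (L2rep v) w\<bar> \<le> L2norm S T w * L2dist S T u v" .
qed

lemma measurable_L2norm_mult:
  assumes "h \<in> borel_measurable (leb_Q S T)" "\<And>p. p \<in> Qrect S T \<Longrightarrow> \<bar>h p\<bar> \<le> B" "0 \<le> B"
  shows "(\<lambda>u. L2norm S T (\<lambda>p. L2rep u p * h p)) \<in> borel_measurable (L2borel S T)"
proof (rule L2borel_measurable_Lipschitz[where C=B])
  fix u v assume u: "u \<in> L2 S T" "v \<in> L2 S T"
  have "\<bar>L2norm S T (\<lambda>p. L2rep u p * h p) - L2norm S T (\<lambda>p. L2rep v p * h p)\<bar>
      \<le> L2norm S T (\<lambda>p. L2rep u p * h p - L2rep v p * h p)"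
    using u assms by (intro L2norm_reverse_triangle L2fun_bounded_mult L2rep_L2fun)
  also have "\<dots> = L2norm S T (\<lambda>p. (L2rep u p - L2rep v p) * h p)" by (simp add: left_diff_distrib)
  also have "\<dots> \<le> B * L2dist S T u v"
    unfolding L2dist_def using u assms by (intro L2norm_bounded_mult L2fun_diff L2rep_L2fun) auto
  finally show "\<bar>L2norm S T (\<lambda>p. L2rep u p * h p) - L2norm S T (\<lambda>p. L2rep v p * h p)\<bar> \<le> B * L2dist S T u v" .
qed

section \<open>Functions of bounded variation\<close>

lemma is_partition_nonneg: "is_partition L n s \<Longrightarrow> i \<le> n \<Longrightarrow> 0 \<le> s i"
  by (induction i) (auto simp: is_partition_def Suc_le_eq intro: order_trans less_imp_le)

lemma is_partition_mono: "is_partition L n s \<Longrightarrow> i \<le> j \<Longrightarrow> j \<le> n \<Longrightarrow> s i \<le> s j"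
  by (induction j) (auto simp: is_partition_def Suc_le_eq le_Suc_eq intro: order_trans less_imp_le)

lemma is_partition_le: "is_partition L n s \<Longrightarrow> i \<le> n \<Longrightarrow> s i \<le> L"
  using is_partition_mono[of L n s i n] by (auto simp: is_partition_def)

lemma is_partition_telescope:
  "is_partition L n s \<Longrightarrow> (\<Sum>i<n. f (s (Suc i)) - f (s i)) = (f L - f 0 :: real)"
  by (simp add: sum_lessThan_telescope[of "\<lambda>i. f (s i)"] is_partition_def)

lemma is_partition_append:
  assumes "is_partition L n s" "L \<le> L'"
  shows "is_partition L' (Suc n) (s(Suc n := L'))"
  using assms by (auto simp: is_partition_def less_Suc_eq)

lemma sum_partition_append:
  fixes F :: "real \<Rightarrow> real \<Rightarrow> real"
  assumes "is_partition L n s"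
  shows "(\<Sum>i<Suc n. F ((s(Suc n := L')) i) ((s(Suc n := L')) (Suc i))) =
    (\<Sum>i<n. F (s i) (s (Suc i))) + F L L'"
  using assms by (auto simp: is_partition_def)

text \<open>The first half of \<open>t'\<close> stops at \<open>c\<close>, the second half starts there. The repeated points that
  arise are harmless, since partitions need not be strictly increasing.\<close>

lemma partition_insert:
  assumes t: "is_partition L n t" and c: "0 \<le> c" "c \<le> L"
  defines "t' \<equiv> \<lambda>j. if j \<le> n then min (t j) c else max (t (j - n)) c"
  shows "is_partition L (n + n) t'"
    and "\<And>F. F c c = 0 \<Longrightarrow> (\<And>a b. 0 \<le> F a b) \<Longrightarrow> (\<And>a b d. F a d \<le> F a b + F b d) \<Longrightarrow>
      (\<Sum>j<n. F (t j) (t (Suc j))) \<le> (\<Sum>j<n+n. F (t' j) (t' (Suc j)) :: real)"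
    and "\<And>F. (\<And>a b. 0 \<le> F a b) \<Longrightarrow> (\<And>a b d. F a d \<le> F a b + F b d) \<Longrightarrow> F 0 0 = 0 \<Longrightarrow>
      F 0 c \<le> (\<Sum>j<n+n. F (t' j) (t' (Suc j)) :: real)"
proof -
  have tn: "t n = L" "t 0 = 0" using t by (auto simp: is_partition_def)
  have lo: "t' j = min (t j) c" if "j \<le> n" for j using that by (simp add: t'_def)
  \<comment> \<open>At \<open>j = 0\<close> both branches agree: the first half ends in
    \<open>min L c = c\<close>, the second begins with \<open>max 0 c = c\<close>.\<close>
  have hi: "t' (n + j) = max (t j) c" for j
    using tn c by (cases j) (auto simp: t'_def)
  have split: "(\<Sum>j<n+n. F (t' j) (t' (Suc j))) =
      (\<Sum>j<n. F (min (t j) c) (min (t (Suc j)) c)) + (\<Sum>j<n. F (max (t j) c) (max (t (Suc j)) c))"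
    for F :: "real \<Rightarrow> real \<Rightarrow> real"
  proof -
    have "(\<Sum>j<n+n. F (t' j) (t' (Suc j))) =
        (\<Sum>j<n. F (t' j) (t' (Suc j))) + (\<Sum>j<n. F (t' (n + j)) (t' (n + Suc j)))"
      by (simp add: sum.atLeastLessThan_concat[of 0 n "n+n", symmetric] lessThan_atLeast0
          sum.shift_bounds_nat_ivl[of _ 0 n n, simplified] add.commute)
    then show ?thesis by (simp add: lo hi del: add_Suc_right)
  qed
  show "is_partition L (n + n) t'"
    unfolding is_partition_def
  proof (intro conjI allI impI)
    show "t' 0 = 0" using tn c by (simp add: lo)
    show "t' (n + n) = L" using tn c by (simp add: hi)
    fix i assume i: "i < n + n"
    show "t' i \<le> t' (Suc i)"
    proof (cases "i < n")
      case True
      then have "t i \<le> t (Suc i)" using t by (auto simp: is_partition_def)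
      then show ?thesis using True by (auto simp: lo min_def)
    next
      case False
      then obtain k where k: "i = n + k" "k < n" using i by (metis add_less_cancel_left le_Suc_ex not_less)
      then have "t k \<le> t (Suc k)" using t by (auto simp: is_partition_def)
      then show ?thesis using hi[of k] hi[of "Suc k"] k by (auto simp: max_def)
    qed
  qed
  fix F :: "real \<Rightarrow> real \<Rightarrow> real"
  assume nonneg: "\<And>a b. 0 \<le> F a b" and sub: "\<And>a b d. F a d \<le> F a b + F b d"
  { assume z: "F c c = 0"
    have "F (t j) (t (Suc j)) \<le> F (min (t j) c) (min (t (Suc j)) c) + F (max (t j) c) (max (t (Suc j)) c)"
      if "j < n" for j
    proof -
      have "t j \<le> t (Suc j)" using t that by (auto simp: is_partition_def)
      then show ?thesis
        using sub[of "t j" "t (Suc j)" c] nonneg z by (auto simp: min_def max_def)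
    qed
    then show "(\<Sum>j<n. F (t j) (t (Suc j))) \<le> (\<Sum>j<n+n. F (t' j) (t' (Suc j)))"
      unfolding split sum.distrib[symmetric] by (intro sum_mono) auto }
  { assume z: "F 0 0 = 0"
    have "F 0 (min (t k) c) \<le> (\<Sum>j<k. F (min (t j) c) (min (t (Suc j)) c))" for k
    proof (induction k)
      case 0
      then show ?case using tn c z by simp
    next
      case (Suc k)
      then show ?case using sub[of 0 "min (t (Suc k)) c" "min (t k) c"] by simp
    qed
    from this[of n] have "F 0 c \<le> (\<Sum>j<n. F (min (t j) c) (min (t (Suc j)) c))" using tn c by simp
    also have "\<dots> \<le> (\<Sum>j<n+n. F (t' j) (t' (Suc j)))"
      unfolding split using nonneg by (simp add: sum_nonneg)
    finally show "F 0 c \<le> (\<Sum>j<n+n. F (t' j) (t' (Suc j)))" . }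
qed

text \<open>\<open>U c\<close> is the variation over \<open>[0,c]\<close> along the bottom edge plus
  the Vitali variation over \<open>[0,c] \<times> [0,T]\<close>, with the partitions of both axes
  free. Bounded variation of the separate sections would give a majorant for each height
  \<open>t\<close>; the Vitali part makes one majorant serve all heights.\<close>

lemma bv_majorant_fst:
  assumes ST: "0 \<le> S" "0 \<le> T" and vit: "bv_vitali S T g" and bv1: "bv_1d S (\<lambda>s. g (s, 0))"
  obtains U where "\<And>s s' t. 0 \<le> s \<Longrightarrow> s \<le> s' \<Longrightarrow> s' \<le> S \<Longrightarrow> 0 \<le> t \<Longrightarrow> t \<le> T \<Longrightarrow>
    \<bar>g (s', t) - g (s, t)\<bar> \<le> U s' - U s"
proof -
  obtain C1 where C1: "\<And>m s. is_partition S m s \<Longrightarrow> (\<Sum>i<m. \<bar>g (s (Suc i), 0) - g (s i, 0)\<bar>) \<le> C1"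
    using bv1 by (auto simp: bv_1d_def)
  obtain C2 where C2: "\<And>m n s t. is_partition S m s \<Longrightarrow> is_partition T n t \<Longrightarrow>
      (\<Sum>i<m. \<Sum>j<n. \<bar>rect_incr g (s i) (s (Suc i)) (t j) (t (Suc j))\<bar>) \<le> C2"
    using vit unfolding bv_vitali_def by blast
  define F where "F n t a b = \<bar>g (b, 0) - g (a, 0)\<bar> + (\<Sum>j<n. \<bar>rect_incr g a b (t j) (t (Suc j))\<bar>)"
    for n :: nat and t a b
  have F0: "0 \<le> F n t a b" for n t a b by (auto simp: F_def intro!: add_nonneg_nonneg sum_nonneg)
  define A where "A c = {\<Sum>i<m. F n t (s i) (s (Suc i)) | m n s t. is_partition c m s \<and> is_partition T n t}" for c
  define U where "U c = Sup (A c)" for c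
  have triv: "is_partition L 1 (\<lambda>i. if i = 0 then 0 else L)" if "0 \<le> L" for L
    using that by (auto simp: is_partition_def)
  have ne: "A c \<noteq> {}" if "0 \<le> c" for c
    using triv[OF that] triv[OF ST(2)] unfolding A_def by blast
  have bdd: "bdd_above (A c)" if "c \<le> S" for c
    unfolding bdd_above_def
  proof (rule exI[of _ "C1 + C2"], rule ballI)
    fix y assume "y \<in> A c"
    then obtain m n s t where y: "y = (\<Sum>i<m. F n t (s i) (s (Suc i)))"
      and s: "is_partition c m s" and t: "is_partition T n t" by (auto simp: A_def)
    have p: "is_partition S (Suc m) (s(Suc m := S))" by (rule is_partition_append[OF s that])
    have "y \<le> (\<Sum>i<Suc m. F n t ((s(Suc m := S)) i) ((s(Suc m := S)) (Suc i)))"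
      unfolding sum_partition_append[OF s] y using F0 by simp
    also have "\<dots> \<le> C1 + C2"
      unfolding F_def sum.distrib using C1[OF p] C2[OF p t] by simp
    finally show "y \<le> C1 + C2" .
  qed
  have "\<bar>g (s', c) - g (s, c)\<bar> \<le> U s' - U s"
    if "0 \<le> s" "s \<le> s'" "s' \<le> S" "0 \<le> c" "c \<le> T" for s s' c
  proof -
    have "y \<le> U s' - \<bar>g (s', c) - g (s, c)\<bar>" if "y \<in> A s" for y
    proof -
      from that obtain m n r t where y: "y = (\<Sum>i<m. F n t (r i) (r (Suc i)))"
        and r: "is_partition s m r" and t: "is_partition T n t" by (auto simp: A_def)
      let ?t = "\<lambda>j. if j \<le> n then min (t j) c else max (t (j - n)) c"
      let ?G = "\<lambda>a b c d. \<bar>rect_incr g a b c d\<bar>"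
      have G: "?G a b c c = 0" "?G a b c e \<le> ?G a b c d + ?G a b d e" for a b c d e
        by (auto simp: rect_incr_def)
      note ins = partition_insert[OF t \<open>0 \<le> c\<close> \<open>c \<le> T\<close>]
      have le: "F n t a b \<le> F (n + n) ?t a b" for a b
        unfolding F_def using ins(2)[of "?G a b"] G by simp
      \<comment> \<open>The increment at height \<open>c\<close> is the one at height 0 plus the
        increment over the rectangle \<open>[s,s'] \<times> [0,c]\<close>. Once \<open>c\<close> is
        a partition point of the second axis, that rectangle is a union of cells and is counted by
        \<open>F\<close>.\<close>
      have "\<bar>g (s', c) - g (s, c)\<bar> \<le> \<bar>g (s', 0) - g (s, 0)\<bar> + ?G s s' 0 c"
        by (simp add: rect_incr_def)
      also have "\<dots> \<le> F (n + n) ?t s s'"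
        unfolding F_def using ins(3)[of "?G s s'"] G by simp
      finally have "y + \<bar>g (s', c) - g (s, c)\<bar> \<le> (\<Sum>i<m. F (n + n) ?t (r i) (r (Suc i))) + F (n + n) ?t s s'"
        unfolding y using le by (intro add_mono sum_mono) auto
      also have "\<dots> \<le> U s'"
        unfolding U_def sum_partition_append[OF r, symmetric] using \<open>s' \<le> S\<close> ins(1)
          is_partition_append[OF r \<open>s \<le> s'\<close>]
        by (intro cSup_upper bdd) (auto simp only: A_def)
      finally show ?thesis by simp
    qed
    then have "U s \<le> U s' - \<bar>g (s', c) - g (s, c)\<bar>"
      unfolding U_def[of s] using ne[OF \<open>0 \<le> s\<close>] by (intro cSup_least)
    then show ?thesis by simp
  qed
  then show ?thesis by (rule that)
qed

lemma bv_vitali_swap: "bv_vitali S T g \<Longrightarrow> bv_vitali T S (\<lambda>(t, s). g (s, t))"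
proof -
  assume "bv_vitali S T g"
  then obtain C where C: "\<And>m n s t. is_partition S m s \<Longrightarrow> is_partition T n t \<Longrightarrow>
      (\<Sum>i<m. \<Sum>j<n. \<bar>rect_incr g (s i) (s (Suc i)) (t j) (t (Suc j))\<bar>) \<le> C"
    unfolding bv_vitali_def by blast
  have eq: "rect_incr (\<lambda>(t, s). g (s, t)) c d a b = rect_incr g a b c d" for a b c d
    by (simp add: rect_incr_def)
  show ?thesis
    unfolding bv_vitali_def eq
    by (intro exI[of _ C] allI impI) (subst sum.swap, auto intro: C)
qed

lemma bv_majorants:
  assumes ST: "0 \<le> S" "0 \<le> T" and bv: "bv_hk S T g"
  obtains U V where
    "\<And>s s' t. 0 \<le> s \<Longrightarrow> s \<le> s' \<Longrightarrow> s' \<le> S \<Longrightarrow> 0 \<le> t \<Longrightarrow> t \<le> T \<Longrightarrow> \<bar>g (s', t) - g (s, t)\<bar> \<le> U s' - U s"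
    "\<And>s t t'. 0 \<le> s \<Longrightarrow> s \<le> S \<Longrightarrow> 0 \<le> t \<Longrightarrow> t \<le> t' \<Longrightarrow> t' \<le> T \<Longrightarrow> \<bar>g (s, t') - g (s, t)\<bar> \<le> V t' - V t"
proof -
  have 1: "bv_vitali S T g" "bv_1d S (\<lambda>s. g (s, 0))" "bv_1d T (\<lambda>t. g (0, t))"
    using bv ST by (auto simp: bv_hk_def)
  obtain U where U: "\<And>s s' t. 0 \<le> s \<Longrightarrow> s \<le> s' \<Longrightarrow> s' \<le> S \<Longrightarrow> 0 \<le> t \<Longrightarrow> t \<le> T \<Longrightarrow>
      \<bar>g (s', t) - g (s, t)\<bar> \<le> U s' - U s"
    using bv_majorant_fst[OF ST 1(1,2)] by blast
  have 2: "bv_1d T (\<lambda>t. (\<lambda>(t, s). g (s, t)) (t, 0))" using 1 by simp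
  obtain V where V: "\<And>t t' s. 0 \<le> t \<Longrightarrow> t \<le> t' \<Longrightarrow> t' \<le> T \<Longrightarrow> 0 \<le> s \<Longrightarrow> s \<le> S \<Longrightarrow>
      \<bar>(\<lambda>(t, s). g (s, t)) (t', s) - (\<lambda>(t, s). g (s, t)) (t, s)\<bar> \<le> V t' - V t"
    using bv_majorant_fst[OF ST(2,1) bv_vitali_swap[OF 1(1)] 2] by blast
  show ?thesis by (rule that[of U V]) (use U V in auto)
qed

lemma bv_bounded:
  assumes ST: "0 \<le> S" "0 \<le> T" and bv: "bv_hk S T g"
  obtains B where "0 \<le> B" "\<And>p. p \<in> Qrect S T \<Longrightarrow> \<bar>g p\<bar> \<le> B"
proof -
  obtain U V where
    U: "\<And>s s' t. 0 \<le> s \<Longrightarrow> s \<le> s' \<Longrightarrow> s' \<le> S \<Longrightarrow> 0 \<le> t \<Longrightarrow> t \<le> T \<Longrightarrow> \<bar>g (s', t) - g (s, t)\<bar> \<le> U s' - U s" and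
    V: "\<And>s t t'. 0 \<le> s \<Longrightarrow> s \<le> S \<Longrightarrow> 0 \<le> t \<Longrightarrow> t \<le> t' \<Longrightarrow> t' \<le> T \<Longrightarrow> \<bar>g (s, t') - g (s, t)\<bar> \<le> V t' - V t"
    by (rule bv_majorants[OF ST bv]) blast
  have "\<bar>g (s, t)\<bar> \<le> \<bar>g (0,0)\<bar> + (U S - U 0) + (V T - V 0)" if "0 \<le> s" "s \<le> S" "0 \<le> t" "t \<le> T" for s t
    using U[of 0 s t] U[of s S t] V[of 0 0 t] V[of 0 t T] that ST by linarith
  then show ?thesis
    by (intro that[of "\<bar>g (0,0)\<bar> + (U S - U 0) + (V T - V 0)"])
      (use U[of 0 S 0] V[of 0 0 T] ST in \<open>auto simp: Qrect_def\<close>)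
qed

section \<open>Step functions of tagged partitions\<close>

definition tagged :: "real \<Rightarrow> real \<Rightarrow> nat \<Rightarrow> (nat \<Rightarrow> real) \<Rightarrow> (nat \<Rightarrow> real) \<Rightarrow> bool" where
  "tagged L d n s \<sigma> \<longleftrightarrow>
    is_partition L n s \<and> (\<forall>i<n. s (Suc i) - s i < d \<and> \<sigma> i \<in> {s i..s (Suc i)})"

text \<open>Half-open cells are pairwise disjoint, and they leave out only the axes, a null
  set.\<close>

definition cell :: "(nat \<Rightarrow> real) \<Rightarrow> (nat \<Rightarrow> real) \<Rightarrow> nat \<Rightarrow> nat \<Rightarrow> pt set" where
  "cell s t i j = {s i<..s (Suc i)} \<times> {t j<..t (Suc j)}"

text \<open>There are \<open>Suc n\<close> intervals, so the sequence of partitions is indexed by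
  all naturals without a division by zero.\<close>

definition unif :: "real \<Rightarrow> nat \<Rightarrow> nat \<Rightarrow> real" where
  "unif L n i = L * real i / real (Suc n)"

lemma is_partition_unif: "0 \<le> L \<Longrightarrow> is_partition L (Suc n) (unif L n)"
  by (auto simp: is_partition_def unif_def divide_right_mono mult_left_mono)

lemma unif_mesh: "unif L n (Suc i) - unif L n i = L / real (Suc n)"
  by (simp add: unif_def diff_divide_distrib[symmetric] right_diff_distrib[symmetric])

lemma tagged_unif:
  assumes "0 \<le> L" "L / real (Suc n) < d"
  shows "tagged L d (Suc n) (unif L n) (\<lambda>i. unif L n (Suc i))"
  using is_partition_unif[OF assms(1), of n] assms(2)
  unfolding tagged_def unif_mesh by (auto simp: is_partition_def)

lemma tagged_unif_eventually:
  assumes "0 \<le> L" "0 < d"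
  shows "\<forall>\<^sub>F n in sequentially. tagged L d (Suc n) (unif L n) (\<lambda>i. unif L n (Suc i))"
proof -
  have "(\<lambda>n. L / real (Suc n)) \<longlonglongrightarrow> 0"
    using LIMSEQ_Suc[OF lim_const_over_n[of L]] by simp
  then have "\<forall>\<^sub>F n in sequentially. L / real (Suc n) < d"
    using assms(2) by (rule order_tendstoD)
  then show ?thesis by eventually_elim (rule tagged_unif[OF assms(1)])
qed

text \<open>Repeated partition points give empty half-open intervals. The least index whose right
  endpoint reaches \<open>x\<close> skips them.\<close>

lemma partition_cell_unique:
  assumes s: "is_partition L n s" and x: "0 < x" "x \<le> L"
  obtains k where "k < n" "\<And>i. i < n \<Longrightarrow> x \<in> {s i<..s (Suc i)} \<longleftrightarrow> i = k"
proof -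
  define k where "k = (LEAST i. x \<le> s (Suc i))"
  have n0: "n > 0" using s x by (auto simp: is_partition_def intro: gr0I)
  have ex: "x \<le> s (Suc (n - 1))" using s x n0 by (simp add: is_partition_def)
  have k1: "x \<le> s (Suc k)" unfolding k_def by (rule LeastI[of "\<lambda>i. x \<le> s (Suc i)", OF ex])
  have kn: "k < n" using Least_le[of "\<lambda>i. x \<le> s (Suc i)", OF ex] n0 by (simp add: k_def)
  have lt: "s (Suc i) < x" if "i < k" for i
    using not_less_Least[of i "\<lambda>i. x \<le> s (Suc i)"] that by (auto simp: k_def)
  have sk: "s k < x" using lt[of "k - 1"] s x by (cases k) (auto simp: is_partition_def)
  show ?thesis
  proof (rule that[OF kn])
    fix i assume i: "i < n"
    show "x \<in> {s i<..s (Suc i)} \<longleftrightarrow> i = k"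
    proof (cases i k rule: linorder_cases)
      case less
      then show ?thesis using lt[of i] by auto
    next
      case equal
      then show ?thesis using k1 sk by auto
    next
      case greater
      then have "s (Suc k) \<le> s i" using is_partition_mono[OF s, of "Suc k" i] i by auto
      then show ?thesis using greater k1 by auto
    qed
  qed
qed

lemma step_function_value:
  assumes s: "is_partition S m s" and t: "is_partition T n t"
    and p: "p \<in> {0<..S} \<times> {0<..T}"
  obtains k l where "k < m" "l < n" "p \<in> cell s t k l"
    "\<And>f. (\<Sum>i<m. \<Sum>j<n. f i j * indicator (cell s t i j) p) = (f k l :: real)"
proof -
  obtain x y where xy: "p = (x, y)" "0 < x" "x \<le> S" "0 < y" "y \<le> T" using p by auto
  obtain k where k: "k < m" "\<And>i. i < m \<Longrightarrow> x \<in> {s i<..s (Suc i)} \<longleftrightarrow> i = k"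
    by (rule partition_cell_unique[OF s xy(2,3)]) blast
  obtain l where l: "l < n" "\<And>i. i < n \<Longrightarrow> y \<in> {t i<..t (Suc i)} \<longleftrightarrow> i = l"
    by (rule partition_cell_unique[OF t xy(4,5)]) blast
  have ind: "indicator (cell s t i j) p = (if i = k then if j = l then 1 else 0 else 0 :: real)"
    if "i < m" "j < n" for i j
    using k(2)[OF that(1)] l(2)[OF that(2)] unfolding cell_def xy(1) indicator_def by auto
  show ?thesis
  proof (rule that[of k l])
    show "p \<in> cell s t k l" using k l by (auto simp: cell_def xy)
    fix f :: "nat \<Rightarrow> nat \<Rightarrow> real"
    have "(\<Sum>i<m. \<Sum>j<n. f i j * indicator (cell s t i j) p) =
        (\<Sum>i<m. \<Sum>j<n. if i = k then if j = l then f i j else 0 else 0)"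
      by (intro sum.cong refl) (simp add: ind)
    also have "\<dots> = (\<Sum>i<m. if i = k then (\<Sum>j<n. if j = l then f i j else 0) else 0)"
      by (intro sum.cong refl) auto
    also have "\<dots> = f k l" using k l by simp
    finally show "(\<Sum>i<m. \<Sum>j<n. f i j * indicator (cell s t i j) p) = f k l" .
  qed (use k l in auto)
qed

lemma sets_halfopen_box: "{a<..b} \<times> {c<..d} \<in> sets (borel :: pt measure)"
  by (simp add: borel_prod[symmetric])

lemma emeasure_halfopen_box:
  assumes "a \<le> b" "c \<le> d"
  shows "emeasure lborel ({a<..b} \<times> {c<..d} :: pt set) = ennreal ((b - a) * (d - c))"
  using assms
  by (simp add: lborel_prod[symmetric] lborel.emeasure_pair_measure_Times ennreal_mult)

lemma halfopen_box_leb_Q: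
  assumes "0 \<le> a" "a \<le> b" "b \<le> S" "0 \<le> c" "c \<le> d" "d \<le> T"
  shows "{a<..b} \<times> {c<..d} \<in> sets (leb_Q S T)"
    and "measure (leb_Q S T) ({a<..b} \<times> {c<..d}) = (b - a) * (d - c)"
proof -
  have sub: "{a<..b} \<times> {c<..d} \<subseteq> Qrect S T" using assms by (auto simp: Qrect_def)
  have leb: "{a<..b} \<times> {c<..d} \<in> sets (lebesgue :: pt measure)"
    using sets_halfopen_box[of a b c d] by auto
  show "{a<..b} \<times> {c<..d} \<in> sets (leb_Q S T)"
    using leb sub by (auto simp: sets_restrict_space image_iff)
  have "emeasure (leb_Q S T) ({a<..b} \<times> {c<..d}) = emeasure lborel ({a<..b} \<times> {c<..d})"
    using sub sets_halfopen_box[of a b c d] by (subst emeasure_restrict_space) auto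
  then show "measure (leb_Q S T) ({a<..b} \<times> {c<..d}) = (b - a) * (d - c)"
    using assms by (simp add: measure_def emeasure_halfopen_box)
qed

lemma cell_leb_Q:
  assumes "is_partition S m s" "is_partition T n t" "i < m" "j < n"
  shows "cell s t i j \<in> sets (leb_Q S T)"
    and "measure (leb_Q S T) (cell s t i j) = (s (Suc i) - s i) * (t (Suc j) - t j)"
  unfolding cell_def using assms
  by (intro halfopen_box_leb_Q;
      use is_partition_nonneg[OF assms(1)] is_partition_nonneg[OF assms(2)]
        is_partition_le[OF assms(1)] is_partition_le[OF assms(2)] in \<open>auto simp: is_partition_def\<close>)+

lemma AE_leb_Q_interior: "AE p in leb_Q S T. p \<in> {0<..S} \<times> {0<..T}"
proof -
  have "negligible (cbox (0,0) (S,T) - box (0,0) (S,T))"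
    by (rule negligible_frontier_interval)
  then have "AE p in lebesgue. p \<notin> cbox (0,0) (S,T) - box (0,0) (S,T)"
    unfolding negligible_iff_null_sets by (rule AE_not_in)
  moreover have "p \<in> {0<..S} \<times> {0<..T}" if "p \<in> box (0,0) (S,T)" for p
    using that by (cases p) (auto simp: box_def Basis_prod_def)
  then have "p \<in> cbox (0,0) (S,T) \<longrightarrow> p \<in> {0<..S} \<times> {0<..T}"
    if "p \<notin> cbox (0,0) (S,T) - box (0,0) (S,T)" for p using that by blast
  ultimately have "AE p in lebesgue. p \<in> Qrect S T \<longrightarrow> p \<in> {0<..S} \<times> {0<..T}"
    unfolding Qrect_cbox by (rule eventually_mono)
  then show ?thesis by (simp add: AE_restrict_space_iff)
qed

lemma integral_step:
  assumes "is_partition S m s" "is_partition T n t"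
  shows "integrable (leb_Q S T) (\<lambda>p. \<Sum>i<m. \<Sum>j<n. f i j * indicator (cell s t i j) p :: real)"
    and "(LINT p|leb_Q S T. (\<Sum>i<m. \<Sum>j<n. f i j * indicator (cell s t i j) p)) =
      (\<Sum>i<m. \<Sum>j<n. f i j * ((s (Suc i) - s i) * (t (Suc j) - t j)))"
proof -
  interpret finite_measure "leb_Q S T" by (rule finite_measure_leb_Q)
  have i: "integrable (leb_Q S T) (\<lambda>p. f i j * indicator (cell s t i j) p)" if "i < m" "j < n" for i j
    using cell_leb_Q(1)[OF assms that] by (auto simp: less_top[symmetric])
  show "integrable (leb_Q S T) (\<lambda>p. \<Sum>i<m. \<Sum>j<n. f i j * indicator (cell s t i j) p)"
    using i by (intro Bochner_Integration.integrable_sum) auto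
  have "(LINT p|leb_Q S T. (\<Sum>i<m. \<Sum>j<n. f i j * indicator (cell s t i j) p)) =
      (\<Sum>i<m. \<Sum>j<n. LINT p|leb_Q S T. f i j * indicator (cell s t i j) p)"
  proof -
    have "(LINT p|leb_Q S T. (\<Sum>i<m. \<Sum>j<n. f i j * indicator (cell s t i j) p)) =
        (\<Sum>i<m. LINT p|leb_Q S T. (\<Sum>j<n. f i j * indicator (cell s t i j) p))"
      using i by (intro Bochner_Integration.integral_sum Bochner_Integration.integrable_sum) auto
    also have "\<dots> = (\<Sum>i<m. \<Sum>j<n. LINT p|leb_Q S T. f i j * indicator (cell s t i j) p)"
      using i by (intro sum.cong refl Bochner_Integration.integral_sum) auto
    finally show ?thesis .
  qed
  also have "\<dots> = (\<Sum>i<m. \<Sum>j<n. f i j * ((s (Suc i) - s i) * (t (Suc j) - t j)))"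
  proof (intro sum.cong refl)
    fix i j assume ij: "i \<in> {..<m}" "j \<in> {..<n}"
    then have "cell s t i j \<subseteq> Qrect S T"
      using cell_leb_Q(1)[OF assms, of i j] sets.sets_into_space by fastforce
    then show "(LINT p|leb_Q S T. f i j * indicator (cell s t i j) p) =
        f i j * ((s (Suc i) - s i) * (t (Suc j) - t j))"
      using cell_leb_Q(2)[OF assms, of i j] ij by (simp add: Int_absorb1 Int_absorb2)
  qed
  finally show "(LINT p|leb_Q S T. (\<Sum>i<m. \<Sum>j<n. f i j * indicator (cell s t i j) p)) =
      (\<Sum>i<m. \<Sum>j<n. f i j * ((s (Suc i) - s i) * (t (Suc j) - t j)))" .
qed

text \<open>The oscillation of a function of bounded variation over a cell is at most the sum of the
  increments of its two majorants, and these increments add up.\<close>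

lemma bv_step_approx:
  assumes ST: "0 \<le> S" "0 \<le> T" and bv: "bv_hk S T g"
  obtains K where "0 \<le> K" "\<And>d m s \<sigma> n t \<tau>. tagged S d m s \<sigma> \<Longrightarrow> tagged T d n t \<tau> \<Longrightarrow> 0 < d \<Longrightarrow>
    \<exists>D. integrable (leb_Q S T) D \<and> (LINT p|leb_Q S T. D p) \<le> K * d \<and> (\<forall>p. 0 \<le> D p) \<and>
      (AE p in leb_Q S T. \<bar>(\<Sum>i<m. \<Sum>j<n. g (\<sigma> i, \<tau> j) * indicator (cell s t i j) p) - g p\<bar> \<le> D p)"
proof -
  obtain U V where
    U: "\<And>s s' t. 0 \<le> s \<Longrightarrow> s \<le> s' \<Longrightarrow> s' \<le> S \<Longrightarrow> 0 \<le> t \<Longrightarrow> t \<le> T \<Longrightarrow> \<bar>g (s', t) - g (s, t)\<bar> \<le> U s' - U s" and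
    V: "\<And>s t t'. 0 \<le> s \<Longrightarrow> s \<le> S \<Longrightarrow> 0 \<le> t \<Longrightarrow> t \<le> t' \<Longrightarrow> t' \<le> T \<Longrightarrow> \<bar>g (s, t') - g (s, t)\<bar> \<le> V t' - V t"
    by (rule bv_majorants[OF ST bv]) blast
  have Um: "U a \<le> U b" if "0 \<le> a" "a \<le> b" "b \<le> S" for a b using U[OF that, of 0] ST by auto
  have Vm: "V a \<le> V b" if "0 \<le> a" "a \<le> b" "b \<le> T" for a b using V[OF _ _ that, of 0] ST by auto
  define K where "K = (U S - U 0) * T + (V T - V 0) * S"
  have "K \<ge> 0" using Um[of 0 S] Vm[of 0 T] ST by (auto simp: K_def)
  moreover have "\<exists>D. integrable (leb_Q S T) D \<and> (LINT p|leb_Q S T. D p) \<le> K * d \<and> (\<forall>p. 0 \<le> D p) \<and>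
      (AE p in leb_Q S T. \<bar>(\<Sum>i<m. \<Sum>j<n. g (\<sigma> i, \<tau> j) * indicator (cell s t i j) p) - g p\<bar> \<le> D p)"
    if tS: "tagged S d m s \<sigma>" and tT: "tagged T d n t \<tau>" and d: "0 < d" for d m s \<sigma> n t \<tau>
  proof -
    have s: "is_partition S m s" and t: "is_partition T n t" using tS tT by (auto simp: tagged_def)
    let ?u = "\<lambda>i. U (s (Suc i)) - U (s i)" and ?v = "\<lambda>j. V (t (Suc j)) - V (t j)"
    let ?D = "\<lambda>p. \<Sum>i<m. \<Sum>j<n. (?u i + ?v j) * indicator (cell s t i j) p :: real"
    have s1: "0 \<le> s i" "s i \<le> s (Suc i)" "s (Suc i) \<le> S" "s (Suc i) - s i \<le> d" "s i \<le> \<sigma> i" "\<sigma> i \<le> s (Suc i)"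
      if "i < m" for i
      using is_partition_nonneg[OF s, of i] is_partition_le[OF s, of "Suc i"] that tS
      by (auto simp: tagged_def is_partition_def less_imp_le)
    have t1: "0 \<le> t i" "t i \<le> t (Suc i)" "t (Suc i) \<le> T" "t (Suc i) - t i \<le> d" "t i \<le> \<tau> i" "\<tau> i \<le> t (Suc i)"
      if "i < n" for i
      using is_partition_nonneg[OF t, of i] is_partition_le[OF t, of "Suc i"] that tT
      by (auto simp: tagged_def is_partition_def less_imp_le)
    have u0: "0 \<le> ?u i" if "i < m" for i using Um[OF s1(1-3)] that by simp
    have v0: "0 \<le> ?v i" if "i < n" for i using Vm[OF t1(1-3)] that by simp
    have "(LINT p|leb_Q S T. ?D p) =
        (\<Sum>i<m. \<Sum>j<n. (?u i + ?v j) * ((s (Suc i) - s i) * (t (Suc j) - t j)))"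
      by (rule integral_step(2)[OF s t])
    \<comment> \<open>Each of \<open>?u\<close> and \<open>?v\<close> depends on one index only, so
      in each term the sum over the other index collapses to a full side length of
      \<open>Q\<close>.\<close>
    also have "\<dots> = (\<Sum>i<m. ?u i * (s (Suc i) - s i)) * (\<Sum>j<n. t (Suc j) - t j)
        + (\<Sum>i<m. s (Suc i) - s i) * (\<Sum>j<n. ?v j * (t (Suc j) - t j))"
      unfolding sum_product sum.distrib[symmetric] by (intro sum.cong refl) algebra
    also have "\<dots> = (\<Sum>i<m. ?u i * (s (Suc i) - s i)) * T + S * (\<Sum>j<n. ?v j * (t (Suc j) - t j))"
      using is_partition_telescope[OF s, of "\<lambda>x. x"] is_partition_telescope[OF t, of "\<lambda>x. x"] by simp
    also have "\<dots> \<le> (\<Sum>i<m. ?u i * d) * T + S * (\<Sum>j<n. ?v j * d)"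
    proof (intro add_mono mult_right_mono mult_left_mono ST)
      show "(\<Sum>i<m. ?u i * (s (Suc i) - s i)) \<le> (\<Sum>i<m. ?u i * d)"
        using u0 s1(4) by (intro sum_mono mult_left_mono) auto
      show "(\<Sum>j<n. ?v j * (t (Suc j) - t j)) \<le> (\<Sum>j<n. ?v j * d)"
        using v0 t1(4) by (intro sum_mono mult_left_mono) auto
    qed
    also have "\<dots> = K * d"
      unfolding K_def sum_distrib_right[symmetric] is_partition_telescope[OF s, of U]
        is_partition_telescope[OF t, of V] by algebra
    finally have "(LINT p|leb_Q S T. ?D p) \<le> K * d" .
    moreover have "AE p in leb_Q S T. \<bar>(\<Sum>i<m. \<Sum>j<n. g (\<sigma> i, \<tau> j) * indicator (cell s t i j) p) - g p\<bar> \<le> ?D p"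
      using AE_leb_Q_interior[of S T]
    proof eventually_elim
      case (elim p)
      obtain k l where k: "k < m" "l < n" "p \<in> cell s t k l" and
        *: "\<And>f. (\<Sum>i<m. \<Sum>j<n. f i j * indicator (cell s t i j) p) = (f k l :: real)"
        by (rule step_function_value[OF s t elim]) blast
      obtain x y where p: "p = (x, y)" by (cases p)
      have x: "s k < x" "x \<le> s (Suc k)" "t l < y" "y \<le> t (Suc l)" using k p by (auto simp: cell_def)
      note sk = s1[OF k(1)] and tl = t1[OF k(2)]
      have osc: "\<bar>f a - f b\<bar> \<le> F hi - F lo"
        if "\<And>a b. lo \<le> a \<Longrightarrow> a \<le> b \<Longrightarrow> b \<le> hi \<Longrightarrow> \<bar>f b - f a\<bar> \<le> F b - F a"
          "lo \<le> a" "a \<le> hi" "lo \<le> b" "b \<le> hi" for f F :: "real \<Rightarrow> real" and a b lo hi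
        using that(1)[of lo a] that(1)[of lo b] that(1)[of a b] that(1)[of b a] that(1)[of a hi]
          that(1)[of b hi] that(2-) by (cases "a \<le> b") auto
      \<comment> \<open>The tag is joined to \<open>p\<close> by a horizontal and then a vertical
        segment inside the closed cell; each leg costs at most one increment of a majorant.\<close>
      have "\<bar>g (\<sigma> k, \<tau> l) - g (x, \<tau> l)\<bar> \<le> ?u k"
        by (rule osc[of "s k" "s (Suc k)" "\<lambda>a. g (a, \<tau> l)"]) (use U x sk tl in auto)
      moreover have "\<bar>g (x, \<tau> l) - g (x, y)\<bar> \<le> ?v l"
        by (rule osc[of "t l" "t (Suc l)" "\<lambda>a. g (x, a)"]) (use V x sk tl in auto)
      ultimately show ?case unfolding * unfolding p by linarith
    qed
    moreover have "0 \<le> ?D p" for p using u0 v0 by (intro sum_nonneg mult_nonneg_nonneg) auto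
    ultimately show ?thesis
      using integral_step(1)[OF s t] by (intro exI[of _ ?D]) auto
  qed
  ultimately show ?thesis by (rule that)
qed

section \<open>Lebesgue measurability of functions of bounded variation\<close>

lemma (in complete_measure) borel_measurable_AE_eq:
  assumes f: "f \<in> borel_measurable M" and ae: "AE x in M. f x = g x"
  shows "g \<in> borel_measurable M"
proof (rule measurableI)
  fix A :: "'b set" assume A: "A \<in> sets borel"
  show "g -` A \<inter> space M \<in> sets M"
  proof (rule in_sets_AE)
    show "AE x in M. x \<in> f -` A \<inter> space M \<longleftrightarrow> x \<in> g -` A \<inter> space M"
      using ae by eventually_elim auto
  qed (use measurable_sets[OF f A] in auto)
qed simp

lemma complete_measure_leb_Q: "complete_measure (leb_Q S T)"
proof
  fix A B :: "pt set" assume "B \<subseteq> A" "A \<in> null_sets (leb_Q S T)"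
  then have "B \<subseteq> Qrect S T" "B \<in> null_sets lebesgue"
    using completion.complete2[of B A lborel] by (auto simp: null_sets_restrict_space)
  then show "B \<in> sets (leb_Q S T)"
    using null_sets_restrict_space[of "Qrect S T" lebesgue B] by auto
qed

text \<open>Bounded variation is a condition on values alone. Step functions on the uniform
  partitions differ from \<open>g\<close> by at most \<open>D N\<close>, whose integral tends to 0;
  along a subsequence they converge almost everywhere, and completeness of Lebesgue measure
  transfers measurability to \<open>g\<close> itself.\<close>

lemma bv_measurable:
  assumes ST: "0 \<le> S" "0 \<le> T" and bv: "bv_hk S T g"
  shows "g \<in> borel_measurable (leb_Q S T)"
proof -
  obtain K where K: "0 \<le> K" "\<And>d m s \<sigma> n t \<tau>. tagged S d m s \<sigma> \<Longrightarrow> tagged T d n t \<tau> \<Longrightarrow> 0 < d \<Longrightarrow>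
    \<exists>D. integrable (leb_Q S T) D \<and> (LINT p|leb_Q S T. D p) \<le> K * d \<and> (\<forall>p. 0 \<le> D p) \<and>
      (AE p in leb_Q S T. \<bar>(\<Sum>i<m. \<Sum>j<n. g (\<sigma> i, \<tau> j) * indicator (cell s t i j) p) - g p\<bar> \<le> D p)"
    by (rule bv_step_approx[OF ST bv]) blast
  define W where "W N p = (\<Sum>i<Suc N. \<Sum>j<Suc N. g (unif S N (Suc i), unif T N (Suc j)) *
    indicator (cell (unif S N) (unif T N) i j) p)" for N p
  \<comment> \<open>The numerator exceeds both side lengths strictly, so one number serves as the
    strict mesh bound in both directions.\<close>
  define e where "e N = (S + T + 1) / real (Suc N)" for N
  have e0: "0 < e N" for N using ST by (simp add: e_def)
  have "\<forall>N. \<exists>D. integrable (leb_Q S T) D \<and> (LINT p|leb_Q S T. D p) \<le> K * e N \<and> (\<forall>p. 0 \<le> D p) \<and>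
      (AE p in leb_Q S T. \<bar>W N p - g p\<bar> \<le> D p)"
    unfolding W_def using ST e0
    by (intro allI K(2) tagged_unif) (auto simp: e_def intro!: divide_strict_right_mono)
  from choice[OF this] obtain D where
    D': "\<forall>N. integrable (leb_Q S T) (D N) \<and> (LINT p|leb_Q S T. D N p) \<le> K * e N \<and> (\<forall>p. 0 \<le> D N p) \<and>
      (AE p in leb_Q S T. \<bar>W N p - g p\<bar> \<le> D N p)"
    by (elim exE)
  have D: "integrable (leb_Q S T) (D N)" "(LINT p|leb_Q S T. D N p) \<le> K * e N"
    "0 \<le> D N p" "AE p in leb_Q S T. \<bar>W N p - g p\<bar> \<le> D N p" for N p
    using D' by blast+
  have lim0: "(\<lambda>N. K * e N) \<longlonglongrightarrow> 0"
    unfolding e_def using LIMSEQ_Suc[OF lim_const_over_n[of "S + T + 1"]]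
    by (intro tendsto_mult_right_zero) simp
  have "(\<lambda>N. LINT p|leb_Q S T. norm (D N p)) \<longlonglongrightarrow> 0"
    by (rule tendsto_sandwich[OF _ _ tendsto_const lim0]) (use D in \<open>auto intro!: integral_nonneg_AE\<close>)
  from tendsto_L1_AE_subseq[OF D(1) this] obtain r where
    r: "strict_mono r" "AE p in leb_Q S T. (\<lambda>N. D (r N) p) \<longlonglongrightarrow> 0" by auto
  have "AE p in leb_Q S T. \<forall>N. \<bar>W N p - g p\<bar> \<le> D N p" using D(4) by (simp add: AE_all_countable)
  with r(2) have "AE p in leb_Q S T. (\<lambda>N. W (r N) p) \<longlonglongrightarrow> g p"
  proof eventually_elim
    case (elim p)
    have "(\<lambda>N. W (r N) p - g p) \<longlonglongrightarrow> 0"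
      by (rule Lim_null_comparison[OF _ elim(1)]) (use elim(2) in auto)
    then show ?case by (simp add: LIM_zero_iff)
  qed
  moreover have "AE p in leb_Q S T. (\<lambda>N. W (r N) p) \<longlonglongrightarrow> lim (\<lambda>N. W (r N) p)"
    using calculation by eventually_elim (simp add: limI)
  ultimately have ae: "AE p in leb_Q S T. lim (\<lambda>N. W (r N) p) = g p"
    by eventually_elim (simp add: limI)
  have Wm: "W N \<in> borel_measurable (leb_Q S T)" for N
    unfolding W_def using integral_step(1)[OF is_partition_unif is_partition_unif, OF ST] by auto
  have limm: "(\<lambda>p. lim (\<lambda>N. W (r N) p)) \<in> borel_measurable (leb_Q S T)"
    by (intro borel_measurable_lim_metric Wm)
  interpret complete_measure "leb_Q S T" by (rule complete_measure_leb_Q)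
  show ?thesis by (rule borel_measurable_AE_eq[OF limm ae])
qed

section \<open>Existence of Riemann--Stieltjes integrals\<close>

definition rs_sum :: "(pt \<Rightarrow> real) \<Rightarrow> (pt \<Rightarrow> real) \<Rightarrow> nat \<Rightarrow> (nat \<Rightarrow> real) \<Rightarrow> (nat \<Rightarrow> real)
    \<Rightarrow> nat \<Rightarrow> (nat \<Rightarrow> real) \<Rightarrow> (nat \<Rightarrow> real) \<Rightarrow> real" where
  "rs_sum g x m s \<sigma> n t \<tau> =
    (\<Sum>i<m. \<Sum>j<n. g (\<sigma> i, \<tau> j) * rect_incr x (s i) (s (Suc i)) (t j) (t (Suc j)))"

lemma has_rs_integral_iff:
  "has_rs_integral S T g x I \<longleftrightarrow> (\<forall>e>0. \<exists>d>0. \<forall>m n s t \<sigma> \<tau>.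
    tagged S d m s \<sigma> \<longrightarrow> tagged T d n t \<tau> \<longrightarrow> \<bar>rs_sum g x m s \<sigma> n t \<tau> - I\<bar> < e)"
proof -
  have *: "(P \<longrightarrow> Q \<longrightarrow> A \<longrightarrow> B \<longrightarrow> R) \<longleftrightarrow> (P \<and> A \<longrightarrow> Q \<and> B \<longrightarrow> R)" for P Q A B R by blast
  show ?thesis unfolding has_rs_integral_def tagged_def rs_sum_def * ..
qed

lemma tagged_mono: "tagged L d n s \<sigma> \<Longrightarrow> d \<le> d' \<Longrightarrow> tagged L d' n s \<sigma>"
  by (force simp: tagged_def)

lemma rs_sum_linear_right:
  "rs_sum g (\<lambda>p. a * x p + b * y p) m s \<sigma> n t \<tau> = a * rs_sum g x m s \<sigma> n t \<tau> + b * rs_sum g y m s \<sigma> n t \<tau>"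
  by (simp add: rs_sum_def rect_incr_def sum_distrib_left sum.distrib[symmetric] algebra_simps)

lemma rs_sum_linear_left:
  "rs_sum (\<lambda>p. a * g p + b * h p) x m s \<sigma> n t \<tau> = a * rs_sum g x m s \<sigma> n t \<tau> + b * rs_sum h x m s \<sigma> n t \<tau>"
  by (simp add: rs_sum_def sum_distrib_left sum.distrib[symmetric] algebra_simps)

text \<open>Linearity in the integrand and in the integrator both follow from the corresponding
  identity for the sums; stating that identity as a premise gives the two versions at once.\<close>

lemma has_rs_integral_combine:
  assumes "has_rs_integral S T g x I" "has_rs_integral S T h y J"
    and lin: "\<And>m s \<sigma> n t \<tau>. rs_sum k z m s \<sigma> n t \<tau> = a * rs_sum g x m s \<sigma> n t \<tau> + b * rs_sum h y m s \<sigma> n t \<tau>"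
  shows "has_rs_integral S T k z (a * I + b * J)"
  unfolding has_rs_integral_iff
proof (intro allI impI)
  fix e :: real assume e: "e > 0"
  define e' where "e' = e / (\<bar>a\<bar> + \<bar>b\<bar> + 1)"
  have "e' > 0" using e by (auto simp: e'_def intro!: divide_pos_pos)
  then obtain d1 d2 where d: "d1 > 0" "d2 > 0" and
    1: "\<And>m n s t \<sigma> \<tau>. tagged S d1 m s \<sigma> \<Longrightarrow> tagged T d1 n t \<tau> \<Longrightarrow> \<bar>rs_sum g x m s \<sigma> n t \<tau> - I\<bar> < e'" and
    2: "\<And>m n s t \<sigma> \<tau>. tagged S d2 m s \<sigma> \<Longrightarrow> tagged T d2 n t \<tau> \<Longrightarrow> \<bar>rs_sum h y m s \<sigma> n t \<tau> - J\<bar> < e'"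
    using assms(1,2) unfolding has_rs_integral_iff by metis
  show "\<exists>d>0. \<forall>m n s t \<sigma> \<tau>. tagged S d m s \<sigma> \<longrightarrow> tagged T d n t \<tau> \<longrightarrow>
      \<bar>rs_sum k z m s \<sigma> n t \<tau> - (a * I + b * J)\<bar> < e"
  proof (intro exI[of _ "min d1 d2"] conjI allI impI)
    fix m n s t \<sigma> \<tau> assume "tagged S (min d1 d2) m s \<sigma>" "tagged T (min d1 d2) n t \<tau>"
    then have le: "\<bar>rs_sum g x m s \<sigma> n t \<tau> - I\<bar> \<le> e'" "\<bar>rs_sum h y m s \<sigma> n t \<tau> - J\<bar> \<le> e'"
      by (auto intro!: less_imp_le[OF 1] less_imp_le[OF 2] elim: tagged_mono)
    have "\<bar>rs_sum k z m s \<sigma> n t \<tau> - (a * I + b * J)\<bar> =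
        \<bar>a * (rs_sum g x m s \<sigma> n t \<tau> - I) + b * (rs_sum h y m s \<sigma> n t \<tau> - J)\<bar>"
      unfolding lin by (simp add: algebra_simps)
    also have "\<dots> \<le> \<bar>a\<bar> * \<bar>rs_sum g x m s \<sigma> n t \<tau> - I\<bar> + \<bar>b\<bar> * \<bar>rs_sum h y m s \<sigma> n t \<tau> - J\<bar>"
      by (metis abs_mult abs_triangle_ineq)
    also have "\<dots> \<le> \<bar>a\<bar> * e' + \<bar>b\<bar> * e'"
      using le by (intro add_mono mult_left_mono) auto
    also have "\<dots> < (\<bar>a\<bar> + \<bar>b\<bar> + 1) * e'" using \<open>e' > 0\<close> by (simp add: algebra_simps)
    also have "\<dots> = e" by (simp add: e'_def add_nonneg_pos)
    finally show "\<bar>rs_sum k z m s \<sigma> n t \<tau> - (a * I + b * J)\<bar> < e" .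
  qed (use d in auto)
qed

lemmas has_rs_integral_linear_right = has_rs_integral_combine[OF _ _ rs_sum_linear_right]
lemmas has_rs_integral_linear_left = has_rs_integral_combine[OF _ _ rs_sum_linear_left]

text \<open>A limit along a fixed sequence of partitions yields uniqueness of the integral. Later it
  also presents the integral along a random path as a limit of explicit finite combinations of
  values of the path.\<close>

lemma has_rs_integral_unif:
  assumes ST: "0 \<le> S" "0 \<le> T" and I: "has_rs_integral S T g x I"
  shows "(\<lambda>n. rs_sum g x (Suc n) (unif S n) (\<lambda>i. unif S n (Suc i)) (Suc n) (unif T n) (\<lambda>i. unif T n (Suc i)))
    \<longlonglongrightarrow> I"
proof (rule tendstoI)
  fix e :: real assume "e > 0"
  then obtain d where "d > 0" and d: "\<And>m n s t \<sigma> \<tau>. tagged S d m s \<sigma> \<Longrightarrow> tagged T d n t \<tau> \<Longrightarrow>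
      \<bar>rs_sum g x m s \<sigma> n t \<tau> - I\<bar> < e"
    using I unfolding has_rs_integral_iff by metis
  from tagged_unif_eventually[OF ST(1) \<open>d > 0\<close>] tagged_unif_eventually[OF ST(2) \<open>d > 0\<close>]
  show "\<forall>\<^sub>F n in sequentially. dist (rs_sum g x (Suc n) (unif S n) (\<lambda>i. unif S n (Suc i))
      (Suc n) (unif T n) (\<lambda>i. unif T n (Suc i))) I < e"
    by eventually_elim (auto simp: dist_real_def intro: d)
qed

lemma rs_integral_eq:
  assumes "0 \<le> S" "0 \<le> T" "has_rs_integral S T g x I"
  shows "rs_integral S T g x = I"
  unfolding rs_integral_def
  using assms LIMSEQ_unique[OF has_rs_integral_unif[OF assms(1,2)] has_rs_integral_unif[OF assms(1,2)]]
  by (intro the_equality) auto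

section \<open>Summation by parts and a uniform bound for Riemann--Stieltjes sums\<close>

lemma abel_summation:
  fixes a b :: "nat \<Rightarrow> real"
  shows "(\<Sum>i<m. a i * (b (Suc i) - b i)) = a m * b m - a 0 * b 0 - (\<Sum>i<m. (a (Suc i) - a i) * b (Suc i))"
  by (induction m) (auto simp: algebra_simps)

text \<open>Applying one-dimensional summation by parts in each index moves all differences from
  \<open>x\<close> to \<open>a\<close>: a corner term, two edge terms and one double sum remain. The
  terms on the other two edges vanish because \<open>x\<close> is zero there.\<close>

lemma abel_summation_2d:
  fixes a x :: "nat \<Rightarrow> nat \<Rightarrow> real"
  assumes "\<And>i. x i 0 = 0" "\<And>j. x 0 j = 0"
  shows "(\<Sum>i<m. \<Sum>j<n. a i j * (x (Suc i) (Suc j) - x i (Suc j) - x (Suc i) j + x i j)) =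
    a m n * x m n - (\<Sum>j<n. (a m (Suc j) - a m j) * x m (Suc j))
    - (\<Sum>i<m. (a (Suc i) n - a i n) * x (Suc i) n)
    + (\<Sum>i<m. \<Sum>j<n. (a (Suc i) (Suc j) - a i (Suc j) - a (Suc i) j + a i j) * x (Suc i) (Suc j))"
proof -
  have "(\<Sum>i<m. \<Sum>j<n. a i j * (x (Suc i) (Suc j) - x i (Suc j) - x (Suc i) j + x i j)) =
      (\<Sum>j<n. \<Sum>i<m. a i j * ((x (Suc i) (Suc j) - x (Suc i) j) - (x i (Suc j) - x i j)))"
    by (subst sum.swap) (simp add: algebra_simps)
  also have "\<dots> = (\<Sum>j<n. a m j * (x m (Suc j) - x m j)
      - (\<Sum>i<m. (a (Suc i) j - a i j) * (x (Suc i) (Suc j) - x (Suc i) j)))"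
    using assms by (simp add: abel_summation[of "\<lambda>i. a i _" "\<lambda>i. x i (Suc _) - x i _"])
  also have "\<dots> = (\<Sum>j<n. a m j * (x m (Suc j) - x m j))
      - (\<Sum>i<m. \<Sum>j<n. (a (Suc i) j - a i j) * (x (Suc i) (Suc j) - x (Suc i) j))"
    by (subst sum.swap) (simp add: sum_subtractf)
  also have "\<dots> = a m n * x m n - (\<Sum>j<n. (a m (Suc j) - a m j) * x m (Suc j))
      - (\<Sum>i<m. (a (Suc i) n - a i n) * x (Suc i) n
        - (\<Sum>j<n. ((a (Suc i) (Suc j) - a i (Suc j)) - (a (Suc i) j - a i j)) * x (Suc i) (Suc j)))"
    using assms by (simp add: abel_summation[of "\<lambda>j. a m j" "\<lambda>j. x m j"]
        abel_summation[of "\<lambda>j. a (Suc _) j - a _ j" "\<lambda>j. x (Suc _) j"])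
  also have "\<dots> = a m n * x m n - (\<Sum>j<n. (a m (Suc j) - a m j) * x m (Suc j))
    - (\<Sum>i<m. (a (Suc i) n - a i n) * x (Suc i) n)
    + (\<Sum>i<m. \<Sum>j<n. (a (Suc i) (Suc j) - a i (Suc j) - a (Suc i) j + a i j) * x (Suc i) (Suc j))"
  proof -
    have "a (Suc i) (Suc j) - a i (Suc j) - (a (Suc i) j - a i j) =
        a (Suc i) (Suc j) - a i (Suc j) - a (Suc i) j + a i j" for i j by simp
    then show ?thesis by (simp only: sum_subtractf)
  qed
  finally show ?thesis .
qed

text \<open>With 0 in front and the endpoint appended, the tags form a partition themselves, so the
  differences of \<open>g\<close> between successive tags are controlled by its variation.\<close>

lemma is_partition_tags:
  assumes "tagged L d m s \<sigma>"
  defines "\<sigma>' \<equiv> \<lambda>i. if i < m then \<sigma> i else L"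
  shows "is_partition L (Suc m) (\<lambda>i. case i of 0 \<Rightarrow> 0 | Suc i \<Rightarrow> \<sigma>' i)"
  unfolding is_partition_def
proof (intro conjI allI impI)
  have s: "is_partition L m s" and tag: "\<And>i. i < m \<Longrightarrow> \<sigma> i \<in> {s i..s (Suc i)}"
    using assms(1) by (auto simp: tagged_def)
  have L: "0 \<le> L" using is_partition_mono[OF s, of 0 m] s by (simp add: is_partition_def)
  fix i assume "i < Suc m"
  show "(case i of 0 \<Rightarrow> 0 | Suc i \<Rightarrow> \<sigma>' i) \<le> (case Suc i of 0 \<Rightarrow> 0 | Suc i \<Rightarrow> \<sigma>' i)"
  proof (cases i)
    case 0
    then show ?thesis using tag[of 0] L s by (auto simp: \<sigma>'_def is_partition_def)
  next
    case (Suc k)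
    then have "k < m" using \<open>i < Suc m\<close> by simp
    then have "\<sigma> k \<le> s (Suc k)" "s (Suc k) \<le> L"
      using tag[of k] is_partition_le[OF s, of "Suc k"] by auto
    then show ?thesis using Suc \<open>k < m\<close> tag[of "Suc k"] by (auto simp: \<sigma>'_def)
  qed
qed (auto simp: \<sigma>'_def)

lemma sum_shift_le:
  fixes f :: "nat \<Rightarrow> real"
  assumes "\<And>i. 0 \<le> f i"
  shows "(\<Sum>i<m. f (Suc i)) \<le> (\<Sum>i<Suc m. f i)"
  using assms[of 0] by (subst sum.lessThan_Suc_shift) simp

text \<open>After summation by parts the sum is a combination of values of \<open>x\<close>,
  weighted by differences of \<open>g\<close> over the grid of tags. The weights have total size at
  most the variation of \<open>g\<close> on \<open>Q\<close> and on the edges \<open>s = S\<close>,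
  \<open>t = T\<close>. That the tags form a product grid is essential here.\<close>

lemma rs_sum_bound:
  assumes ST: "0 \<le> S" "0 \<le> T" and bv: "bv_hk S T g"
  obtains C where "0 \<le> C"
    "\<And>d m s \<sigma> n t \<tau> x K. tagged S d m s \<sigma> \<Longrightarrow> tagged T d n t \<tau> \<Longrightarrow>
      (\<And>p. p \<in> Qrect S T \<Longrightarrow> \<bar>x p\<bar> \<le> K) \<Longrightarrow> (\<And>s. s \<in> {0..S} \<Longrightarrow> x (s, 0) = 0) \<Longrightarrow>
      (\<And>t. t \<in> {0..T} \<Longrightarrow> x (0, t) = 0) \<Longrightarrow> \<bar>rs_sum g x m s \<sigma> n t \<tau>\<bar> \<le> C * K"
proof -
  have bv': "bv_vitali S T g" "bv_1d S (\<lambda>s. g (s, T))" "bv_1d T (\<lambda>t. g (S, t))"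
    using bv ST by (auto simp: bv_hk_def)
  obtain C1 where C1: "\<And>n s. is_partition S n s \<Longrightarrow> (\<Sum>i<n. \<bar>g (s (Suc i), T) - g (s i, T)\<bar>) \<le> C1"
    using bv'(2) unfolding bv_1d_def by blast
  obtain C2 where C2: "\<And>n s. is_partition T n s \<Longrightarrow> (\<Sum>i<n. \<bar>g (S, s (Suc i)) - g (S, s i)\<bar>) \<le> C2"
    using bv'(3) unfolding bv_1d_def by blast
  obtain C3 where C3: "\<And>m n s t. is_partition S m s \<Longrightarrow> is_partition T n t \<Longrightarrow>
      (\<Sum>i<m. \<Sum>j<n. \<bar>rect_incr g (s i) (s (Suc i)) (t j) (t (Suc j))\<bar>) \<le> C3"
    using bv'(1) unfolding bv_vitali_def by blast
  define C where "C = \<bar>g (S, T)\<bar> + C2 + C1 + C3"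
  have bound: "\<bar>rs_sum g x m s \<sigma> n t \<tau>\<bar> \<le> C * K"
    if tS: "tagged S d m s \<sigma>" and tT: "tagged T d n t \<tau>"
      and K: "\<And>p. p \<in> Qrect S T \<Longrightarrow> \<bar>x p\<bar> \<le> K" and x0: "\<And>s. s \<in> {0..S} \<Longrightarrow> x (s, 0) = 0"
        "\<And>t. t \<in> {0..T} \<Longrightarrow> x (0, t) = 0" for d m s \<sigma> n t \<tau> x K
  proof -
    have s: "is_partition S m s" and t: "is_partition T n t" using tS tT by (auto simp: tagged_def)
    \<comment> \<open>Summation by parts calls for one tag beyond the last. Placing it at the
      endpoint puts the boundary terms on the edges \<open>s = S\<close> and
      \<open>t = T\<close>.\<close>
    define \<sigma>' where "\<sigma>' i = (if i < m then \<sigma> i else S)" for i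
    define \<tau>' where "\<tau>' j = (if j < n then \<tau> j else T)" for j
    define a where "a i j = g (\<sigma>' i, \<tau>' j)" for i j
    \<comment> \<open>Partitions are constrained only up to index \<open>m\<close> or
      \<open>n\<close>; truncation makes the vanishing and the bound by \<open>K\<close> valid for
      all indices.\<close>
    define y where "y i j = (if i \<le> m \<and> j \<le> n then x (s i, t j) else 0)" for i j
    define ps where "ps i = (case i of 0 \<Rightarrow> 0 | Suc i \<Rightarrow> \<sigma>' i)" for i
    define pt where "pt j = (case j of 0 \<Rightarrow> 0 | Suc j \<Rightarrow> \<tau>' j)" for j
    have ps: "is_partition S (Suc m) ps" unfolding ps_def \<sigma>'_def by (rule is_partition_tags[OF tS])
    have pt: "is_partition T (Suc n) pt" unfolding pt_def \<tau>'_def by (rule is_partition_tags[OF tT])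
    have pS: "ps (Suc i) = \<sigma>' i" "pt (Suc j) = \<tau>' j" for i j by (simp_all add: ps_def pt_def)
    have end_: "\<sigma>' m = S" "\<tau>' n = T" by (simp_all add: \<sigma>'_def \<tau>'_def)
    have mem: "i \<le> m \<Longrightarrow> s i \<in> {0..S}" "j \<le> n \<Longrightarrow> t j \<in> {0..T}" for i j
      using is_partition_nonneg[OF s] is_partition_le[OF s] is_partition_nonneg[OF t] is_partition_le[OF t]
      by auto
    have K0: "0 \<le> K" using K[of "(0,0)"] ST by (auto simp: Qrect_def)
    have yK: "\<bar>y i j\<bar> \<le> K" for i j
      using mem K0 by (auto simp: y_def Qrect_def intro!: K)
    have y0: "y i 0 = 0" "y 0 j = 0" for i j
      using s t x0 mem by (auto simp: y_def is_partition_def)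
    have "rs_sum g x m s \<sigma> n t \<tau> =
        (\<Sum>i<m. \<Sum>j<n. a i j * (y (Suc i) (Suc j) - y i (Suc j) - y (Suc i) j + y i j))"
      unfolding rs_sum_def rect_incr_def a_def y_def \<sigma>'_def \<tau>'_def
      by (intro sum.cong refl) (simp add: Suc_le_eq)
    also have "\<dots> = a m n * y m n - (\<Sum>j<n. (a m (Suc j) - a m j) * y m (Suc j))
      - (\<Sum>i<m. (a (Suc i) n - a i n) * y (Suc i) n)
      + (\<Sum>i<m. \<Sum>j<n. (a (Suc i) (Suc j) - a i (Suc j) - a (Suc i) j + a i j) * y (Suc i) (Suc j))"
      by (rule abel_summation_2d) (rule y0)+
    finally have eq: "rs_sum g x m s \<sigma> n t \<tau> = \<dots>" .
    have 0: "\<bar>a m n * y m n\<bar> \<le> \<bar>g (S, T)\<bar> * K"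
      unfolding abs_mult using yK by (intro mult_mono) (auto simp: a_def end_)
    have "\<bar>\<Sum>j<n. (a m (Suc j) - a m j) * y m (Suc j)\<bar> \<le> (\<Sum>j<n. \<bar>a m (Suc j) - a m j\<bar> * K)"
      using yK by (intro order_trans[OF sum_abs] sum_mono) (auto simp: abs_mult intro!: mult_left_mono)
    also have "\<dots> \<le> (\<Sum>j<Suc n. \<bar>g (S, pt (Suc j)) - g (S, pt j)\<bar>) * K"
      using K0 sum_shift_le[of "\<lambda>j. \<bar>g (S, pt (Suc j)) - g (S, pt j)\<bar>" n]
      unfolding sum_distrib_right[symmetric]
      by (intro mult_right_mono) (simp_all add: a_def end_ pS del: sum.lessThan_Suc)
    also have "\<dots> \<le> C2 * K" using C2[OF pt] K0 by (intro mult_right_mono)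
    finally have 1: "\<bar>\<Sum>j<n. (a m (Suc j) - a m j) * y m (Suc j)\<bar> \<le> C2 * K" .
    have "\<bar>\<Sum>i<m. (a (Suc i) n - a i n) * y (Suc i) n\<bar> \<le> (\<Sum>i<m. \<bar>a (Suc i) n - a i n\<bar> * K)"
      using yK by (intro order_trans[OF sum_abs] sum_mono) (auto simp: abs_mult intro!: mult_left_mono)
    also have "\<dots> \<le> (\<Sum>i<Suc m. \<bar>g (ps (Suc i), T) - g (ps i, T)\<bar>) * K"
      using K0 sum_shift_le[of "\<lambda>i. \<bar>g (ps (Suc i), T) - g (ps i, T)\<bar>" m]
      unfolding sum_distrib_right[symmetric]
      by (intro mult_right_mono) (simp_all add: a_def end_ pS del: sum.lessThan_Suc)
    also have "\<dots> \<le> C1 * K" using C1[OF ps] K0 by (intro mult_right_mono)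
    finally have 2: "\<bar>\<Sum>i<m. (a (Suc i) n - a i n) * y (Suc i) n\<bar> \<le> C1 * K" .
    let ?r = "\<lambda>i j. \<bar>rect_incr g (ps i) (ps (Suc i)) (pt j) (pt (Suc j))\<bar>"
    have "\<bar>\<Sum>i<m. \<Sum>j<n. (a (Suc i) (Suc j) - a i (Suc j) - a (Suc i) j + a i j) * y (Suc i) (Suc j)\<bar>
        \<le> (\<Sum>i<m. \<Sum>j<n. ?r (Suc i) (Suc j) * K)"
    proof (intro order_trans[OF sum_abs] sum_mono)
      fix i j
      show "\<bar>(a (Suc i) (Suc j) - a i (Suc j) - a (Suc i) j + a i j) * y (Suc i) (Suc j)\<bar> \<le> ?r (Suc i) (Suc j) * K"
        using yK[of "Suc i" "Suc j"] unfolding abs_mult a_def rect_incr_def pS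
        by (intro mult_mono) auto
    qed
    also have "\<dots> = (\<Sum>i<m. \<Sum>j<n. ?r (Suc i) (Suc j)) * K" by (simp add: sum_distrib_right)
    also have "\<dots> \<le> (\<Sum>i<Suc m. \<Sum>j<Suc n. ?r i j) * K"
    proof (rule mult_right_mono[OF _ K0])
      have "(\<Sum>i<m. \<Sum>j<n. ?r (Suc i) (Suc j)) \<le> (\<Sum>i<m. \<Sum>j<Suc n. ?r (Suc i) j)"
        by (intro sum_mono sum_shift_le[of "?r (Suc _)"]) auto
      also have "\<dots> \<le> (\<Sum>i<Suc m. \<Sum>j<Suc n. ?r i j)"
        by (rule sum_shift_le) (auto intro!: sum_nonneg)
      finally show "(\<Sum>i<m. \<Sum>j<n. ?r (Suc i) (Suc j)) \<le> (\<Sum>i<Suc m. \<Sum>j<Suc n. ?r i j)" .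
    qed
    also have "\<dots> \<le> C3 * K" using C3[OF ps pt] K0 by (intro mult_right_mono)
    finally have 3: "\<bar>\<Sum>i<m. \<Sum>j<n. (a (Suc i) (Suc j) - a i (Suc j) - a (Suc i) j + a i j) * y (Suc i) (Suc j)\<bar>
      \<le> C3 * K" .
    show ?thesis unfolding eq C_def distrib_right[where c=K] using 0 1 2 3 by linarith
  qed
  have "0 \<le> C"
  proof -
    have p: "is_partition L 1 (\<lambda>i. if i = 0 then 0 else L)" if "0 \<le> L" for L
      using that by (auto simp: is_partition_def)
    have "0 \<le> C1" by (rule order_trans[OF _ C1[OF p[OF ST(1)]]]) (auto intro!: sum_nonneg)
    moreover have "0 \<le> C2" by (rule order_trans[OF _ C2[OF p[OF ST(2)]]]) (auto intro!: sum_nonneg)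
    moreover have "0 \<le> C3" by (rule order_trans[OF _ C3[OF p[OF ST(1)] p[OF ST(2)]]]) (auto intro!: sum_nonneg)
    ultimately show ?thesis by (simp add: C_def)
  qed
  with bound show ?thesis by (intro that[of C]) blast+
qed

text \<open>If the rectangle increments of \<open>x\<close> have a bounded density
  \<open>\<psi>\<close>, a Riemann--Stieltjes sum is exactly the integral of a step function against
  \<open>\<psi>\<close>. The error is then at most \<open>M\<close> times the \<open>L^1\<close>
  distance of the step function from \<open>g\<close>.\<close>

lemma has_rs_integral_density:
  assumes ST: "0 \<le> S" "0 \<le> T" and bv: "bv_hk S T g"
    and psi: "\<psi> \<in> borel_measurable (leb_Q S T)" "\<And>p. p \<in> Qrect S T \<Longrightarrow> \<bar>\<psi> p\<bar> \<le> M" "0 \<le> M"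
    and x: "\<And>a b c d. 0 \<le> a \<Longrightarrow> a \<le> b \<Longrightarrow> b \<le> S \<Longrightarrow> 0 \<le> c \<Longrightarrow> c \<le> d \<Longrightarrow> d \<le> T \<Longrightarrow>
      rect_incr x a b c d = (LINT p|leb_Q S T. indicator ({a<..b} \<times> {c<..d}) p * \<psi> p)"
  shows "has_rs_integral S T g x (LINT p|leb_Q S T. g p * \<psi> p)"
  unfolding has_rs_integral_iff
proof (intro allI impI)
  fix e :: real assume e: "e > 0"
  obtain K where K: "0 \<le> K" "\<And>d m s \<sigma> n t \<tau>. tagged S d m s \<sigma> \<Longrightarrow> tagged T d n t \<tau> \<Longrightarrow> 0 < d \<Longrightarrow>
    \<exists>D. integrable (leb_Q S T) D \<and> (LINT p|leb_Q S T. D p) \<le> K * d \<and> (\<forall>p. 0 \<le> D p) \<and>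
      (AE p in leb_Q S T. \<bar>(\<Sum>i<m. \<Sum>j<n. g (\<sigma> i, \<tau> j) * indicator (cell s t i j) p) - g p\<bar> \<le> D p)"
    by (rule bv_step_approx[OF ST bv]) blast
  obtain B where B: "\<And>p. p \<in> Qrect S T \<Longrightarrow> \<bar>g p\<bar> \<le> B" by (rule bv_bounded[OF ST bv]) blast
  have psi_int: "integrable (leb_Q S T) (\<lambda>p. v p * \<psi> p)" if "v \<in> L2fun S T" for v
    by (rule L2fun_mult_integrable[OF that L2fun_bounded[OF psi(1,2)]])
  have gL: "g \<in> L2fun S T" by (rule L2fun_bounded[OF bv_measurable[OF ST bv] B])
  \<comment> \<open>The error will be at most \<open>M * K * d\<close>; the added 1 makes this
    strictly less than \<open>e\<close> and covers \<open>M * K = 0\<close>.\<close>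
  define d where "d = e / (M * K + 1)"
  have d: "d > 0" using e psi(3) K(1) by (auto simp: d_def intro!: divide_pos_pos add_nonneg_pos)
  show "\<exists>d>0. \<forall>m n s t \<sigma> \<tau>. tagged S d m s \<sigma> \<longrightarrow> tagged T d n t \<tau> \<longrightarrow>
      \<bar>rs_sum g x m s \<sigma> n t \<tau> - (LINT p|leb_Q S T. g p * \<psi> p)\<bar> < e"
  proof (intro exI[of _ d] conjI allI impI d)
    fix m n s t \<sigma> \<tau> assume tS: "tagged S d m s \<sigma>" and tT: "tagged T d n t \<tau>"
    have s: "is_partition S m s" and t: "is_partition T n t" using tS tT by (auto simp: tagged_def)
    obtain D where D: "integrable (leb_Q S T) D" "(LINT p|leb_Q S T. D p) \<le> K * d" "\<And>p. 0 \<le> D p"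
      "AE p in leb_Q S T. \<bar>(\<Sum>i<m. \<Sum>j<n. g (\<sigma> i, \<tau> j) * indicator (cell s t i j) p) - g p\<bar> \<le> D p"
      using K(2)[OF tS tT d] by blast
    let ?W = "\<lambda>p. \<Sum>i<m. \<Sum>j<n. g (\<sigma> i, \<tau> j) * indicator (cell s t i j) p"
    have ind: "indicat_real (cell s t i j) \<in> L2fun S T" if "i < m" "j < n" for i j
      using cell_leb_Q(1)[OF s t that] by (intro L2fun_bounded[of _ _ _ 1]) (auto simp: indicator_def)
    have WL: "?W \<in> L2fun S T" using ind by (intro L2fun_sum L2fun_scale) auto
    have "rs_sum g x m s \<sigma> n t \<tau> = (\<Sum>i<m. \<Sum>j<n. LINT p|leb_Q S T. (g (\<sigma> i, \<tau> j) * indicator (cell s t i j) p) * \<psi> p)"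
      unfolding rs_sum_def
    proof (intro sum.cong refl)
      fix i j assume "i \<in> {..<m}" "j \<in> {..<n}"
      then have "rect_incr x (s i) (s (Suc i)) (t j) (t (Suc j)) =
          (LINT p|leb_Q S T. indicator (cell s t i j) p * \<psi> p)"
        unfolding cell_def using s t is_partition_nonneg[OF s, of i] is_partition_nonneg[OF t, of j]
          is_partition_le[OF s, of "Suc i"] is_partition_le[OF t, of "Suc j"]
        by (intro x) (auto simp: is_partition_def)
      then show "g (\<sigma> i, \<tau> j) * rect_incr x (s i) (s (Suc i)) (t j) (t (Suc j)) =
          (LINT p|leb_Q S T. (g (\<sigma> i, \<tau> j) * indicator (cell s t i j) p) * \<psi> p)"
        by (simp add: mult.assoc)
    qed
    also have "\<dots> = (\<Sum>i<m. LINT p|leb_Q S T. (\<Sum>j<n. (g (\<sigma> i, \<tau> j) * indicator (cell s t i j) p) * \<psi> p))"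
      using ind by (intro sum.cong refl Bochner_Integration.integral_sum[symmetric] psi_int L2fun_scale) auto
    also have "\<dots> = (LINT p|leb_Q S T. (\<Sum>i<m. \<Sum>j<n. (g (\<sigma> i, \<tau> j) * indicator (cell s t i j) p) * \<psi> p))"
      using ind by (intro Bochner_Integration.integral_sum[symmetric] Bochner_Integration.integrable_sum
          psi_int L2fun_scale) auto
    also have "\<dots> = (LINT p|leb_Q S T. ?W p * \<psi> p)" by (simp only: sum_distrib_right)
    finally have "rs_sum g x m s \<sigma> n t \<tau> - (LINT p|leb_Q S T. g p * \<psi> p) =
        (LINT p|leb_Q S T. (?W p - g p) * \<psi> p)"
      using psi_int[OF WL] psi_int[OF gL]
      by (simp add: left_diff_distrib Bochner_Integration.integral_diff)
    also have "\<bar>\<dots>\<bar> \<le> (LINT p|leb_Q S T. M * D p)"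
    proof (rule order_trans[OF integral_abs_bound], rule integral_mono_AE)
      show "integrable (leb_Q S T) (\<lambda>p. \<bar>(?W p - g p) * \<psi> p\<bar>)"
        by (intro integrable_abs psi_int L2fun_diff WL gL)
      show "AE p in leb_Q S T. \<bar>(?W p - g p) * \<psi> p\<bar> \<le> M * D p"
        using D(4) AE_space
      proof eventually_elim
        case (elim p)
        then have "\<bar>\<psi> p\<bar> * \<bar>?W p - g p\<bar> \<le> M * D p"
          using psi(2)[of p] psi(3) by (intro mult_mono) auto
        then show ?case by (simp add: abs_mult mult.commute)
      qed
    qed (use D in simp)
    also have "\<dots> \<le> M * (K * d)" using D(2) psi(3) by (simp add: mult_left_mono)
    also have "\<dots> < (M * K + 1) * d" using d by (simp add: algebra_simps)
    also have "\<dots> = e"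
    proof -
      have "M * K + 1 > 0" using psi(3) K(1) by (intro add_nonneg_pos) auto
      then show ?thesis by (simp add: d_def)
    qed
    finally show "\<bar>rs_sum g x m s \<sigma> n t \<tau> - (LINT p|leb_Q S T. g p * \<psi> p)\<bar> < e" .
  qed
qed

section \<open>Polynomial integrators\<close>

lemma integral_halfopen_FTC:
  fixes A :: "real \<Rightarrow> real"
  assumes "a \<le> b" "\<And>x. (A has_real_derivative A' x) (at x)" "continuous_on UNIV A'"
  shows "has_bochner_integral lborel (\<lambda>x. indicator {a<..b} x * A' x) (A b - A a)"
proof -
  have "has_bochner_integral lborel (\<lambda>x. A' x * indicator {a..b} x) (A b - A a)"
    by (rule has_bochner_integral_FTC_Icc_real[OF assms(1)])
      (use assms in \<open>auto simp: continuous_on_eq_continuous_at\<close>)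
  moreover have [measurable]: "A' \<in> borel_measurable borel"
    using assms(3) by (rule borel_measurable_continuous_onI)
  have "AE x in lborel. A' x * indicator {a..b} x = indicator {a<..b} x * A' x"
    using AE_lborel_singleton[of a] by eventually_elim (auto simp: indicator_def)
  ultimately show ?thesis
    by (subst (asm) has_bochner_integral_cong_AE[where g="\<lambda>x. indicator {a<..b} x * A' x"]) auto
qed

lemma integral_product_box:
  fixes A B :: "real \<Rightarrow> real"
  assumes "0 \<le> a" "a \<le> b" "b \<le> S" "0 \<le> c" "c \<le> d" "d \<le> T"
    and A: "\<And>x. (A has_real_derivative A' x) (at x)" "continuous_on UNIV A'"
    and B: "\<And>x. (B has_real_derivative B' x) (at x)" "continuous_on UNIV B'"
  shows "(LINT p|leb_Q S T. indicator ({a<..b} \<times> {c<..d}) p * (A' (fst p) * B' (snd p))) =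
    (A b - A a) * (B d - B c)"
proof -
  note iA = integral_halfopen_FTC[OF assms(2) A] and iB = integral_halfopen_FTC[OF assms(5) B]
  have [measurable]: "A' \<in> borel_measurable borel" "B' \<in> borel_measurable borel"
    using A(2) B(2) by (auto intro: borel_measurable_continuous_onI)
  let ?f = "\<lambda>p. indicator ({a<..b} \<times> {c<..d}) p * (A' (fst p) * B' (snd p)) :: real"
  have f: "?f = (\<lambda>(x, y). (indicator {a<..b} x * A' x) * (indicator {c<..d} y * B' y))"
    by (auto simp: fun_eq_iff indicator_def)
  have fxy: "?f (x, y) = (indicator {a<..b} x * A' x) * (indicator {c<..d} y * B' y)" for x y
    by (auto simp: indicator_def)
  have fm: "?f \<in> borel_measurable (lborel \<Otimes>\<^sub>M lborel)" unfolding f by measurable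
  have sub: "indicator (Qrect S T) p * ?f p = ?f p" for p
    using assms by (auto simp: indicator_def Qrect_def)
  have "(LINT p|leb_Q S T. ?f p) = (LINT p|lebesgue. indicator (Qrect S T) p *\<^sub>R ?f p)"
    by (subst integral_restrict_space) auto
  also have "\<dots> = (LINT p|lebesgue. ?f p)" by (simp only: real_scaleR_def sub)
  also have "\<dots> = (LINT p|(lborel \<Otimes>\<^sub>M lborel). ?f p)"
    unfolding lborel_prod using fm by (intro integral_completion) (simp add: lborel_prod)
  also have "\<dots> = (LINT x|lborel. (LINT y|lborel. ?f (x, y)))"
  proof (rule lborel_pair.integral_fst'[symmetric], rule lborel_pair.Fubini_integrable[OF fm])
    show "integrable lborel (\<lambda>x. LINT y|lborel. norm (?f (x, y)))"
      unfolding fxy using integrable_abs[OF integrable.intros[OF iA]] by (simp add: abs_mult)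
    show "AE x in lborel. integrable lborel (\<lambda>y. ?f (x, y))"
      unfolding fxy using integrable.intros[OF iB] by simp
  qed
  also have "\<dots> = (A b - A a) * (B d - B c)"
    unfolding fxy using iA[THEN has_bochner_integral_integral_eq] iB[THEN has_bochner_integral_integral_eq]
    by simp
  finally show ?thesis .
qed

text \<open>Polynomials from the Stone--Weierstrass theorem are closed under products, whereas
  existence of the integral passes only through linear combinations. Expanding into monomials
  removes the products.\<close>

inductive monomial_sum :: "(pt \<Rightarrow> real) \<Rightarrow> bool" where
  mono: "monomial_sum (\<lambda>p. c * (fst p ^ a * snd p ^ b))"
| add: "monomial_sum x \<Longrightarrow> monomial_sum y \<Longrightarrow> monomial_sum (\<lambda>p. x p + y p)"

lemma monomial_sum_mult:
  assumes "monomial_sum x" "monomial_sum y"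
  shows "monomial_sum (\<lambda>p. x p * y p)"
  using assms
proof (induction x)
  case (mono c a b)
  from mono show ?case
  proof (induction y)
    case (mono c' a' b')
    have "(\<lambda>p. c * (fst p ^ a * snd p ^ b) * (c' * (fst p ^ a' * snd p ^ b'))) =
        (\<lambda>p. c * c' * (fst p ^ (a + a') * snd p ^ (b + b')) :: real)"
      by (simp add: fun_eq_iff power_add algebra_simps)
    then show ?case using monomial_sum.mono by metis
  next
    case (add x y)
    then show ?case using monomial_sum.add by (simp add: distrib_left)
  qed
next
  case (add x x')
  then show ?case using monomial_sum.add by (simp add: distrib_right)
qed

lemma monomial_sum_polynomial: "real_polynomial_function x \<Longrightarrow> monomial_sum x"
proof (induction x rule: real_polynomial_function.induct)
  case (linear f)
  then interpret bounded_linear f .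
  have "f p = f (1, 0) * (fst p ^ 1 * snd p ^ 0) + f (0, 1) * (fst p ^ 0 * snd p ^ 1)" for p
  proof -
    have eq: "fst p *\<^sub>R (1, 0) + snd p *\<^sub>R (0, 1) = p" by (simp add: prod_eq_iff)
    have "f p = f (1, 0) * fst p + f (0, 1) * snd p"
      using add[of "fst p *\<^sub>R (1, 0)" "snd p *\<^sub>R (0, 1)"]
      unfolding eq scaleR real_scaleR_def by (simp only: mult.commute)
    then show ?thesis by (simp only: power_one_right power_0 mult_1_left mult_1_right)
  qed
  then have eq: "f = (\<lambda>p. f (1, 0) * (fst p ^ 1 * snd p ^ 0) + f (0, 1) * (fst p ^ 0 * snd p ^ 1))" by (rule ext)
  show ?case by (subst eq) (intro monomial_sum.add monomial_sum.mono)
next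
  case (const c)
  then show ?case using monomial_sum.mono[of c 0 0] by simp
qed (auto intro: monomial_sum.add monomial_sum_mult)

lemma has_rs_integral_monomial:
  assumes ST: "0 \<le> S" "0 \<le> T" and bv: "bv_hk S T g"
  shows "\<exists>I. has_rs_integral S T g (\<lambda>p. fst p ^ a * snd p ^ b) I"
proof -
  \<comment> \<open>\<open>?psi\<close> is the mixed partial derivative of the monomial. For
    exponent 0 the factor \<open>real a\<close> or \<open>real b\<close> vanishes, so the truncated
    subtraction in the power is harmless.\<close>
  let ?A = "\<lambda>x. real a * x ^ (a - 1)" and ?B = "\<lambda>x. real b * x ^ (b - 1)"
  let ?psi = "\<lambda>p. ?A (fst p) * ?B (snd p)"
  have "continuous_on (cbox (0,0) (S,T)) ?psi" by (intro continuous_intros)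
  then have "bounded (?psi ` Qrect S T)"
    unfolding Qrect_cbox by (intro compact_imp_bounded compact_continuous_image) auto
  then obtain M where M: "0 < M" "\<And>p. p \<in> Qrect S T \<Longrightarrow> \<bar>?psi p\<bar> \<le> M"
    unfolding bounded_pos by auto
  have "?psi \<in> borel_measurable borel"
    by (intro borel_measurable_continuous_onI continuous_intros)
  then have m1: "?psi \<in> borel_measurable (leb_Q S T)"
    by (intro measurable_restrict_space1 measurable_completion) simp
  have m2: "rect_incr (\<lambda>p. fst p ^ a * snd p ^ b) a' b' c' d' =
      (LINT p|leb_Q S T. indicator ({a'<..b'} \<times> {c'<..d'}) p * ?psi p)"
    if "0 \<le> a'" "a' \<le> b'" "b' \<le> S" "0 \<le> c'" "c' \<le> d'" "d' \<le> T" for a' b' c' d'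
  proof -
    have "(LINT p|leb_Q S T. indicator ({a'<..b'} \<times> {c'<..d'}) p * ?psi p) =
        (b' ^ a - a' ^ a) * (d' ^ b - c' ^ b)"
      by (rule integral_product_box[OF that])
        (auto intro!: derivative_eq_intros continuous_intros)
    then show ?thesis by (simp add: rect_incr_def algebra_simps)
  qed
  show ?thesis
    using has_rs_integral_density[OF ST bv m1 M(2) less_imp_le[OF M(1)] m2] by blast
qed

lemma has_rs_integral_monomial_sum:
  assumes ST: "0 \<le> S" "0 \<le> T" and bv: "bv_hk S T g" and x: "monomial_sum x"
  shows "\<exists>I. has_rs_integral S T g x I"
  using x
proof induction
  case (mono c a b)
  obtain I where I: "has_rs_integral S T g (\<lambda>p. fst p ^ a * snd p ^ b) I"
    using has_rs_integral_monomial[OF ST bv] by blast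
  from has_rs_integral_linear_right[OF I I, of c 0] show ?case by auto
next
  case (add x y)
  then obtain I J where "has_rs_integral S T g x I" "has_rs_integral S T g y J" by blast
  from has_rs_integral_linear_right[OF this, of 1 1] show ?case by auto
qed

text \<open>The sums are bounded by a multiple of \<open>sup \<bar>x\<bar>\<close> uniformly in the partition, and they converge
  for polynomial \<open>x\<close>, so they converge for all uniform limits of polynomials.\<close>

lemma has_rs_integral_exists:
  assumes ST: "0 \<le> S" "0 \<le> T" and bv: "bv_hk S T g" and x: "x \<in> C0 S T"
  shows "\<exists>I. has_rs_integral S T g x I"
proof -
  obtain C where C: "0 \<le> C"
    "\<And>d m s \<sigma> n t \<tau> x K. tagged S d m s \<sigma> \<Longrightarrow> tagged T d n t \<tau> \<Longrightarrow>
      (\<And>p. p \<in> Qrect S T \<Longrightarrow> \<bar>x p\<bar> \<le> K) \<Longrightarrow> (\<And>s. s \<in> {0..S} \<Longrightarrow> x (s, 0) = 0) \<Longrightarrow>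
      (\<And>t. t \<in> {0..T} \<Longrightarrow> x (0, t) = 0) \<Longrightarrow> \<bar>rs_sum g x m s \<sigma> n t \<tau>\<bar> \<le> C * K"
    by (rule rs_sum_bound[OF ST bv]) blast
  have x0: "\<And>s. s \<in> {0..S} \<Longrightarrow> x (s, 0) = 0" "\<And>t. t \<in> {0..T} \<Longrightarrow> x (0, t) = 0"
    and cont: "continuous_on (Qrect S T) x"
    using x by (auto simp: C0_def)
  have approx: "\<exists>y I. has_rs_integral S T g y I \<and> (\<forall>d m s \<sigma> n t \<tau>. tagged S d m s \<sigma> \<longrightarrow> tagged T d n t \<tau> \<longrightarrow>
      \<bar>rs_sum g x m s \<sigma> n t \<tau> - rs_sum g y m s \<sigma> n t \<tau>\<bar> \<le> e)" if "e > 0" for e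
  proof -
    define e' where "e' = e / (4 * C + 1)"
    have e': "e' > 0" using that C(1) by (auto simp: e'_def)
    have "compact (Qrect S T)" by (simp add: Qrect_cbox)
    from Stone_Weierstrass_real_polynomial_function[OF this cont e'] obtain y where
      y: "real_polynomial_function y" "\<And>p. p \<in> Qrect S T \<Longrightarrow> \<bar>x p - y p\<bar> < e'" by blast
    obtain I where I: "has_rs_integral S T g y I"
      using has_rs_integral_monomial_sum[OF ST bv monomial_sum_polynomial[OF y(1)]] by blast
    \<comment> \<open>The approximating polynomial need not vanish on the axes. Subtracting its
      boundary values leaves all rectangle increments unchanged and makes the difference vanish
      there. Since \<open>x\<close> is zero on the axes, each of the four terms costs at most
      \<open>e'\<close>, whence the 4 in \<open>e'\<close>.\<close>
    define z where "z p = x p - (y p - y (fst p, 0) - y (0, snd p) + y (0, 0))" for p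
    have "\<bar>rs_sum g x m s \<sigma> n t \<tau> - rs_sum g y m s \<sigma> n t \<tau>\<bar> \<le> e"
      if "tagged S d m s \<sigma>" "tagged T d n t \<tau>" for d m s \<sigma> n t \<tau>
    proof -
      have "rs_sum g x m s \<sigma> n t \<tau> - rs_sum g y m s \<sigma> n t \<tau> = rs_sum g z m s \<sigma> n t \<tau>"
        unfolding rs_sum_def z_def rect_incr_def sum_subtractf[symmetric]
        by (simp add: algebra_simps)
      moreover have "\<bar>rs_sum g z m s \<sigma> n t \<tau>\<bar> \<le> C * (4 * e')"
      proof (rule C(2)[OF that])
        fix p assume p: "p \<in> Qrect S T"
        then have q: "(fst p, 0) \<in> Qrect S T" "(0, snd p) \<in> Qrect S T" "(0, 0) \<in> Qrect S T"
          using ST by (auto simp: Qrect_def)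
        have "x (fst p, 0) = 0" "x (0, snd p) = 0" "x (0, 0) = 0"
          using x0 p ST by (auto simp: Qrect_def)
        then show "\<bar>z p\<bar> \<le> 4 * e'"
          using y(2)[OF p] y(2)[OF q(1)] y(2)[OF q(2)] y(2)[OF q(3)] unfolding z_def by linarith
      qed (use x0 in \<open>auto simp: z_def\<close>)
      moreover have "C * (4 * e') \<le> (4 * C + 1) * e'" using e' by (simp add: algebra_simps)
      moreover have "(4 * C + 1) * e' = e" using C(1) by (simp add: e'_def)
      ultimately show ?thesis by simp
    qed
    then show ?thesis using I by blast
  qed
  have "\<forall>k. \<exists>y I. has_rs_integral S T g y I \<and> (\<forall>d m s \<sigma> n t \<tau>. tagged S d m s \<sigma> \<longrightarrow> tagged T d n t \<tau> \<longrightarrow>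
      \<bar>rs_sum g x m s \<sigma> n t \<tau> - rs_sum g y m s \<sigma> n t \<tau>\<bar> \<le> inverse (real (Suc k)))"
    by (intro allI approx) simp
  then obtain y I where yI: "\<And>k. has_rs_integral S T g (y k) (I k)"
    "\<And>k d m s \<sigma> n t \<tau>. tagged S d m s \<sigma> \<Longrightarrow> tagged T d n t \<tau> \<Longrightarrow>
      \<bar>rs_sum g x m s \<sigma> n t \<tau> - rs_sum g (y k) m s \<sigma> n t \<tau>\<bar> \<le> inverse (real (Suc k))"
    by metis
  let ?r = "\<lambda>y n. rs_sum g y (Suc n) (unif S n) (\<lambda>i. unif S n (Suc i)) (Suc n) (unif T n) (\<lambda>i. unif T n (Suc i))"
  \<comment> \<open>The integrals \<open>I k\<close> and \<open>I l\<close> are compared through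
    their sums on the same uniform partitions, both of which are close to the sums for
    \<open>x\<close>.\<close>
  have diff: "\<bar>I k - I l\<bar> \<le> inverse (real (Suc k)) + inverse (real (Suc l))" for k l
  proof (rule tendsto_upperbound)
    show "(\<lambda>n. \<bar>?r (y k) n - ?r (y l) n\<bar>) \<longlonglongrightarrow> \<bar>I k - I l\<bar>"
      by (intro tendsto_intros has_rs_integral_unif ST yI)
    show "\<forall>\<^sub>F n in sequentially. \<bar>?r (y k) n - ?r (y l) n\<bar> \<le> inverse (real (Suc k)) + inverse (real (Suc l))"
      using tagged_unif_eventually[OF ST(1) zero_less_one] tagged_unif_eventually[OF ST(2) zero_less_one]
    proof eventually_elim
      case (elim n)
      show ?case using yI(2)[OF elim, of k] yI(2)[OF elim, of l] by linarith
    qed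
  qed simp
  have "Cauchy I"
  proof (rule CauchyI)
    fix e :: real assume "e > 0"
    then obtain N where N: "inverse (real (Suc N)) < e / 2" using reals_Archimedean[of "e/2"] by auto
    have "norm (I k - I l) < e" if "k \<ge> N" "l \<ge> N" for k l
    proof -
      have "inverse (real (Suc k)) \<le> inverse (real (Suc N))" "inverse (real (Suc l)) \<le> inverse (real (Suc N))"
        using that by auto
      then show ?thesis unfolding real_norm_def using diff[of k l] N by linarith
    qed
    then show "\<exists>M. \<forall>m\<ge>M. \<forall>n\<ge>M. norm (I m - I n) < e" by blast
  qed
  then obtain J where J: "I \<longlonglongrightarrow> J" by (auto simp: Cauchy_convergent_iff convergent_def)
  have "has_rs_integral S T g x J"
    unfolding has_rs_integral_iff
  proof (intro allI impI)
    fix e :: real assume e: "e > 0"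
    have "(\<lambda>k. inverse (real (Suc k)) + \<bar>I k - J\<bar>) \<longlonglongrightarrow> 0 + \<bar>J - J\<bar>"
      by (intro tendsto_intros J LIMSEQ_inverse_real_of_nat)
    then have "\<forall>\<^sub>F k in sequentially. inverse (real (Suc k)) + \<bar>I k - J\<bar> < e / 2"
      using e by (intro order_tendstoD(2)) auto
    then obtain k where k: "inverse (real (Suc k)) + \<bar>I k - J\<bar> < e / 2"
      by (auto simp: eventually_sequentially)
    obtain d where "d > 0" and d: "\<And>m n s t \<sigma> \<tau>. tagged S d m s \<sigma> \<Longrightarrow> tagged T d n t \<tau> \<Longrightarrow>
        \<bar>rs_sum g (y k) m s \<sigma> n t \<tau> - I k\<bar> < e / 2"
      using yI(1)[of k] e unfolding has_rs_integral_iff by (metis half_gt_zero)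
    show "\<exists>d>0. \<forall>m n s t \<sigma> \<tau>. tagged S d m s \<sigma> \<longrightarrow> tagged T d n t \<tau> \<longrightarrow> \<bar>rs_sum g x m s \<sigma> n t \<tau> - J\<bar> < e"
    proof (intro exI[of _ d] conjI allI impI \<open>d > 0\<close>)
      fix m n s t \<sigma> \<tau> assume tg: "tagged S d m s \<sigma>" "tagged T d n t \<tau>"
      show "\<bar>rs_sum g x m s \<sigma> n t \<tau> - J\<bar> < e"
        using d[OF tg] yI(2)[OF tg, of k] k by linarith
    qed
  qed
  then show ?thesis by blast
qed

section \<open>Gaussian functionals on Yeh--Wiener space\<close>

text \<open>By scaling to the standard normal law; the factor 3 is
  \<open>4! / (2^2 * 2!)\<close>.\<close>

lemma (in prob_space) normal_density_moments:
  assumes \<sigma>: "0 < \<sigma>" and X: "distributed M lborel X (normal_density 0 \<sigma>)"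
  shows "integrable M (\<lambda>x. (X x)\<^sup>2)" "expectation (\<lambda>x. (X x)\<^sup>2) = \<sigma>\<^sup>2"
    "integrable M (\<lambda>x. (X x) ^ 4)" "expectation (\<lambda>x. (X x) ^ 4) = 3 * \<sigma> ^ 4"
    "(LINT x|M. exp (\<i> * of_real (t * X x))) = of_real (exp (- (t\<^sup>2 * \<sigma>\<^sup>2) / 2))"
proof -
  define Z where "Z x = X x / \<sigma>" for x
  have XZ: "X x = \<sigma> * Z x" for x using \<sigma> by (simp add: Z_def)
  have Z: "distributed M lborel Z std_normal_density"
    using X unfolding normal_standard_normal_convert[OF \<sigma>] Z_def by simp
  have d: "distr M lborel Z = std_normal_distribution"
    using distributed_distr_eq_density[OF Z] by simp
  have Zm: "Z \<in> measurable M lborel" by (rule distributed_measurable[OF Z])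
  have i: "integrable M (\<lambda>x. (Z x) ^ (2 * k))"
    "expectation (\<lambda>x. (Z x) ^ (2 * k)) = fact (2 * k) / (2 ^ k * fact k)" for k
    using std_normal_distribution_even_moments[of k] Zm
    unfolding d[symmetric] by (simp_all add: integrable_distr_eq integral_distr)
  have p: "(X x)\<^sup>2 = \<sigma>\<^sup>2 * (Z x) ^ (2 * 1)" "(X x) ^ 4 = \<sigma> ^ 4 * (Z x) ^ (2 * 2)" for x
    by (simp_all add: XZ power_mult_distrib)
  show "integrable M (\<lambda>x. (X x)\<^sup>2)" "integrable M (\<lambda>x. (X x) ^ 4)"
    unfolding p by (intro integrable_mult_right i)+
  show "expectation (\<lambda>x. (X x)\<^sup>2) = \<sigma>\<^sup>2" "expectation (\<lambda>x. (X x) ^ 4) = 3 * \<sigma> ^ 4"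
    unfolding p using i(2)[of 1] i(2)[of 2] by (simp_all add: fact_numeral)
  have "(LINT x|M. exp (\<i> * of_real (t * X x))) = (LINT z|distr M lborel Z. iexp (t * \<sigma> * z))"
    using Zm by (subst integral_distr) (auto simp: XZ mult.assoc)
  also have "\<dots> = char std_normal_distribution (t * \<sigma>)" unfolding d char_def ..
  finally show "(LINT x|M. exp (\<i> * of_real (t * X x))) = of_real (exp (- (t\<^sup>2 * \<sigma>\<^sup>2) / 2))"
    by (simp add: char_std_normal_distribution power_mult_distrib)
qed

lemma power4_add_le: "(a + b) ^ 4 \<le> 8 * a ^ 4 + 8 * (b::real) ^ 4"
proof -
  have sq: "(x + y)\<^sup>2 \<le> 2 * x\<^sup>2 + 2 * y\<^sup>2" for x y :: real
    using sum_squares_bound[of x y] by (simp add: power2_sum)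
  have "(a + b) ^ 4 = ((a + b)\<^sup>2)\<^sup>2" by simp
  also have "\<dots> \<le> (2 * a\<^sup>2 + 2 * b\<^sup>2)\<^sup>2" using sq[of a b] by (intro power_mono) auto
  also have "\<dots> \<le> 2 * (2 * a\<^sup>2)\<^sup>2 + 2 * (2 * b\<^sup>2)\<^sup>2" by (rule sq)
  also have "\<dots> = 8 * a ^ 4 + 8 * b ^ 4" by (simp add: power_mult_distrib)
  finally show ?thesis .
qed

lemma nn_integral_power4_add_le:
  fixes X Y :: "'a \<Rightarrow> real"
  assumes [measurable]: "X \<in> borel_measurable M" "Y \<in> borel_measurable M"
    and "(\<integral>\<^sup>+x. ennreal (X x ^ 4) \<partial>M) \<le> ennreal A" "(\<integral>\<^sup>+x. ennreal (Y x ^ 4) \<partial>M) \<le> ennreal B" "0 \<le> A" "0 \<le> B"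
  shows "(\<integral>\<^sup>+x. ennreal ((a * X x + b * Y x) ^ 4) \<partial>M) \<le> ennreal (8 * a ^ 4 * A + 8 * b ^ 4 * B)"
proof -
  have "(\<integral>\<^sup>+x. ennreal ((a * X x + b * Y x) ^ 4) \<partial>M) \<le>
      (\<integral>\<^sup>+x. ennreal (8 * a ^ 4) * ennreal (X x ^ 4) + ennreal (8 * b ^ 4) * ennreal (Y x ^ 4) \<partial>M)"
  proof (rule nn_integral_mono)
    fix x
    have "(a * X x + b * Y x) ^ 4 \<le> 8 * a ^ 4 * X x ^ 4 + 8 * b ^ 4 * Y x ^ 4"
      using power4_add_le[of "a * X x" "b * Y x"] by (simp add: power_mult_distrib)
    then show "ennreal ((a * X x + b * Y x) ^ 4) \<le>
        ennreal (8 * a ^ 4) * ennreal (X x ^ 4) + ennreal (8 * b ^ 4) * ennreal (Y x ^ 4)"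
      by (simp add: ennreal_mult[symmetric] ennreal_plus[symmetric] ennreal_leI del: ennreal_plus)
  qed
  also have "\<dots> = ennreal (8 * a ^ 4) * (\<integral>\<^sup>+x. ennreal (X x ^ 4) \<partial>M) + ennreal (8 * b ^ 4) * (\<integral>\<^sup>+x. ennreal (Y x ^ 4) \<partial>M)"
    by (simp add: nn_integral_add nn_integral_cmult)
  also have "\<dots> \<le> ennreal (8 * a ^ 4) * ennreal A + ennreal (8 * b ^ 4) * ennreal B"
    using assms by (intro add_mono mult_left_mono) auto
  also have "\<dots> = ennreal (8 * a ^ 4 * A + 8 * b ^ 4 * B)"
    using assms by (simp add: ennreal_mult ennreal_plus)
  finally show ?thesis .
qed

section \<open>Point evaluations and their kernels\<close>

definition origin_box :: "pt \<Rightarrow> pt set" where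
  "origin_box p = {0..fst p} \<times> {0..snd p}"

locale yeh_wiener_space =
  fixes S T :: real and m :: "(pt \<Rightarrow> real) measure"
  assumes S_pos: "0 < S" and T_pos: "0 < T" and yeh_wiener_m: "yeh_wiener S T m"
begin

abbreviation combo :: "pt set \<Rightarrow> (pt \<Rightarrow> real) \<Rightarrow> (pt \<Rightarrow> real) \<Rightarrow> real" where
  "combo J c \<equiv> (\<lambda>x. \<Sum>p\<in>J. c p * x p)"

abbreviation combo_kernel :: "pt set \<Rightarrow> (pt \<Rightarrow> real) \<Rightarrow> pt \<Rightarrow> real" where
  "combo_kernel J c \<equiv> (\<lambda>q. \<Sum>p\<in>J. c p * indicator (origin_box p) q)"

lemma ST: "0 \<le> S" "0 \<le> T" using S_pos T_pos by auto

lemma origin_box_leb_Q: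
  assumes "p \<in> Qrect S T"
  shows "origin_box p \<in> sets (leb_Q S T)"
    and "measure (leb_Q S T) (origin_box p) = fst p * snd p"
proof -
  have eq: "origin_box p = cbox (0,0) p" by (cases p) (simp add: origin_box_def cbox_Pair_eq)
  have sub: "cbox (0,0) p \<subseteq> Qrect S T"
    using assms unfolding eq[symmetric] by (auto simp: Qrect_def origin_box_def)
  show "origin_box p \<in> sets (leb_Q S T)"
    unfolding eq using sub by (auto simp: sets_restrict_space image_iff)
  have "measure (leb_Q S T) (cbox (0,0) p) = measure lborel (cbox (0,0) p)"
    using sub by (subst measure_restrict_space) auto
  also have "\<dots> = fst p * snd p"
    using assms by (cases p) (auto simp: measure_lborel_cbox_eq Qrect_def Basis_prod_def)
  finally show "measure (leb_Q S T) (origin_box p) = fst p * snd p" unfolding eq .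
qed

lemma origin_box_L2: "p \<in> Qrect S T \<Longrightarrow> indicator (origin_box p) \<in> L2fun S T"
  using origin_box_leb_Q(1) by (intro L2fun_bounded[of _ _ _ 1]) (auto simp: indicator_def)

text \<open>The right-hand side is the Yeh--Wiener covariance, so sending the evaluation at
  \<open>p\<close> to the indicator of \<open>[0,p]\<close> is an isometry.\<close>

lemma origin_box_inner:
  assumes "p \<in> Qrect S T" "q \<in> Qrect S T"
  shows "L2inner S T (indicator (origin_box p)) (indicator (origin_box q)) =
    min (fst p) (fst q) * min (snd p) (snd q)"
proof -
  let ?r = "(min (fst p) (fst q), min (snd p) (snd q))"
  have r: "?r \<in> Qrect S T" using assms by (auto simp: Qrect_def)
  have "L2inner S T (indicator (origin_box p)) (indicator (origin_box q)) =
      (LINT x|leb_Q S T. indicator (origin_box ?r) x)"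
    unfolding L2inner_def by (intro Bochner_Integration.integral_cong) (auto simp: indicator_def origin_box_def)
  also have "\<dots> = measure (leb_Q S T) (origin_box ?r \<inter> space (leb_Q S T))" by simp
  also have "origin_box ?r \<inter> space (leb_Q S T) = origin_box ?r"
    using sets.sets_into_space[OF origin_box_leb_Q(1)[OF r]] by blast
  finally show ?thesis using origin_box_leb_Q(2)[OF r] by simp
qed

lemma combo_kernel_L2: "J \<subseteq> Qrect S T \<Longrightarrow> combo_kernel J c \<in> L2fun S T"
  by (intro L2fun_sum L2fun_scale origin_box_L2) auto

text \<open>The description of \<open>m\<close> refers to an uncompleted measure \<open>W\<close>.
  These facts are proved on \<open>W\<close> and carried to the completion once, after which
  \<open>W\<close> disappears. By the isometry the variance of a combination is the squared norm of
  its kernel, and a centered normal law is determined by its variance.\<close>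

lemma yw_facts:
  shows prob_space_m: "prob_space m" and complete_m: "complete_measure m" and space_m: "space m = C0 S T"
    and eval_measurable: "\<And>p. p \<in> Qrect S T \<Longrightarrow> (\<lambda>x. x p) \<in> borel_measurable m"
    and combo_moment: "\<And>J c. finite J \<Longrightarrow> J \<subseteq> Qrect S T \<Longrightarrow>
      (\<integral>\<^sup>+x. ennreal (combo J c x ^ 4) \<partial>m) \<le> ennreal (3 * L2norm S T (combo_kernel J c) ^ 4)"
    and combo_char: "\<And>J c t. finite J \<Longrightarrow> J \<subseteq> Qrect S T \<Longrightarrow>
      (LINT x|m. exp (\<i> * of_real (t * combo J c x))) = of_real (exp (- (t\<^sup>2 * (L2norm S T (combo_kernel J c))\<^sup>2) / 2))"
proof -
  obtain W where W: "m = completion W" "prob_space W" "space W = C0 S T"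
    "sets W = sigma_sets (C0 S T) {{x \<in> C0 S T. x p \<in> B} | p B. p \<in> Qrect S T \<and> B \<in> sets borel}"
    and normal': "\<forall>J c. finite J \<longrightarrow> J \<subseteq> Qrect S T \<longrightarrow> centered_normal W (combo J c)"
    and cov: "\<forall>(s, t)\<in>Qrect S T. \<forall>(s', t')\<in>Qrect S T. (LINT x | W. x (s, t) * x (s', t')) = min s s' * min t t'"
    using yeh_wiener_m unfolding yeh_wiener_def by (elim exE conjE) (rule that)
  have normal: "\<And>J c. finite J \<Longrightarrow> J \<subseteq> Qrect S T \<Longrightarrow> centered_normal W (combo J c)"
    using normal' by blast
  interpret W: prob_space W by fact
  show "prob_space m" unfolding W(1) by (intro prob_spaceI) (simp add: W.emeasure_space_1)
  show "complete_measure m" unfolding W(1) by (rule completion.complete_measure_axioms)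
  show "space m = C0 S T" by (simp add: W)
  have ev: "(\<lambda>x. x p) \<in> borel_measurable W" if "p \<in> Qrect S T" for p
  proof (rule measurableI)
    fix B :: "real set" assume "B \<in> sets borel"
    then have "{x \<in> C0 S T. x p \<in> B} \<in> sets W" unfolding W(4) using that by (intro sigma_sets.Basic) blast
    moreover have "(\<lambda>x. x p) -` B \<inter> space W = {x \<in> C0 S T. x p \<in> B}" using W(3) by auto
    ultimately show "(\<lambda>x. x p) -` B \<inter> space W \<in> sets W" by simp
  qed simp
  then show "(\<lambda>x. x p) \<in> borel_measurable m" if "p \<in> Qrect S T" for p
    unfolding W(1) using that by (intro measurable_completion)
  have cov': "(LINT x|W. x p * x q) = min (fst p) (fst q) * min (snd p) (snd q)"
    if "p \<in> Qrect S T" "q \<in> Qrect S T" for p q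
    using cov that by (cases p; cases q) auto
  fix J c assume J: "finite J" "J \<subseteq> Qrect S T"
  have cm [measurable]: "combo J c \<in> borel_measurable W" using ev J by (intro borel_measurable_sum) auto
  have sq: "integrable W (\<lambda>x. (x p)\<^sup>2)" if "p \<in> Qrect S T" for p
  proof -
    have "centered_normal W (combo {p} (\<lambda>_. 1))" using that by (intro normal) auto
    then have "(AE x in W. x p = 0) \<or> (\<exists>\<sigma>>0. distributed W lborel (\<lambda>x. x p) (normal_density 0 \<sigma>))"
      by (simp add: centered_normal_def)
    then show ?thesis
    proof
      assume "AE x in W. x p = 0"
      then have "AE x in W. (x p)\<^sup>2 = 0" by eventually_elim simp
      then show ?thesis
        using ev[OF that] by (subst integrable_cong_AE[where g="\<lambda>_. 0"]) auto
    qed (use W.normal_density_moments(1) in blast)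
  qed
  have prod: "integrable W (\<lambda>x. x p * x q)" if "p \<in> Qrect S T" "q \<in> Qrect S T" for p q
  proof (rule Bochner_Integration.integrable_bound)
    show "integrable W (\<lambda>x. (x p)\<^sup>2 + (x q)\<^sup>2)" using sq that by auto
    show "(\<lambda>x. x p * x q) \<in> borel_measurable W" using ev that by measurable
    show "AE x in W. norm (x p * x q) \<le> norm ((x p)\<^sup>2 + (x q)\<^sup>2)"
      using abs_mult_le_sum_squares by auto
  qed
  have "(LINT x|W. (combo J c x)\<^sup>2) = (LINT x|W. (\<Sum>p\<in>J. \<Sum>q\<in>J. c p * c q * (x p * x q)))"
    unfolding power2_eq_square sum_product by (simp add: algebra_simps)
  also have "\<dots> = (\<Sum>p\<in>J. \<Sum>q\<in>J. c p * c q * (LINT x|W. x p * x q))"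
  proof -
    have i: "integrable W (\<lambda>x. c p * c q * (x p * x q))" if "p \<in> J" "q \<in> J" for p q
      using that J(2) by (intro integrable_mult_right prod) auto
    have "(LINT x|W. (\<Sum>p\<in>J. \<Sum>q\<in>J. c p * c q * (x p * x q))) =
        (\<Sum>p\<in>J. LINT x|W. (\<Sum>q\<in>J. c p * c q * (x p * x q)))"
      by (intro Bochner_Integration.integral_sum Bochner_Integration.integrable_sum i)
    also have "\<dots> = (\<Sum>p\<in>J. \<Sum>q\<in>J. LINT x|W. c p * c q * (x p * x q))"
      by (intro sum.cong refl Bochner_Integration.integral_sum i)
    finally show ?thesis by simp
  qed
  also have "\<dots> = (\<Sum>p\<in>J. \<Sum>q\<in>J. c p * c q * L2inner S T (indicator (origin_box p)) (indicator (origin_box q)))"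
  proof (intro sum.cong refl)
    fix p q assume "p \<in> J" "q \<in> J"
    then have pq: "p \<in> Qrect S T" "q \<in> Qrect S T" using J(2) by auto
    show "c p * c q * (LINT x|W. x p * x q) =
        c p * c q * L2inner S T (indicator (origin_box p)) (indicator (origin_box q))"
      unfolding cov'[OF pq] origin_box_inner[OF pq] ..
  qed
  also have "\<dots> = L2inner S T (combo_kernel J c) (combo_kernel J c)"
  proof -
    have "L2inner S T (combo_kernel J c) (combo_kernel J c) =
        (\<Sum>p\<in>J. c p * L2inner S T (indicator (origin_box p)) (combo_kernel J c))"
      using J(2) combo_kernel_L2[OF J(2)] origin_box_L2
      by (subst L2inner_sum_left) (auto simp: L2inner_scale_left intro!: L2fun_scale)
    also have "\<dots> = (\<Sum>p\<in>J. c p * (\<Sum>q\<in>J. c q * L2inner S T (indicator (origin_box p)) (indicator (origin_box q))))"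
    proof (intro sum.cong refl arg_cong2[where f="(*)"])
      fix p assume p: "p \<in> J"
      show "L2inner S T (indicator (origin_box p)) (combo_kernel J c) =
          (\<Sum>q\<in>J. c q * L2inner S T (indicator (origin_box p)) (indicator (origin_box q)))"
      proof (subst L2inner_commute, subst L2inner_sum_left)
        show "(\<lambda>r. c q * indicator (origin_box q) r) \<in> L2fun S T" if "q \<in> J" for q
          using that J(2) by (intro L2fun_scale origin_box_L2) auto
        show "indicator (origin_box p) \<in> L2fun S T" using p J(2) by (intro origin_box_L2) auto
      qed (simp add: L2inner_scale_left L2inner_commute[of S T "indicator (origin_box p)"])
    qed
    finally show ?thesis by (simp add: sum_distrib_left mult.assoc)
  qed
  finally have var: "(LINT x|W. (combo J c x)\<^sup>2) = (L2norm S T (combo_kernel J c))\<^sup>2" by (simp add: L2norm_sq)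
  let ?v = "L2norm S T (combo_kernel J c)"
  have main: "(\<integral>\<^sup>+x. ennreal (combo J c x ^ 4) \<partial>W) \<le> ennreal (3 * ?v ^ 4) \<and>
      (LINT x|W. exp (\<i> * of_real (t * combo J c x))) = of_real (exp (- (t\<^sup>2 * ?v\<^sup>2) / 2))" for t
    using normal[OF J, of c] unfolding centered_normal_def
  proof
    \<comment> \<open>In the degenerate case the variance formula forces the kernel to have norm 0,
      so both claims reduce to those for the constant 0.\<close>
    assume z: "AE x in W. combo J c x = 0"
    have "(\<integral>\<^sup>+x. ennreal (combo J c x ^ 4) \<partial>W) = (\<integral>\<^sup>+x. 0 \<partial>W)"
      by (rule nn_integral_cong_AE) (use z in eventually_elim, simp)
    moreover have "?v\<^sup>2 = (LINT x|W. 0)"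
      unfolding var[symmetric] by (rule integral_cong_AE) (use z in \<open>auto elim: eventually_mono\<close>)
    moreover have "(LINT x|W. exp (\<i> * of_real (t * combo J c x))) = (LINT x|W. 1)"
    proof (rule integral_cong_AE)
      show "AE x in W. exp (\<i> * of_real (t * combo J c x)) = 1" using z by eventually_elim simp
      show "(\<lambda>x. exp (\<i> * of_real (t * combo J c x))) \<in> borel_measurable W" by measurable
    qed auto
    ultimately show ?thesis by (simp add: W.prob_space)
  next
    assume "\<exists>\<sigma>>0. distributed W lborel (combo J c) (normal_density 0 \<sigma>)"
    then obtain \<sigma> where \<sigma>: "\<sigma> > 0" "distributed W lborel (combo J c) (normal_density 0 \<sigma>)" by blast
    note mom = W.normal_density_moments[OF \<sigma>]
    have v: "\<sigma>\<^sup>2 = ?v\<^sup>2" using mom(2) var by simp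
    have "?v ^ 4 = (?v\<^sup>2)\<^sup>2" by simp
    also have "\<dots> = \<sigma> ^ 4" unfolding v[symmetric] by simp
    finally have v4: "?v ^ 4 = \<sigma> ^ 4" .
    have "(\<integral>\<^sup>+x. ennreal (combo J c x ^ 4) \<partial>W) = ennreal (3 * \<sigma> ^ 4)"
      using nn_integral_eq_integral[OF mom(3)] mom(4) by simp
    then show ?thesis using mom(5)[of t] v v4 by simp
  qed
  show "(\<integral>\<^sup>+x. ennreal (combo J c x ^ 4) \<partial>m) \<le> ennreal (3 * ?v ^ 4)"
    unfolding W(1) nn_integral_completion using main by blast
  have "(\<lambda>x. exp (\<i> * of_real (t * combo J c x))) \<in> borel_measurable W" for t by measurable
  then show "(LINT x|m. exp (\<i> * of_real (t * combo J c x))) = of_real (exp (- (t\<^sup>2 * ?v\<^sup>2) / 2))" for t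
    unfolding W(1) using main[of t] by (simp only: integral_completion)
qed

sublocale prob_space m by (rule prob_space_m)
sublocale complete_measure m by (rule complete_m)

lemma combo_measurable: "J \<subseteq> Qrect S T \<Longrightarrow> combo J c \<in> borel_measurable m"
  using eval_measurable by (intro borel_measurable_sum borel_measurable_times) auto

text \<open>\<open>rep Z w\<close>: the random variable \<open>Z\<close> is the Wiener integral of \<open>w\<close>, expressed as membership of
  \<open>(Z, w)\<close> in the closure of the graph of \<open>1\<^bsub>[0,p]\<^esub> \<mapsto> x(p)\<close>. The closure is taken in \<open>L\<^sup>4\<close> because
  the almost sure convergence below rests on fourth moments.\<close>

definition rep :: "((pt \<Rightarrow> real) \<Rightarrow> real) \<Rightarrow> (pt \<Rightarrow> real) \<Rightarrow> bool" where
  "rep Z w \<longleftrightarrow> Z \<in> borel_measurable m \<and> w \<in> L2fun S T \<and>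
    (\<forall>e>0. \<exists>J c. finite J \<and> J \<subseteq> Qrect S T \<and>
      (\<integral>\<^sup>+x. ennreal ((Z x - combo J c x) ^ 4) \<partial>m) \<le> ennreal e \<and>
      L2norm S T (\<lambda>q. w q - combo_kernel J c q) \<le> e)"

lemma rep_measurable: "rep Z w \<Longrightarrow> Z \<in> borel_measurable m"
  and rep_L2: "rep Z w \<Longrightarrow> w \<in> L2fun S T"
  by (simp_all add: rep_def)

lemma rep_approx:
  assumes "rep Z w" "0 < e"
  obtains J c where "finite J" "J \<subseteq> Qrect S T"
    "(\<integral>\<^sup>+x. ennreal ((Z x - combo J c x) ^ 4) \<partial>m) \<le> ennreal e"
    "L2norm S T (\<lambda>q. w q - combo_kernel J c q) \<le> e"
  using assms unfolding rep_def by blast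

lemma rep_combo: "finite J \<Longrightarrow> J \<subseteq> Qrect S T \<Longrightarrow> rep (combo J c) (combo_kernel J c)"
  unfolding rep_def
  by (intro conjI combo_measurable combo_kernel_L2 allI impI exI[of _ J] exI[of _ c])
    (auto simp: L2norm_def L2inner_def)

lemma rep_eval: "p \<in> Qrect S T \<Longrightarrow> rep (\<lambda>x. x p) (indicator (origin_box p))"
  using rep_combo[of "{p}" "\<lambda>_. 1"] by simp

text \<open>The constant is \<open>8 * 3\<close>: 3 from the normal law, 8 from splitting a fourth
  power into an approximating combination and an error that tends to 0. Only its being absolute
  matters.\<close>

lemma rep_moment:
  assumes Z: "rep Z w"
  shows "(\<integral>\<^sup>+x. ennreal (Z x ^ 4) \<partial>m) \<le> ennreal (24 * L2norm S T w ^ 4)"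
proof -
  let ?w = "L2norm S T w"
  have bd: "(\<integral>\<^sup>+x. ennreal (Z x ^ 4) \<partial>m) \<le> ennreal (8 * e + 24 * (?w + e) ^ 4)" if e: "e > 0" for e
  proof -
    obtain J c where J: "finite J" "J \<subseteq> Qrect S T"
      and 1: "(\<integral>\<^sup>+x. ennreal ((Z x - combo J c x) ^ 4) \<partial>m) \<le> ennreal e"
      and 2: "L2norm S T (\<lambda>q. w q - combo_kernel J c q) \<le> e"
      by (rule rep_approx[OF Z e]) blast
    have "L2norm S T (combo_kernel J c) \<le> ?w + e"
      using L2norm_reverse_triangle[OF rep_L2[OF Z] combo_kernel_L2[OF J(2), of c]] 2 by linarith
    then have "L2norm S T (combo_kernel J c) ^ 4 \<le> (?w + e) ^ 4" by (intro power_mono) auto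
    then have 3: "(\<integral>\<^sup>+x. ennreal (combo J c x ^ 4) \<partial>m) \<le> ennreal (3 * (?w + e) ^ 4)"
      by (intro order_trans[OF combo_moment[OF J]] ennreal_leI) simp
    have "(\<integral>\<^sup>+x. ennreal ((1 * (Z x - combo J c x) + 1 * combo J c x) ^ 4) \<partial>m)
        \<le> ennreal (8 * 1 ^ 4 * e + 8 * 1 ^ 4 * (3 * (?w + e) ^ 4))"
      using e rep_measurable[OF Z] combo_measurable[OF J(2), of c] 1 3
      by (intro nn_integral_power4_add_le) auto
    then show ?thesis by simp
  qed
  have "(\<lambda>n. ennreal (8 * inverse (real (Suc n)) + 24 * (?w + inverse (real (Suc n))) ^ 4)) \<longlonglongrightarrow>
      ennreal (8 * 0 + 24 * (?w + 0) ^ 4)"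
    by (intro tendsto_ennrealI tendsto_intros LIMSEQ_inverse_real_of_nat)
  then have "(\<integral>\<^sup>+x. ennreal (Z x ^ 4) \<partial>m) \<le> ennreal (8 * 0 + 24 * (?w + 0) ^ 4)"
    by (rule LIMSEQ_le_const) (use bd in auto)
  then show ?thesis by simp
qed

lemma rep_closed:
  assumes Z: "Z \<in> borel_measurable m" and w: "w \<in> L2fun S T"
    and ap: "\<And>e. 0 < e \<Longrightarrow> \<exists>Z' w'. rep Z' w' \<and> (\<integral>\<^sup>+x. ennreal ((Z x - Z' x) ^ 4) \<partial>m) \<le> ennreal e \<and>
      L2norm S T (\<lambda>q. w q - w' q) \<le> e"
  shows "rep Z w"
  unfolding rep_def
proof (intro conjI allI impI Z w)
  fix e :: real assume e: "0 < e"
  \<comment> \<open>Splitting the fourth power multiplies each of the two errors by 8, and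
    \<open>8 * (e / 16) + 8 * (e / 16) = e\<close>.\<close>
  obtain Z' w' where Z': "rep Z' w'" and 1: "(\<integral>\<^sup>+x. ennreal ((Z x - Z' x) ^ 4) \<partial>m) \<le> ennreal (e / 16)"
    and 2: "L2norm S T (\<lambda>q. w q - w' q) \<le> e / 16"
    using ap[of "e / 16"] e by auto
  obtain J c where J: "finite J" "J \<subseteq> Qrect S T"
    and 3: "(\<integral>\<^sup>+x. ennreal ((Z' x - combo J c x) ^ 4) \<partial>m) \<le> ennreal (e / 16)"
    and 4: "L2norm S T (\<lambda>q. w' q - combo_kernel J c q) \<le> e / 16"
    by (rule rep_approx[OF Z', of "e / 16"]) (use e in auto)
  have "(\<integral>\<^sup>+x. ennreal ((1 * (Z x - Z' x) + 1 * (Z' x - combo J c x)) ^ 4) \<partial>m)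
      \<le> ennreal (8 * 1 ^ 4 * (e / 16) + 8 * 1 ^ 4 * (e / 16))"
    using e Z rep_measurable[OF Z'] combo_measurable[OF J(2), of c] 1 3
    by (intro nn_integral_power4_add_le) auto
  then have "(\<integral>\<^sup>+x. ennreal ((Z x - combo J c x) ^ 4) \<partial>m) \<le> ennreal e" by simp
  moreover have "L2norm S T (\<lambda>q. w q - combo_kernel J c q) \<le> e"
    using L2norm_diff_triangle[OF w rep_L2[OF Z'] combo_kernel_L2[OF J(2), of c]] 2 4 e by linarith
  ultimately show "\<exists>J c. finite J \<and> J \<subseteq> Qrect S T \<and>
      (\<integral>\<^sup>+x. ennreal ((Z x - combo J c x) ^ 4) \<partial>m) \<le> ennreal e \<and>
      L2norm S T (\<lambda>q. w q - combo_kernel J c q) \<le> e"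
    using J by blast
qed

lemma rep_linear:
  assumes Z: "rep Z w" and Z': "rep Z' w'"
  shows "rep (\<lambda>x. a * Z x + b * Z' x) (\<lambda>q. a * w q + b * w' q)"
proof (rule rep_closed)
  note m = rep_measurable[OF Z] rep_measurable[OF Z'] and L = rep_L2[OF Z] rep_L2[OF Z']
  show "(\<lambda>x. a * Z x + b * Z' x) \<in> borel_measurable m" using m by measurable
  show "(\<lambda>q. a * w q + b * w' q) \<in> L2fun S T" using L by auto
  fix e :: real assume e: "0 < e"
  define d where "d = e / (8 * a ^ 4 + 8 * b ^ 4 + \<bar>a\<bar> + \<bar>b\<bar> + 1)"
  have pos: "8 * a ^ 4 + 8 * b ^ 4 + \<bar>a\<bar> + \<bar>b\<bar> + 1 > 0" by (simp add: add_nonneg_pos)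
  then have d: "d > 0" using e by (simp add: d_def)
  have de: "(8 * a ^ 4 + 8 * b ^ 4 + \<bar>a\<bar> + \<bar>b\<bar> + 1) * d = e" using pos by (simp add: d_def)
  obtain J c where J: "finite J" "J \<subseteq> Qrect S T"
    and 1: "(\<integral>\<^sup>+x. ennreal ((Z x - combo J c x) ^ 4) \<partial>m) \<le> ennreal d"
    and 2: "L2norm S T (\<lambda>q. w q - combo_kernel J c q) \<le> d"
    by (rule rep_approx[OF Z d]) blast
  obtain J' c' where J': "finite J'" "J' \<subseteq> Qrect S T"
    and 3: "(\<integral>\<^sup>+x. ennreal ((Z' x - combo J' c' x) ^ 4) \<partial>m) \<le> ennreal d"
    and 4: "L2norm S T (\<lambda>q. w' q - combo_kernel J' c' q) \<le> d"
    by (rule rep_approx[OF Z' d]) blast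
  \<comment> \<open>Both coefficient families are extended by 0 to the union of the two finite sets
    of points.\<close>
  define c2 where "c2 p = a * (if p \<in> J then c p else 0) + b * (if p \<in> J' then c' p else 0)" for p
  have c2: "(\<Sum>p\<in>J \<union> J'. c2 p * f p) = a * (\<Sum>p\<in>J. c p * f p) + b * (\<Sum>p\<in>J'. c' p * f p)" for f
  proof -
    have "(\<Sum>p\<in>J \<union> J'. c2 p * f p) = (\<Sum>p\<in>J \<union> J'. a * (if p \<in> J then c p * f p else 0)) +
        (\<Sum>p\<in>J \<union> J'. b * (if p \<in> J' then c' p * f p else 0))"
      unfolding sum.distrib[symmetric] by (intro sum.cong refl) (simp add: c2_def algebra_simps)
    also have "\<dots> = a * (\<Sum>p\<in>J. c p * f p) + b * (\<Sum>p\<in>J'. c' p * f p)"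
      using J(1) J'(1) by (simp add: sum_distrib_left[symmetric] sum.If_cases Int_absorb1)
    finally show ?thesis .
  qed
  have "(\<integral>\<^sup>+x. ennreal ((a * (Z x - combo J c x) + b * (Z' x - combo J' c' x)) ^ 4) \<partial>m)
      \<le> ennreal (8 * a ^ 4 * d + 8 * b ^ 4 * d)"
    using d m combo_measurable[OF J(2), of c] combo_measurable[OF J'(2), of c'] 1 3
    by (intro nn_integral_power4_add_le) auto
  also have "\<dots> \<le> ennreal e" using d unfolding de[symmetric] by (intro ennreal_leI) (simp add: algebra_simps)
  also have "(\<lambda>x. (a * (Z x - combo J c x) + b * (Z' x - combo J' c' x)) ^ 4) =
      (\<lambda>x. (a * Z x + b * Z' x - combo (J \<union> J') c2 x) ^ 4)"
    unfolding c2 by (simp add: algebra_simps)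
  finally have i: "(\<integral>\<^sup>+x. ennreal ((a * Z x + b * Z' x - combo (J \<union> J') c2 x) ^ 4) \<partial>m) \<le> ennreal e" .
  have "L2norm S T (\<lambda>q. a * w q + b * w' q - combo_kernel (J \<union> J') c2 q) =
      L2norm S T (\<lambda>q. a * (w q - combo_kernel J c q) + b * (w' q - combo_kernel J' c' q))"
    unfolding c2 by (simp add: algebra_simps)
  also have "\<dots> \<le> \<bar>a\<bar> * L2norm S T (\<lambda>q. w q - combo_kernel J c q) + \<bar>b\<bar> * L2norm S T (\<lambda>q. w' q - combo_kernel J' c' q)"
    using L combo_kernel_L2[OF J(2), of c] combo_kernel_L2[OF J'(2), of c']
    unfolding L2norm_scale[symmetric] by (intro L2norm_triangle L2fun_scale L2fun_diff)
  also have "\<dots> \<le> \<bar>a\<bar> * d + \<bar>b\<bar> * d" using 2 4 by (intro add_mono mult_left_mono) auto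
  also have "\<dots> \<le> e" using d unfolding de[symmetric] by (simp add: algebra_simps)
  finally have ii: "L2norm S T (\<lambda>q. a * w q + b * w' q - combo_kernel (J \<union> J') c2 q) \<le> e" .
  show "\<exists>Za wa. rep Za wa \<and> (\<integral>\<^sup>+x. ennreal ((a * Z x + b * Z' x - Za x) ^ 4) \<partial>m) \<le> ennreal e \<and>
      L2norm S T (\<lambda>q. a * w q + b * w' q - wa q) \<le> e"
    using rep_combo[of "J \<union> J'" c2] J J' i ii by blast
qed

lemma rep_zero: "rep (\<lambda>x. 0) (\<lambda>q. 0)"
  using rep_combo[of "{}"] by simp

lemma rep_diff: "rep Z w \<Longrightarrow> rep Z' w' \<Longrightarrow> rep (\<lambda>x. Z x - Z' x) (\<lambda>q. w q - w' q)"
  using rep_linear[of Z w Z' w' 1 "-1"] by simp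

lemma rep_sum:
  "(\<And>i. i \<in> A \<Longrightarrow> rep (Z i) (w i)) \<Longrightarrow> rep (\<lambda>x. \<Sum>i\<in>A. c i * Z i x) (\<lambda>q. \<Sum>i\<in>A. c i * w i q)"
proof (induction A rule: infinite_finite_induct)
  case (insert i A)
  then show ?case using rep_linear[of "Z i" "w i" "\<lambda>x. \<Sum>i\<in>A. c i * Z i x" "\<lambda>q. \<Sum>i\<in>A. c i * w i q" "c i" 1] by simp
qed (simp_all add: rep_zero)

text \<open>The moment bound, applied to differences, turns convergence of the kernels in
  \<open>L^2\<close> into a Cauchy condition for the variables in \<open>L^4\<close>; Fatou's lemma
  shows that the almost sure limit is also the limit in \<open>L^4\<close>.\<close>

lemma rep_AE_limit:
  assumes Z: "\<And>n. rep (Z n) (w n)" and v: "v \<in> L2fun S T" and X: "X \<in> borel_measurable m"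
    and lim: "(\<lambda>n. L2norm S T (\<lambda>q. w n q - v q)) \<longlonglongrightarrow> 0" and ae: "AE x in m. (\<lambda>n. Z n x) \<longlonglongrightarrow> X x"
  shows "rep X v"
proof (rule rep_closed[OF X v])
  fix e :: real assume e: "0 < e"
  have [measurable]: "Z n \<in> borel_measurable m" "X \<in> borel_measurable m" for n
    using rep_measurable[OF Z] X by auto
  let ?d = "\<lambda>n. L2norm S T (\<lambda>q. w n q - v q)"
  have "(\<lambda>n. 24 * (?d n + ?d n) ^ 4) \<longlonglongrightarrow> 24 * (0 + 0) ^ 4" by (intro tendsto_intros lim)
  then have "\<forall>\<^sub>F n in sequentially. 24 * (?d n + ?d n) ^ 4 < e \<and> ?d n < e"
    using e by (intro eventually_conj order_tendstoD(2)[OF lim] order_tendstoD(2)[where y="24 * (0 + 0) ^ 4"]) auto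
  then obtain n where n: "24 * (?d n + ?d n) ^ 4 < e" "?d n < e" by (auto simp: eventually_sequentially)
  \<comment> \<open>The index \<open>n\<close> stays fixed while \<open>k\<close> tends to infinity.
    The choice of \<open>n\<close> bounds \<open>2 * ?d n\<close>, which leaves room for
    \<open>?d k + ?d n\<close>.\<close>
  have dn: "\<forall>\<^sub>F k in sequentially. 24 * (?d k + ?d n) ^ 4 < e"
  proof -
    have "(\<lambda>k. 24 * (?d k + ?d n) ^ 4) \<longlonglongrightarrow> 24 * (0 + ?d n) ^ 4" by (intro tendsto_intros lim)
    moreover have "(0 + ?d n) ^ 4 \<le> (?d n + ?d n) ^ 4" by (intro power_mono) auto
    then have "24 * (0 + ?d n) ^ 4 < e" using n by linarith
    ultimately show ?thesis by (rule order_tendstoD(2))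
  qed
  have "(\<integral>\<^sup>+x. ennreal ((X x - Z n x) ^ 4) \<partial>m) = (\<integral>\<^sup>+x. liminf (\<lambda>k. ennreal ((Z k x - Z n x) ^ 4)) \<partial>m)"
  proof (intro nn_integral_cong_AE, use ae in eventually_elim)
    case (elim x)
    then have "(\<lambda>k. ennreal ((Z k x - Z n x) ^ 4)) \<longlonglongrightarrow> ennreal ((X x - Z n x) ^ 4)"
      by (intro tendsto_ennrealI tendsto_intros)
    then show ?case by (intro lim_imp_Liminf[symmetric]) auto
  qed
  also have "\<dots> \<le> liminf (\<lambda>k. \<integral>\<^sup>+x. ennreal ((Z k x - Z n x) ^ 4) \<partial>m)"
    by (rule nn_integral_liminf) measurable
  also have "\<dots> \<le> liminf (\<lambda>k. ennreal e)"
  proof (rule Liminf_mono, use dn in eventually_elim)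
    case (elim k)
    have "L2norm S T (\<lambda>q. w k q - w n q) \<le> ?d k + ?d n"
      using L2norm_diff_triangle[OF rep_L2[OF Z[of k]] v rep_L2[OF Z[of n]]]
      by (simp add: L2norm_minus_commute[of S T v])
    then have "24 * L2norm S T (\<lambda>q. w k q - w n q) ^ 4 \<le> 24 * (?d k + ?d n) ^ 4"
      by (intro mult_left_mono power_mono) auto
    with elim show ?case
      by (intro order_trans[OF rep_moment[OF rep_diff[OF Z Z]]] ennreal_leI) linarith
  qed
  also have "\<dots> = ennreal e" by (simp add: Liminf_const)
  finally show "\<exists>Z' w'. rep Z' w' \<and> (\<integral>\<^sup>+x. ennreal ((X x - Z' x) ^ 4) \<partial>m) \<le> ennreal e \<and>
      L2norm S T (\<lambda>q. v q - w' q) \<le> e"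
    using Z[of n] less_imp_le[OF n(2)] unfolding L2norm_minus_commute[of S T "w n" v] by blast
qed

lemma rep_cong_AE:
  assumes Z: "rep Z w" and ae: "AE x in m. Z x = Z' x"
  shows "rep Z' w"
proof (rule rep_AE_limit[of "\<lambda>_. Z" "\<lambda>_. w"])
  show "Z' \<in> borel_measurable m" by (rule borel_measurable_AE_eq[OF rep_measurable[OF Z] ae])
  show "AE x in m. (\<lambda>n. Z x) \<longlonglongrightarrow> Z' x" using ae by eventually_elim simp
qed (use Z rep_L2 in \<open>auto simp: L2norm_def L2inner_def\<close>)

text \<open>A subsequence of the approximating combinations converges almost surely, so their
  characteristic functions converge by bounded convergence. The variances converge with the norms of
  the kernels.\<close>

lemma rep_char:
  assumes Z: "rep Z w"
  shows "(LINT x|m. exp (\<i> * of_real (t * Z x))) = of_real (exp (- (t\<^sup>2 * (L2norm S T w)\<^sup>2) / 2))"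
proof -
  have [measurable]: "Z \<in> borel_measurable m" by (rule rep_measurable[OF Z])
  have "\<forall>n. \<exists>J c. finite J \<and> J \<subseteq> Qrect S T \<and>
      (\<integral>\<^sup>+x. ennreal ((Z x - combo J c x) ^ 4) \<partial>m) \<le> ennreal (inverse (real (Suc n))) \<and>
      L2norm S T (\<lambda>q. w q - combo_kernel J c q) \<le> inverse (real (Suc n))"
    using Z by (simp add: rep_def)
  from this[THEN choice] obtain J where "\<forall>n. \<exists>c. finite (J n) \<and> J n \<subseteq> Qrect S T \<and>
      (\<integral>\<^sup>+x. ennreal ((Z x - combo (J n) c x) ^ 4) \<partial>m) \<le> ennreal (inverse (real (Suc n))) \<and>
      L2norm S T (\<lambda>q. w q - combo_kernel (J n) c q) \<le> inverse (real (Suc n))"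
    by (elim exE)
  from this[THEN choice] obtain c where Jc: "\<forall>n. finite (J n) \<and> J n \<subseteq> Qrect S T \<and>
      (\<integral>\<^sup>+x. ennreal ((Z x - combo (J n) (c n) x) ^ 4) \<partial>m) \<le> ennreal (inverse (real (Suc n))) \<and>
      L2norm S T (\<lambda>q. w q - combo_kernel (J n) (c n) q) \<le> inverse (real (Suc n))"
    by (elim exE)
  have J: "finite (J n)" "J n \<subseteq> Qrect S T"
    and 1: "(\<integral>\<^sup>+x. ennreal ((Z x - combo (J n) (c n) x) ^ 4) \<partial>m) \<le> ennreal (inverse (real (Suc n)))"
    and 2: "L2norm S T (\<lambda>q. w q - combo_kernel (J n) (c n) q) \<le> inverse (real (Suc n))" for n
    using Jc by blast+
  have [measurable]: "combo (J n) (c n) \<in> borel_measurable m" for n by (rule combo_measurable[OF J(2)])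
  let ?D = "\<lambda>n x. (Z x - combo (J n) (c n) x) ^ 4"
  have int: "integrable m (?D n)" for n
    using 1[of n] by (intro integrableI_bounded) (auto simp: top_unique intro: le_less_trans)
  have le: "(LINT x|m. norm (?D n x)) \<le> inverse (real (Suc n))" for n
  proof -
    have "ennreal (LINT x|m. norm (?D n x)) = (\<integral>\<^sup>+x. ennreal (norm (?D n x)) \<partial>m)"
      using int by (intro nn_integral_eq_integral[symmetric]) auto
    also have "\<dots> \<le> ennreal (inverse (real (Suc n)))" using 1[of n] by simp
    finally show ?thesis by (subst (asm) ennreal_le_iff) auto
  qed
  have "(\<lambda>n. LINT x|m. norm (?D n x)) \<longlonglongrightarrow> 0"
    by (rule tendsto_sandwich[OF _ _ tendsto_const LIMSEQ_inverse_real_of_nat]) (use le in auto)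
  from tendsto_L1_AE_subseq[OF int this] obtain r where r: "strict_mono r"
    and ae: "AE x in m. (\<lambda>n. ?D (r n) x) \<longlonglongrightarrow> 0" by auto
  have "(\<lambda>n. LINT x|m. exp (\<i> * of_real (t * combo (J (r n)) (c (r n)) x))) \<longlonglongrightarrow> (LINT x|m. exp (\<i> * of_real (t * Z x)))"
  proof (rule integral_dominated_convergence[where w="\<lambda>_. 1"])
    show "AE x in m. (\<lambda>n. exp (\<i> * of_real (t * combo (J (r n)) (c (r n)) x))) \<longlonglongrightarrow> exp (\<i> * of_real (t * Z x))"
      using ae
    proof eventually_elim
      case (elim x)
      have "(\<lambda>n. root 4 (?D (r n) x)) \<longlonglongrightarrow> root 4 0" by (intro tendsto_real_root elim)
      then have "(\<lambda>n. \<bar>Z x - combo (J (r n)) (c (r n)) x\<bar>) \<longlonglongrightarrow> 0"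
      proof -
        have "root 4 (?D (r n) x) = \<bar>Z x - combo (J (r n)) (c (r n)) x\<bar>" for n
          using real_root_power_cancel[of 4 "\<bar>Z x - combo (J (r n)) (c (r n)) x\<bar>"]
          by (simp add: power_even_abs)
        then show ?thesis using \<open>(\<lambda>n. root 4 (?D (r n) x)) \<longlonglongrightarrow> root 4 0\<close> by simp
      qed
      then have "(\<lambda>n. Z x - combo (J (r n)) (c (r n)) x) \<longlonglongrightarrow> 0" by (simp add: tendsto_rabs_zero_iff)
      then have "(\<lambda>n. Z x - (Z x - combo (J (r n)) (c (r n)) x)) \<longlonglongrightarrow> Z x - 0" by (intro tendsto_intros)
      then have "(\<lambda>n. combo (J (r n)) (c (r n)) x) \<longlonglongrightarrow> Z x" by simp
      then show ?case by (intro tendsto_intros)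
    qed
    show "(\<lambda>x. exp (\<i> * of_real (t * combo (J (r n)) (c (r n)) x))) \<in> borel_measurable m" for n
      by measurable
  qed auto
  moreover have "(\<lambda>n. LINT x|m. exp (\<i> * of_real (t * combo (J (r n)) (c (r n)) x)))
      \<longlonglongrightarrow> of_real (exp (- (t\<^sup>2 * (L2norm S T w)\<^sup>2) / 2))"
  proof -
    have "(\<lambda>n. L2norm S T (combo_kernel (J n) (c n)) - L2norm S T w) \<longlonglongrightarrow> 0"
    proof (rule Lim_null_comparison[OF _ LIMSEQ_inverse_real_of_nat], intro always_eventually allI)
      fix n
      show "norm (L2norm S T (combo_kernel (J n) (c n)) - L2norm S T w) \<le> inverse (real (Suc n))"
        using L2norm_reverse_triangle[OF combo_kernel_L2[OF J(2)[of n], of "c n"] rep_L2[OF Z]] 2[of n]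
        unfolding L2norm_minus_commute[of S T w] real_norm_def by linarith
    qed
    then have "(\<lambda>n. L2norm S T (combo_kernel (J n) (c n))) \<longlonglongrightarrow> L2norm S T w" by (simp add: LIM_zero_iff)
    then have "(\<lambda>n. L2norm S T (combo_kernel (J (r n)) (c (r n)))) \<longlonglongrightarrow> L2norm S T w"
      using LIMSEQ_subseq_LIMSEQ[OF _ r] by (auto simp: o_def)
    then show ?thesis unfolding combo_char[OF J] by (intro tendsto_intros) auto
  qed
  ultimately show ?thesis by (rule LIMSEQ_unique)
qed

end

section \<open>Almost sure convergence from fourth moment increments\<close>

text \<open>Two uses of \<open>(x + y)^2 \<le> (1 + 9) x^2 + (1 + 1/9) y^2\<close> give the
  constants \<open>10^3\<close> and \<open>(10/9)^3\<close>. The weight 9 is chosen to keep the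
  second constant below 2, since the bisection halves what it multiplies.\<close>

lemma power4_add_le_weighted: "(a + b) ^ 4 \<le> 1000 * a ^ 4 + 1000 / 729 * (b::real) ^ 4"
proof -
  have sq: "(x + y)\<^sup>2 \<le> 10 * x\<^sup>2 + 10 / 9 * y\<^sup>2" for x y :: real
  proof -
    have "0 \<le> (3 * x - y / 3)\<^sup>2" by simp
    then show ?thesis by (simp add: power2_eq_square algebra_simps)
  qed
  have "(a + b) ^ 4 = ((a + b)\<^sup>2)\<^sup>2" by simp
  also have "\<dots> \<le> (10 * a\<^sup>2 + 10 / 9 * b\<^sup>2)\<^sup>2" using sq[of a b] by (intro power_mono) auto
  also have "\<dots> \<le> 10 * (10 * a\<^sup>2)\<^sup>2 + 10 / 9 * (10 / 9 * b\<^sup>2)\<^sup>2" by (rule sq)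
  also have "\<dots> = 1000 * a ^ 4 + 1000 / 729 * b ^ 4" by (simp add: power_mult_distrib power_divide)
  finally show ?thesis .
qed

lemma ennreal_combine:
  assumes "0 \<le> a" "0 \<le> b" "0 \<le> x" "0 \<le> y" "0 \<le> z"
  shows "ennreal a * ennreal x + (ennreal b * ennreal y + ennreal b * ennreal z) =
    ennreal (a * x + (b * y + b * z))"
  using assms by (simp add: ennreal_mult ennreal_plus)

definition max_increment :: "(nat \<Rightarrow> 'a \<Rightarrow> real) \<Rightarrow> nat \<Rightarrow> nat \<Rightarrow> 'a \<Rightarrow> real" where
  "max_increment X i j x = Max ((\<lambda>k. (X k x - X i x) ^ 4) ` {i..j})"

lemma max_increment_ge: "i \<le> k \<Longrightarrow> k \<le> j \<Longrightarrow> (X k x - X i x) ^ 4 \<le> max_increment X i j x"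
  unfolding max_increment_def by (intro Max_ge) auto

lemma max_increment_leI:
  "i \<le> j \<Longrightarrow> (\<And>k. i \<le> k \<Longrightarrow> k \<le> j \<Longrightarrow> (X k x - X i x) ^ 4 \<le> c) \<Longrightarrow> max_increment X i j x \<le> c"
  unfolding max_increment_def by (subst Max_le_iff) auto

lemma max_increment_nonneg: "i \<le> j \<Longrightarrow> 0 \<le> max_increment X i j x"
  using max_increment_ge[of i i j X x] by simp

lemma max_increment_mono: "i \<le> j \<Longrightarrow> j \<le> k \<Longrightarrow> max_increment X i j x \<le> max_increment X i k x"
  by (rule max_increment_leI) (auto intro: max_increment_ge)

lemma max_increment_measurable [measurable]:
  "(\<And>k. X k \<in> borel_measurable M) \<Longrightarrow> max_increment X i j \<in> borel_measurable M"
  unfolding max_increment_def by measurable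

text \<open>Moricz's bisection: the index range is cut where the increment of \<open>\<tau>\<close> passes one half, so
  that the two halves contribute at most \<open>1/4 + 1/4\<close> of the bound, leaving room for the weights in
  the convexity estimate.\<close>

lemma maximal_inequality:
  fixes X :: "nat \<Rightarrow> 'a \<Rightarrow> real" and \<tau> :: "nat \<Rightarrow> real"
  assumes X [measurable]: "\<And>k. X k \<in> borel_measurable M"
    and \<tau>: "\<And>i j. i \<le> j \<Longrightarrow> \<tau> i \<le> \<tau> j" and K: "0 \<le> K"
    and inc: "\<And>i j. i \<le> j \<Longrightarrow> (\<integral>\<^sup>+x. ennreal ((X j x - X i x) ^ 4) \<partial>M) \<le> ennreal (K * (\<tau> j - \<tau> i)\<^sup>2)"
    and ij: "i \<le> j"
  shows "(\<integral>\<^sup>+x. ennreal (max_increment X i j x) \<partial>M) \<le> ennreal (4000 * K * (\<tau> j - \<tau> i)\<^sup>2)"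
  using ij
proof (induction "j - i" arbitrary: i j rule: less_induct)
  case less
  show ?case
  proof (cases "i = j")
    case True
    then show ?thesis by (simp add: max_increment_def)
  next
    case False
    then have lt: "i < j" using less.prems by simp
    define g where "g = \<tau> j - \<tau> i"
    have g0: "0 \<le> g" using \<tau>[OF less.prems] by (simp add: g_def)
    define k where "k = (LEAST k. i < k \<and> g / 2 \<le> \<tau> k - \<tau> i)"
    have jP: "i < j \<and> g / 2 \<le> \<tau> j - \<tau> i" using lt g0 by (simp add: g_def)
    have k: "i < k" "g / 2 \<le> \<tau> k - \<tau> i"
      unfolding k_def using LeastI[of "\<lambda>k. i < k \<and> g / 2 \<le> \<tau> k - \<tau> i", OF jP] by auto
    have kj: "k \<le> j" unfolding k_def by (rule Least_le[of "\<lambda>k. i < k \<and> g / 2 \<le> \<tau> k - \<tau> i", OF jP])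
    \<comment> \<open>The left block ends at \<open>k - 1\<close>, because the single step to
      \<open>k\<close> may carry more than half of the increment of \<open>\<tau>\<close>. The
      difference \<open>X k - X i\<close> is estimated directly by \<open>inc\<close>.\<close>
    have left: "\<tau> (k - 1) - \<tau> i \<le> g / 2"
    proof (cases "k - 1 = i")
      case True
      then show ?thesis using g0 by simp
    next
      case False
      have "\<not> (i < k - 1 \<and> g / 2 \<le> \<tau> (k - 1) - \<tau> i)"
        by (rule not_less_Least[of "k - 1" "\<lambda>k. i < k \<and> g / 2 \<le> \<tau> k - \<tau> i", folded k_def]) (use k(1) in simp)
      then show ?thesis using False k(1) by auto
    qed
    have right: "\<tau> j - \<tau> k \<le> g / 2" using k(2) by (simp add: g_def)
    have half: "(\<tau> (k - 1) - \<tau> i)\<^sup>2 \<le> g\<^sup>2 / 4" "(\<tau> j - \<tau> k)\<^sup>2 \<le> g\<^sup>2 / 4"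
      using power_mono[OF left, of 2] power_mono[OF right, of 2] \<tau>[of i "k - 1"] \<tau>[OF kj] k(1)
      by (auto simp: power_divide)
    have IH1: "(\<integral>\<^sup>+x. ennreal (max_increment X i (k - 1) x) \<partial>M) \<le> ennreal (4000 * K * (g\<^sup>2 / 4))"
      using k(1) kj lt half(1) K
      by (intro order_trans[OF less.hyps[of "k - 1" i]] ennreal_leI mult_left_mono) auto
    have IH2: "(\<integral>\<^sup>+x. ennreal (max_increment X k j x) \<partial>M) \<le> ennreal (4000 * K * (g\<^sup>2 / 4))"
      using k(1) kj lt half(2) K
      by (intro order_trans[OF less.hyps[of j k]] ennreal_leI mult_left_mono) auto
    have IH3: "(\<integral>\<^sup>+x. ennreal ((X k x - X i x) ^ 4) \<partial>M) \<le> ennreal (K * g\<^sup>2)"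
      using inc[of i k] k(1) K \<tau>[of i k] \<tau>[OF kj]
      by (intro order_trans[OF inc[of i k]] ennreal_leI mult_left_mono power_mono) (auto simp: g_def)
    have pt: "max_increment X i j x \<le>
        1000 * (X k x - X i x) ^ 4 + (1000 / 729 * max_increment X i (k - 1) x + 1000 / 729 * max_increment X k j x)" for x
    proof (rule max_increment_leI[OF less.prems])
      fix l assume l: "i \<le> l" "l \<le> j"
      have n: "0 \<le> max_increment X i (k - 1) x" "0 \<le> max_increment X k j x" "0 \<le> (X k x - X i x) ^ 4"
        using k(1) kj by (auto intro!: max_increment_nonneg)
      show "(X l x - X i x) ^ 4 \<le>
        1000 * (X k x - X i x) ^ 4 + (1000 / 729 * max_increment X i (k - 1) x + 1000 / 729 * max_increment X k j x)"
      proof (cases "l < k")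
        case True
        then have "(X l x - X i x) ^ 4 \<le> max_increment X i (k - 1) x" using l by (intro max_increment_ge) auto
        then show ?thesis using n by linarith
      next
        case False
        then have "(X l x - X k x) ^ 4 \<le> max_increment X k j x" using l by (intro max_increment_ge) auto
        moreover have "(X l x - X i x) ^ 4 \<le> 1000 * (X k x - X i x) ^ 4 + 1000 / 729 * (X l x - X k x) ^ 4"
          using power4_add_le_weighted[of "X k x - X i x" "X l x - X k x"] by simp
        ultimately show ?thesis using n by linarith
      qed
    qed
    have "(\<integral>\<^sup>+x. ennreal (max_increment X i j x) \<partial>M) \<le>
        (\<integral>\<^sup>+x. ennreal 1000 * ennreal ((X k x - X i x) ^ 4) + (ennreal (1000 / 729) * ennreal (max_increment X i (k - 1) x)
          + ennreal (1000 / 729) * ennreal (max_increment X k j x)) \<partial>M)"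
    proof (rule nn_integral_mono)
      fix x
      have n: "0 \<le> max_increment X i (k - 1) x" "0 \<le> max_increment X k j x"
        using k(1) kj by (auto intro!: max_increment_nonneg)
      have "ennreal (max_increment X i j x) \<le> ennreal (1000 * (X k x - X i x) ^ 4 +
          (1000 / 729 * max_increment X i (k - 1) x + 1000 / 729 * max_increment X k j x))"
        by (rule ennreal_leI[OF pt])
      also have "\<dots> = ennreal 1000 * ennreal ((X k x - X i x) ^ 4)
          + (ennreal (1000 / 729) * ennreal (max_increment X i (k - 1) x)
          + ennreal (1000 / 729) * ennreal (max_increment X k j x))"
        using n by (intro ennreal_combine[symmetric]) auto
      finally show "ennreal (max_increment X i j x) \<le> ennreal 1000 * ennreal ((X k x - X i x) ^ 4)
          + (ennreal (1000 / 729) * ennreal (max_increment X i (k - 1) x)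
          + ennreal (1000 / 729) * ennreal (max_increment X k j x))"
        .
    qed
    also have "\<dots> = ennreal 1000 * (\<integral>\<^sup>+x. ennreal ((X k x - X i x) ^ 4) \<partial>M) +
        (ennreal (1000 / 729) * (\<integral>\<^sup>+x. ennreal (max_increment X i (k - 1) x) \<partial>M)
          + ennreal (1000 / 729) * (\<integral>\<^sup>+x. ennreal (max_increment X k j x) \<partial>M))"
      by (simp add: nn_integral_add nn_integral_cmult)
    also have "\<dots> \<le> ennreal 1000 * ennreal (K * g\<^sup>2) +
        (ennreal (1000 / 729) * ennreal (4000 * K * (g\<^sup>2 / 4)) + ennreal (1000 / 729) * ennreal (4000 * K * (g\<^sup>2 / 4)))"
      using IH1 IH2 IH3 by (intro add_mono mult_left_mono) auto
    also have "\<dots> = ennreal (1000 * (K * g\<^sup>2) + (1000 / 729 * (4000 * K * (g\<^sup>2 / 4)) + 1000 / 729 * (4000 * K * (g\<^sup>2 / 4))))"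
      using K by (intro ennreal_combine) auto
    \<comment> \<open>The total is \<open>1000 + 2 * (1000/729) * 1000\<close>, about 3744, times
      \<open>K * g^2\<close>. The constant 4000 therefore reproduces itself.\<close>
    also have "\<dots> \<le> ennreal (4000 * K * g\<^sup>2)"
    proof (rule ennreal_leI)
      have "0 \<le> K * g\<^sup>2" using K by simp
      then show "1000 * (K * g\<^sup>2) + (1000 / 729 * (4000 * K * (g\<^sup>2 / 4)) + 1000 / 729 * (4000 * K * (g\<^sup>2 / 4)))
          \<le> 4000 * K * g\<^sup>2" by simp
    qed
    finally show ?thesis by (simp add: g_def)
  qed
qed

text \<open>The maximal inequality bounds the supremum of all increments after index
  \<open>N\<close> by the squared tail of \<open>\<tau>\<close>. These tails tend to 0, so the
  infimum of the suprema over \<open>N\<close> vanishes almost surely, which is the Cauchy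
  property.\<close>

lemma AE_convergent_fourth_moment:
  fixes X :: "nat \<Rightarrow> 'a \<Rightarrow> real" and \<tau> :: "nat \<Rightarrow> real"
  assumes X [measurable]: "\<And>k. X k \<in> borel_measurable M"
    and \<tau>: "\<And>i j. i \<le> j \<Longrightarrow> \<tau> i \<le> \<tau> j" and conv: "convergent \<tau>" and K: "0 \<le> K"
    and inc: "\<And>i j. i \<le> j \<Longrightarrow> (\<integral>\<^sup>+x. ennreal ((X j x - X i x) ^ 4) \<partial>M) \<le> ennreal (K * (\<tau> j - \<tau> i)\<^sup>2)"
  shows "AE x in M. convergent (\<lambda>n. X n x)"
proof -
  obtain L where L: "\<tau> \<longlonglongrightarrow> L" using conv by (auto simp: convergent_def)
  have \<tau>L: "\<tau> i \<le> L" for i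
    using \<tau> by (intro incseq_le[OF _ L]) (auto simp: incseq_def)
  define G where "G N x = (SUP j. ennreal (max_increment X N (N + j) x))" for N x
  have [measurable]: "G N \<in> borel_measurable M" for N unfolding G_def by measurable
  have G: "(\<integral>\<^sup>+x. G N x \<partial>M) \<le> ennreal (4000 * K * (L - \<tau> N)\<^sup>2)" for N
  proof -
    have "(\<integral>\<^sup>+x. G N x \<partial>M) = (SUP j. \<integral>\<^sup>+x. ennreal (max_increment X N (N + j) x) \<partial>M)"
      unfolding G_def
    proof (rule nn_integral_monotone_convergence_SUP)
      show "incseq (\<lambda>j x. ennreal (max_increment X N (N + j) x))"
        by (auto simp: incseq_def le_fun_def intro!: ennreal_leI max_increment_mono)
    qed measurable
    also have "\<dots> \<le> ennreal (4000 * K * (L - \<tau> N)\<^sup>2)"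
    proof (rule SUP_least)
      fix j
      have "(\<integral>\<^sup>+x. ennreal (max_increment X N (N + j) x) \<partial>M) \<le> ennreal (4000 * K * (\<tau> (N + j) - \<tau> N)\<^sup>2)"
        by (rule maximal_inequality[OF X \<tau> K inc]) auto
      also have "\<dots> \<le> ennreal (4000 * K * (L - \<tau> N)\<^sup>2)"
        using \<tau>L[of "N + j"] \<tau>[of N "N + j"] K by (intro ennreal_leI mult_left_mono power_mono) auto
      finally show "(\<integral>\<^sup>+x. ennreal (max_increment X N (N + j) x) \<partial>M) \<le> ennreal (4000 * K * (L - \<tau> N)\<^sup>2)" .
    qed
    finally show ?thesis .
  qed
  have "(\<lambda>N. ennreal (4000 * K * (L - \<tau> N)\<^sup>2)) \<longlonglongrightarrow> ennreal (4000 * K * (L - L)\<^sup>2)"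
    by (intro tendsto_ennrealI tendsto_intros L)
  moreover have "(\<integral>\<^sup>+x. (INF N. G N x) \<partial>M) \<le> ennreal (4000 * K * (L - \<tau> N)\<^sup>2)" for N
    by (rule order_trans[OF nn_integral_mono G]) (rule INF_lower, simp)
  ultimately have "(\<integral>\<^sup>+x. (INF N. G N x) \<partial>M) \<le> ennreal (4000 * K * (L - L)\<^sup>2)"
    by (intro LIMSEQ_le_const[of _ _ "\<integral>\<^sup>+x. (INF N. G N x) \<partial>M"]) auto
  then have "(\<integral>\<^sup>+x. (INF N. G N x) \<partial>M) = 0" by simp
  then have "AE x in M. (INF N. G N x) = 0" by (subst (asm) nn_integral_0_iff_AE) auto
  then show ?thesis
  proof eventually_elim
    case (elim x)
    have "Cauchy (\<lambda>n. X n x)"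
      unfolding Cauchy_altdef
    proof (intro allI impI)
      fix e :: real assume e: "0 < e"
      have "(INF N. G N x) < ennreal ((e / 2) ^ 4)" using elim e by simp
      then obtain N where N: "G N x < ennreal ((e / 2) ^ 4)" by (auto simp: INF_less_iff)
      have near: "\<bar>X n x - X N x\<bar> < e / 2" if "n \<ge> N" for n
      proof -
        have "ennreal ((X n x - X N x) ^ 4) \<le> ennreal (max_increment X N (N + (n - N)) x)"
          using that by (intro ennreal_leI max_increment_ge) auto
        also have "\<dots> \<le> G N x" unfolding G_def by (rule SUP_upper) simp
        also note N
        finally have "(X n x - X N x) ^ 4 < (e / 2) ^ 4" by (simp add: ennreal_less_iff)
        then have "\<bar>X n x - X N x\<bar> ^ 4 < (e / 2) ^ 4" by (simp add: power_even_abs)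
        then show ?thesis by (rule power_less_imp_less_base) (use e in simp)
      qed
      show "\<exists>M. \<forall>m\<ge>M. \<forall>n>m. dist (X m x) (X n x) < e"
      proof (intro exI[of _ N] allI impI)
        fix a b assume "N \<le> a" "a < b"
        then show "dist (X a x) (X b x) < e"
          unfolding dist_real_def using near[of a] near[of b] by linarith
      qed
    qed
    then show ?case by (simp add: Cauchy_convergent_iff)
  qed
qed

section \<open>The Paley--Wiener--Zygmund integral along Gaussian paths\<close>

lemma C0_scale: "x \<in> C0 S T \<Longrightarrow> (\<lambda>p. c * x p) \<in> C0 S T"
  by (auto simp: C0_def intro!: continuous_intros)

lemma C0_add: "x \<in> C0 S T \<Longrightarrow> y \<in> C0 S T \<Longrightarrow> (\<lambda>p. x p + y p) \<in> C0 S T"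
  by (auto simp: C0_def intro!: continuous_intros)

section \<open>Linearity and measurability of the PWZ integral\<close>

context
  fixes S T :: real
  assumes ST: "0 \<le> S" "0 \<le> T"
begin

lemma has_rs_integral_rs_integral:
  assumes "bv_hk S T g" "x \<in> C0 S T"
  shows "has_rs_integral S T g x (rs_integral S T g x)"
  using has_rs_integral_exists[OF ST assms] rs_integral_eq[OF ST] by metis

lemma rs_integral_linear:
  assumes "bv_hk S T g" "x \<in> C0 S T" "y \<in> C0 S T"
  shows "rs_integral S T g (\<lambda>p. a * x p + b * y p) = a * rs_integral S T g x + b * rs_integral S T g y"
  by (intro rs_integral_eq ST has_rs_integral_linear_right has_rs_integral_rs_integral assms)

lemma rs_integral_sum:
  assumes g: "\<And>j. j \<in> A \<Longrightarrow> bv_hk S T (g j)" and x: "x \<in> C0 S T"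
  shows "rs_integral S T (\<lambda>p. \<Sum>j\<in>A. c j * g j p) x = (\<Sum>j\<in>A. c j * rs_integral S T (g j) x)"
proof (rule rs_integral_eq[OF ST])
  have zero: "has_rs_integral S T (\<lambda>p. 0) x 0"
    by (auto simp: has_rs_integral_def intro!: exI[of _ 1])
  show "has_rs_integral S T (\<lambda>p. \<Sum>j\<in>A. c j * g j p) x (\<Sum>j\<in>A. c j * rs_integral S T (g j) x)"
    using g
  proof (induction A rule: infinite_finite_induct)
    case (insert j A)
    have "has_rs_integral S T (g j) x (rs_integral S T (g j) x)"
      using insert.prems x by (intro has_rs_integral_rs_integral) auto
    from has_rs_integral_linear_left[OF this insert.IH, of "c j" 1] insert show ?case by simp
  qed (use zero in auto)
qed

context
  fixes \<phi> :: "nat \<Rightarrow> pt \<Rightarrow> real"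
  assumes onb: "complete_orthonormal_bv S T \<phi>"
begin

lemma pwz_seq_eq:
  "x \<in> C0 S T \<Longrightarrow> pwz_seq S T \<phi> v x n = (\<Sum>j<n. L2inner S T v (\<phi> j) * rs_integral S T (\<phi> j) x)"
  unfolding pwz_seq_def by (rule rs_integral_sum) (auto intro: onb_bv[OF onb])

lemma pwz_seq_linear:
  assumes "x \<in> C0 S T" "y \<in> C0 S T"
  shows "pwz_seq S T \<phi> v (\<lambda>p. a * x p + b * y p) n = a * pwz_seq S T \<phi> v x n + b * pwz_seq S T \<phi> v y n"
proof -
  have "(\<lambda>p. a * x p + b * y p) \<in> C0 S T" using assms by (intro C0_add C0_scale)
  then show ?thesis
    using assms onb_bv[OF onb]
    by (simp add: pwz_seq_eq rs_integral_linear sum_distrib_left sum.distrib[symmetric] algebra_simps)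
qed

text \<open>Linearity in the path holds already for the partial sums. It is what splits the
  exponential when \<open>F\<close> is evaluated at a sum of two paths and extracts the factor
  \<open>1 / sqrt \<lambda>\<close>.\<close>

lemma pwz_linear:
  assumes "x \<in> C0 S T" "y \<in> C0 S T" "pwz_exists S T \<phi> v x" "pwz_exists S T \<phi> v y"
  shows "pwz_exists S T \<phi> v (\<lambda>p. a * x p + b * y p)"
    and "pwz S T \<phi> v (\<lambda>p. a * x p + b * y p) = a * pwz S T \<phi> v x + b * pwz S T \<phi> v y"
proof -
  have "pwz_seq S T \<phi> v (\<lambda>p. a * x p + b * y p) \<longlonglongrightarrow> a * pwz S T \<phi> v x + b * pwz S T \<phi> v y"
    using assms(3,4) unfolding pwz_seq_linear[OF assms(1,2)] pwz_exists_def pwz_def convergent_LIMSEQ_iff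
    by (intro tendsto_intros)
  then show "pwz_exists S T \<phi> v (\<lambda>p. a * x p + b * y p)"
    "pwz S T \<phi> v (\<lambda>p. a * x p + b * y p) = a * pwz S T \<phi> v x + b * pwz S T \<phi> v y"
    by (auto simp: pwz_exists_def pwz_def convergent_def intro: limI)
qed

lemma measurable_pwz_seq_rep:
  assumes x: "x \<in> C0 S T"
  shows "(\<lambda>u. pwz_seq S T \<phi> (L2rep u) x n) \<in> borel_measurable (L2borel S T)"
  unfolding pwz_seq_eq[OF x] by (intro borel_measurable_sum borel_measurable_times measurable_L2inner_rep onb_L2 onb) simp

lemma measurable_pwz_rep:
  "x \<in> C0 S T \<Longrightarrow> (\<lambda>u. pwz S T \<phi> (L2rep u) x) \<in> borel_measurable (L2borel S T)"
  unfolding pwz_def by (intro borel_measurable_lim_metric measurable_pwz_seq_rep)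

end

end

text \<open>The \<open>L^1\<close> estimate becomes an \<open>L^2\<close> estimate because the step
  function and \<open>g\<close> share the bound \<open>B\<close>, whence
  \<open>\<bar>W - g\<bar>^2 \<le> 2 B \<bar>W - g\<bar>\<close>.\<close>

lemma bv_unif_step_L2:
  assumes ST: "0 \<le> S" "0 \<le> T" and bv: "bv_hk S T g"
  shows "(\<lambda>N. L2norm S T (\<lambda>p. (\<Sum>i<Suc N. \<Sum>j<Suc N. g (unif S N (Suc i), unif T N (Suc j)) *
    indicator (cell (unif S N) (unif T N) i j) p) - g p)) \<longlonglongrightarrow> 0"
proof -
  obtain K where K: "0 \<le> K" "\<And>d m s \<sigma> n t \<tau>. tagged S d m s \<sigma> \<Longrightarrow> tagged T d n t \<tau> \<Longrightarrow> 0 < d \<Longrightarrow>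
    \<exists>D. integrable (leb_Q S T) D \<and> (LINT p|leb_Q S T. D p) \<le> K * d \<and> (\<forall>p. 0 \<le> D p) \<and>
      (AE p in leb_Q S T. \<bar>(\<Sum>i<m. \<Sum>j<n. g (\<sigma> i, \<tau> j) * indicator (cell s t i j) p) - g p\<bar> \<le> D p)"
    by (rule bv_step_approx[OF ST bv]) blast
  obtain B where B: "0 \<le> B" "\<And>p. p \<in> Qrect S T \<Longrightarrow> \<bar>g p\<bar> \<le> B" by (rule bv_bounded[OF ST bv]) blast
  define W where "W N p = (\<Sum>i<Suc N. \<Sum>j<Suc N. g (unif S N (Suc i), unif T N (Suc j)) *
    indicator (cell (unif S N) (unif T N) i j) p)" for N p
  define e where "e N = (S + T + 1) / real (Suc N)" for N
  have e0: "0 < e N" for N using ST by (simp add: e_def)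
  note pS = is_partition_unif[OF ST(1)] and pT = is_partition_unif[OF ST(2)]
  have WB: "\<bar>W N p - g p\<bar> \<le> 2 * B" if p: "p \<in> {0<..S} \<times> {0<..T}" for N p
  proof -
    obtain k l where kl: "k < Suc N" "l < Suc N" and
      *: "\<And>f. (\<Sum>i<Suc N. \<Sum>j<Suc N. f i j * indicator (cell (unif S N) (unif T N) i j) p) = (f k l :: real)"
      by (rule step_function_value[OF pS pT p]) blast
    have "(unif S N (Suc k), unif T N (Suc l)) \<in> Qrect S T"
      using is_partition_nonneg[OF pS, of "Suc k" N] is_partition_le[OF pS, of "Suc k" N]
        is_partition_nonneg[OF pT, of "Suc l" N] is_partition_le[OF pT, of "Suc l" N] kl by (auto simp: Qrect_def)
    moreover have "p \<in> Qrect S T" using p by (auto simp: Qrect_def)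
    moreover have "W N p = g (unif S N (Suc k), unif T N (Suc l))" unfolding W_def by (rule *)
    ultimately show ?thesis using B(2)[of p] B(2)[of "(unif S N (Suc k), unif T N (Suc l))"] by linarith
  qed
  have gm: "g \<in> borel_measurable (leb_Q S T)" by (rule bv_measurable[OF ST bv])
  have Wm: "W N \<in> borel_measurable (leb_Q S T)" for N
    unfolding W_def using integral_step(1)[OF pS pT] by auto
  have sq: "(L2norm S T (\<lambda>p. W N p - g p))\<^sup>2 \<le> 2 * B * (K * e N)" for N
  proof -
    have "tagged S (e N) (Suc N) (unif S N) (\<lambda>i. unif S N (Suc i))"
      "tagged T (e N) (Suc N) (unif T N) (\<lambda>i. unif T N (Suc i))"
      using ST by (auto simp: e_def intro!: tagged_unif divide_strict_right_mono)
    from K(2)[OF this e0] obtain D where D: "integrable (leb_Q S T) D" "(LINT p|leb_Q S T. D p) \<le> K * e N"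
      "\<And>p. 0 \<le> D p" "AE p in leb_Q S T. \<bar>W N p - g p\<bar> \<le> D p"
      unfolding W_def by blast
    have "(\<integral>\<^sup>+p. ennreal ((W N p - g p)\<^sup>2) \<partial>leb_Q S T) \<le> (\<integral>\<^sup>+p. ennreal (2 * B * D p) \<partial>leb_Q S T)"
    proof (rule nn_integral_mono_AE, use D(4) AE_leb_Q_interior[of S T] in eventually_elim)
      case (elim p)
      have "(W N p - g p)\<^sup>2 = \<bar>W N p - g p\<bar> * \<bar>W N p - g p\<bar>" by (simp add: power2_eq_square)
      also have "\<dots> \<le> 2 * B * D p" using elim WB[OF elim(2), of N] B(1) by (intro mult_mono) auto
      finally show ?case by (rule ennreal_leI)
    qed
    also have "\<dots> = ennreal (LINT p|leb_Q S T. 2 * B * D p)"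
      using D B(1) by (intro nn_integral_eq_integral) auto
    also have "\<dots> \<le> ennreal (2 * B * (K * e N))"
      using D(2) B(1) by (intro ennreal_leI) (simp add: mult_left_mono)
    finally have le: "(\<integral>\<^sup>+p. ennreal ((W N p - g p)\<^sup>2) \<partial>leb_Q S T) \<le> ennreal (2 * B * (K * e N))" .
    then have "(\<lambda>p. W N p - g p) \<in> L2fun S T"
      using gm Wm by (intro L2fun_nn_integralI) (auto intro: le_less_trans)
    from nn_integral_square_L2[OF this] le show ?thesis
      using B(1) K(1) e0[of N] by (simp add: ennreal_le_iff less_imp_le)
  qed
  have lim0: "(\<lambda>N. 2 * B * (K * e N)) \<longlonglongrightarrow> 2 * B * (K * 0)"
    unfolding e_def using LIMSEQ_Suc[OF lim_const_over_n[of "S + T + 1"]] by (intro tendsto_intros) simp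
  have "(\<lambda>N. (L2norm S T (\<lambda>p. W N p - g p))\<^sup>2) \<longlonglongrightarrow> 0"
    by (rule tendsto_sandwich[OF _ _ tendsto_const]) (use sq lim0 in auto)
  then have "(\<lambda>N. sqrt ((L2norm S T (\<lambda>p. W N p - g p))\<^sup>2)) \<longlonglongrightarrow> sqrt 0" by (rule tendsto_real_sqrt)
  then show ?thesis by (simp add: W_def)
qed

section \<open>Wiener processes with a weight, and integrals along them\<close>

context yeh_wiener_space
begin

text \<open>Both \<open>Y h\<close> and the coordinate process (\<open>h = 1\<close>) are of this kind, and the PWZ integral along the
  latter is what defines the former.\<close>

definition wiener_process :: "((pt \<Rightarrow> real) \<Rightarrow> pt \<Rightarrow> real) \<Rightarrow> (pt \<Rightarrow> real) \<Rightarrow> bool" where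
  "wiener_process Z h \<longleftrightarrow> h \<in> borel_measurable (leb_Q S T) \<and> (\<exists>B\<ge>0. \<forall>p\<in>Qrect S T. \<bar>h p\<bar> \<le> B) \<and>
    (\<forall>x\<in>C0 S T. Z x \<in> C0 S T) \<and>
    (\<forall>p\<in>Qrect S T. rep (\<lambda>x. Z x p) (\<lambda>q. indicator (origin_box p) q * h q))"

lemma wiener_process_C0: "wiener_process Z h \<Longrightarrow> x \<in> C0 S T \<Longrightarrow> Z x \<in> C0 S T"
  by (simp add: wiener_process_def)

text \<open>On uniform partitions the sums are combinations of rectangle increments of the path,
  with kernel a step function times \<open>h\<close>. For every path they converge to the integral,
  while the step functions converge to \<open>g\<close> in \<open>L^2\<close>.\<close>

lemma rep_rs_integral:
  assumes Z: "wiener_process Z h" and bv: "bv_hk S T g"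
  shows "rep (\<lambda>x. rs_integral S T g (Z x)) (\<lambda>q. g q * h q)"
proof -
  obtain B where B: "B \<ge> 0" "\<And>p. p \<in> Qrect S T \<Longrightarrow> \<bar>h p\<bar> \<le> B" and hm: "h \<in> borel_measurable (leb_Q S T)"
    and ZC: "\<And>x. x \<in> C0 S T \<Longrightarrow> Z x \<in> C0 S T"
    and Zr: "\<And>p. p \<in> Qrect S T \<Longrightarrow> rep (\<lambda>x. Z x p) (\<lambda>q. indicator (origin_box p) q * h q)"
    using Z unfolding wiener_process_def by blast
  obtain C where C: "\<And>p. p \<in> Qrect S T \<Longrightarrow> \<bar>g p\<bar> \<le> C" by (rule bv_bounded[OF ST bv]) blast
  have gL: "g \<in> L2fun S T" by (rule L2fun_bounded[OF bv_measurable[OF ST bv] C])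
  have incr: "rep (\<lambda>x. rect_incr (Z x) a b c d) (\<lambda>q. indicator ({a<..b} \<times> {c<..d}) q * h q)"
    if "0 \<le> a" "a \<le> b" "b \<le> S" "0 \<le> c" "c \<le> d" "d \<le> T" for a b c d
  proof -
    have Q: "(b, d) \<in> Qrect S T" "(a, d) \<in> Qrect S T" "(b, c) \<in> Qrect S T" "(a, c) \<in> Qrect S T"
      using that by (auto simp: Qrect_def)
    have "rep (\<lambda>x. 1 * (Z x (b, d) - Z x (a, d)) + 1 * (Z x (a, c) - Z x (b, c)))
      (\<lambda>q. 1 * (indicator (origin_box (b, d)) q * h q - indicator (origin_box (a, d)) q * h q)
        + 1 * (indicator (origin_box (a, c)) q * h q - indicator (origin_box (b, c)) q * h q))"
      using Q by (intro rep_linear rep_diff Zr)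
    also have "(\<lambda>q. 1 * (indicator (origin_box (b, d)) q * h q - indicator (origin_box (a, d)) q * h q)
        + 1 * (indicator (origin_box (a, c)) q * h q - indicator (origin_box (b, c)) q * h q)) =
        (\<lambda>q. indicator ({a<..b} \<times> {c<..d}) q * h q)"
    proof
      fix q :: pt
      \<comment> \<open>Inclusion and exclusion of the four closed boxes at the corners gives
        exactly the half-open rectangle.\<close>
      have "indicator (origin_box (b, d)) q - indicator (origin_box (a, d)) q
        + (indicator (origin_box (a, c)) q - indicator (origin_box (b, c)) q) =
          (indicator ({a<..b} \<times> {c<..d}) q :: real)"
        using that by (cases q) (auto simp: indicator_def origin_box_def)
      then show "1 * (indicator (origin_box (b, d)) q * h q - indicator (origin_box (a, d)) q * h q)
        + 1 * (indicator (origin_box (a, c)) q * h q - indicator (origin_box (b, c)) q * h q) =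
        indicator ({a<..b} \<times> {c<..d}) q * h q"
        by (simp only: mult_1 left_diff_distrib[symmetric] distrib_right[symmetric])
    qed
    finally show ?thesis by (simp add: rect_incr_def algebra_simps)
  qed
  let ?W = "\<lambda>N p. \<Sum>i<Suc N. \<Sum>j<Suc N. g (unif S N (Suc i), unif T N (Suc j)) *
    indicator (cell (unif S N) (unif T N) i j) p"
  let ?R = "\<lambda>N y. rs_sum g y (Suc N) (unif S N) (\<lambda>i. unif S N (Suc i)) (Suc N) (unif T N) (\<lambda>i. unif T N (Suc i))"
  note pS = is_partition_unif[OF ST(1)] and pT = is_partition_unif[OF ST(2)]
  have ri: "rep (\<lambda>x. rect_incr (Z x) (unif S N i) (unif S N (Suc i)) (unif T N j) (unif T N (Suc j)))
      (\<lambda>q. indicator (cell (unif S N) (unif T N) i j) q * h q)" if "i < Suc N" "j < Suc N" for N i j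
    unfolding cell_def
    using that is_partition_nonneg[OF pS, of i N] is_partition_nonneg[OF pT, of j N]
      is_partition_le[OF pS, of "Suc i" N] is_partition_le[OF pT, of "Suc j" N]
      is_partition_mono[OF pS, of i "Suc i" N] is_partition_mono[OF pT, of j "Suc j" N]
    by (intro incr) auto
  have R: "rep (\<lambda>x. ?R N (Z x)) (\<lambda>q. ?W N q * h q)" for N
  proof -
    have "rep (\<lambda>x. \<Sum>i<Suc N. 1 * (\<Sum>j<Suc N. g (unif S N (Suc i), unif T N (Suc j)) *
        rect_incr (Z x) (unif S N i) (unif S N (Suc i)) (unif T N j) (unif T N (Suc j))))
      (\<lambda>q. \<Sum>i<Suc N. 1 * (\<Sum>j<Suc N. g (unif S N (Suc i), unif T N (Suc j)) *
        (indicator (cell (unif S N) (unif T N) i j) q * h q)))"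
      by (intro rep_sum ri) auto
    then show ?thesis by (simp only: rs_sum_def sum_distrib_right mult_1 mult.assoc)
  qed
  have lim: "(\<lambda>N. ?R N (Z x)) \<longlonglongrightarrow> rs_integral S T g (Z x)" if "x \<in> C0 S T" for x
    by (intro has_rs_integral_unif ST has_rs_integral_rs_integral bv ZC that)
  show ?thesis
  proof (rule rep_AE_limit[OF R])
    show "(\<lambda>q. g q * h q) \<in> L2fun S T" by (rule L2fun_bounded_mult[OF gL hm B(2)])
    show "(\<lambda>x. rs_integral S T g (Z x)) \<in> borel_measurable m"
      by (rule borel_measurable_LIMSEQ_real[OF _ rep_measurable[OF R]]) (use lim space_m in auto)
    show "AE x in m. (\<lambda>N. ?R N (Z x)) \<longlonglongrightarrow> rs_integral S T g (Z x)"
      using lim by (intro AE_I2) (simp add: space_m)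
    have Wg: "(\<lambda>p. ?W N p - g p) \<in> L2fun S T" for N
    proof (rule L2fun_diff[OF _ gL], intro L2fun_sum L2fun_scale)
      fix i j assume "i \<in> {..<Suc N}" "j \<in> {..<Suc N}"
      then show "indicator (cell (unif S N) (unif T N) i j) \<in> L2fun S T"
        using cell_leb_Q(1)[OF pS pT] by (intro L2fun_bounded[of _ _ _ 1]) (auto simp: indicator_def)
    qed
    show "(\<lambda>N. L2norm S T (\<lambda>q. ?W N q * h q - g q * h q)) \<longlonglongrightarrow> 0"
    proof (rule Lim_null_comparison)
      show "(\<lambda>N. B * L2norm S T (\<lambda>p. ?W N p - g p)) \<longlonglongrightarrow> 0"
        by (intro tendsto_mult_right_zero bv_unif_step_L2 ST bv)
      show "\<forall>\<^sub>F N in sequentially. norm (L2norm S T (\<lambda>q. ?W N q * h q - g q * h q)) \<le> B * L2norm S T (\<lambda>p. ?W N p - g p)"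
        unfolding left_diff_distrib[symmetric] real_norm_def abs_of_nonneg[OF L2norm_nonneg]
        by (intro always_eventually allI L2norm_bounded_mult Wg hm B)
    qed
  qed
qed

lemma wiener_process_id: "wiener_process (\<lambda>x. x) (\<lambda>_. 1)"
  unfolding wiener_process_def using rep_eval by (auto intro!: exI[of _ 1])

lemma Supp_BV_bounded_measurable:
  assumes "h \<in> Supp_BV S T"
  shows "h \<in> borel_measurable (leb_Q S T)" "\<exists>B\<ge>0. \<forall>p\<in>Qrect S T. \<bar>h p\<bar> \<le> B"
proof -
  have bv: "bv_hk S T h" using assms by (simp add: Supp_BV_def)
  show "h \<in> borel_measurable (leb_Q S T)" by (rule bv_measurable[OF ST bv])
  show "\<exists>B\<ge>0. \<forall>p\<in>Qrect S T. \<bar>h p\<bar> \<le> B" by (rule bv_bounded[OF ST bv]) blast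
qed

lemma s_AE_imp_AE:
  assumes "s_AE m P"
  shows "AE x in m. P x"
proof -
  obtain N where N: "scale_null m N" "{x \<in> space m. \<not> P x} \<subseteq> N" using assms by (auto simp: s_AE_def)
  have "scale_set 1 N = N" by (auto simp: scale_set_def)
  then have "N \<in> null_sets m" using N(1) unfolding scale_null_def by (metis null_setsI zero_less_one)
  then show ?thesis using N(2) by (rule AE_I')
qed

context
  fixes \<phi> :: "nat \<Rightarrow> pt \<Rightarrow> real"
  assumes onb: "complete_orthonormal_bv S T \<phi>"
begin

text \<open>The partial sums have kernels \<open>?P n * h\<close>. Multiplication by the bounded
  \<open>h\<close> keeps the convergence of the Fourier expansion, and the squared coefficients of
  \<open>v\<close> supply the summable sequence that the fourth moment criterion requires.\<close>

lemma pwz_wiener_process: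
  assumes Z: "wiener_process Z h" and v: "v \<in> L2fun S T"
  shows "AE x in m. pwz_exists S T \<phi> v (Z x)"
    and "rep (\<lambda>x. pwz S T \<phi> v (Z x)) (\<lambda>q. v q * h q)"
proof -
  obtain B where B: "B \<ge> 0" "\<And>p. p \<in> Qrect S T \<Longrightarrow> \<bar>h p\<bar> \<le> B" and hm: "h \<in> borel_measurable (leb_Q S T)"
    using Z unfolding wiener_process_def by blast
  let ?c = "\<lambda>j. L2inner S T v (\<phi> j)"
  define X where "X n x = (\<Sum>j<n. ?c j * rs_integral S T (\<phi> j) (Z x))" for n x
  let ?P = "\<lambda>n q. \<Sum>j<n. ?c j * \<phi> j q"
  have P: "?P n \<in> L2fun S T" for n by (intro L2fun_sum L2fun_scale onb_L2[OF onb])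
  have Xseq: "pwz_seq S T \<phi> v (Z x) = (\<lambda>n. X n x)" if "x \<in> C0 S T" for x
    using pwz_seq_eq[OF ST onb wiener_process_C0[OF Z that]] by (simp add: X_def fun_eq_iff)
  have X: "rep (X n) (\<lambda>q. ?P n q * h q)" for n
  proof -
    have "rep (\<lambda>x. \<Sum>j<n. ?c j * rs_integral S T (\<phi> j) (Z x)) (\<lambda>q. \<Sum>j<n. ?c j * (\<phi> j q * h q))"
      by (intro rep_sum rep_rs_integral[OF Z] onb_bv[OF onb])
    then show ?thesis by (simp add: X_def[abs_def] sum_distrib_right mult.assoc)
  qed
  \<comment> \<open>The factor 24 is that of \<open>rep_moment\<close>; \<open>B ^ 4\<close> comes
    from the bound on \<open>h\<close>. Parseval, used before multiplying by \<open>h\<close>, makes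
    the squared norm an increment of the partial sums of the squared coefficients.\<close>
  have incr: "(\<integral>\<^sup>+x. ennreal ((X j x - X i x) ^ 4) \<partial>m) \<le>
      ennreal (24 * B ^ 4 * ((\<Sum>l<j. (?c l)\<^sup>2) - (\<Sum>l<i. (?c l)\<^sup>2))\<^sup>2)" if "i \<le> j" for i j
  proof -
    let ?d = "\<lambda>q. \<Sum>l\<in>{i..<j}. ?c l * \<phi> l q"
    have d: "?d \<in> L2fun S T" by (intro L2fun_sum L2fun_scale onb_L2[OF onb])
    have eq: "?P j q * h q - ?P i q * h q = ?d q * h q" for q
      using that by (simp add: left_diff_distrib[symmetric] lessThan_atLeast0 sum_diff_nat_ivl)
    have "(L2norm S T (\<lambda>q. ?d q * h q)) \<le> B * L2norm S T ?d"
      by (rule L2norm_bounded_mult[OF d hm B(2,1)])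
    then have "(L2norm S T (\<lambda>q. ?d q * h q)) ^ 4 \<le> (B * L2norm S T ?d) ^ 4" by (intro power_mono) auto
    also have "\<dots> = B ^ 4 * ((L2norm S T ?d)\<^sup>2)\<^sup>2" by (simp add: power_mult_distrib)
    also have "(L2norm S T ?d)\<^sup>2 = (\<Sum>l<j. (?c l)\<^sup>2) - (\<Sum>l<i. (?c l)\<^sup>2)"
      using that by (simp add: L2norm_onb_sum[OF onb] lessThan_atLeast0 sum_diff_nat_ivl)
    finally have "24 * (L2norm S T (\<lambda>q. ?d q * h q)) ^ 4 \<le> 24 * B ^ 4 * ((\<Sum>l<j. (?c l)\<^sup>2) - (\<Sum>l<i. (?c l)\<^sup>2))\<^sup>2"
      by simp
    then show ?thesis
      using rep_moment[OF rep_diff[OF X X], of j i] unfolding eq by (meson ennreal_leI order_trans)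
  qed
  have "AE x in m. convergent (\<lambda>n. X n x)"
  proof (rule AE_convergent_fourth_moment[where K="24 * B ^ 4"])
    show "convergent (\<lambda>n. \<Sum>l<n. (?c l)\<^sup>2)"
      using summable_fourier_coeffs[OF onb v] by (simp add: summable_iff_convergent)
    show "(\<Sum>l<i. (?c l)\<^sup>2) \<le> (\<Sum>l<j. (?c l)\<^sup>2)" if "i \<le> j" for i j
      using that by (intro sum_mono2) auto
  qed (use incr rep_measurable[OF X] in auto)
  then show ex: "AE x in m. pwz_exists S T \<phi> v (Z x)"
    using AE_space by eventually_elim (simp add: pwz_exists_def Xseq space_m)
  have ae: "AE x in m. pwz S T \<phi> v (Z x) = lim (\<lambda>n. X n x)"
    using AE_space by eventually_elim (simp add: pwz_def Xseq space_m)
  have "rep (\<lambda>x. lim (\<lambda>n. X n x)) (\<lambda>q. v q * h q)"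
  proof (rule rep_AE_limit[OF X])
    show "(\<lambda>q. v q * h q) \<in> L2fun S T" by (rule L2fun_bounded_mult[OF v hm B(2)])
    show "(\<lambda>x. lim (\<lambda>n. X n x)) \<in> borel_measurable m"
      by (intro borel_measurable_lim_metric rep_measurable[OF X])
    show "AE x in m. (\<lambda>n. X n x) \<longlonglongrightarrow> lim (\<lambda>n. X n x)"
      using \<open>AE x in m. convergent (\<lambda>n. X n x)\<close> by eventually_elim (simp add: convergent_LIMSEQ_iff)
    show "(\<lambda>n. L2norm S T (\<lambda>q. ?P n q * h q - v q * h q)) \<longlonglongrightarrow> 0"
    proof (rule Lim_null_comparison)
      show "(\<lambda>n. B * L2norm S T (\<lambda>p. ?P n p - v p)) \<longlonglongrightarrow> 0"
        by (intro tendsto_mult_right_zero fourier_converges[OF onb v])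
      show "\<forall>\<^sub>F n in sequentially. norm (L2norm S T (\<lambda>q. ?P n q * h q - v q * h q)) \<le> B * L2norm S T (\<lambda>p. ?P n p - v p)"
        unfolding left_diff_distrib[symmetric] real_norm_def abs_of_nonneg[OF L2norm_nonneg]
        by (intro always_eventually allI L2norm_bounded_mult L2fun_diff P v hm B)
    qed
  qed
  then show "rep (\<lambda>x. pwz S T \<phi> v (Z x)) (\<lambda>q. v q * h q)"
    by (rule rep_cong_AE) (use ae in \<open>auto elim: eventually_mono\<close>)
qed

text \<open>The preceding lemma is used twice in the development: here along the coordinate process,
  with integrand \<open>h\<close> cut off to \<open>[0,p]\<close>, to find the kernel of
  \<open>Y h x p\<close>; and afterwards along \<open>Y h\<close> itself.\<close>

lemma wiener_process_gaussian_paths: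
  assumes Y: "gaussian_paths S T \<phi> m Y" and h: "h \<in> Supp_BV S T"
  shows "wiener_process (Y h) h"
  unfolding wiener_process_def
proof (intro conjI Supp_BV_bounded_measurable[OF h] ballI)
  show "Y h x \<in> C0 S T" if "x \<in> C0 S T" for x
    using Y h that unfolding gaussian_paths_def by blast
  fix p assume p: "p \<in> Qrect S T"
  then have "s_AE m (\<lambda>x. Y h x p = pwz S T \<phi> (\<lambda>q. indicator ({0..fst p} \<times> {0..snd p}) q * h q) x)"
    using Y h unfolding gaussian_paths_def by (cases p) auto
  then have ae: "AE x in m. Y h x p = pwz S T \<phi> (\<lambda>q. indicator (origin_box p) q * h q) x"
    unfolding origin_box_def[symmetric] by (rule s_AE_imp_AE)
  obtain B where B: "\<And>q. q \<in> Qrect S T \<Longrightarrow> \<bar>h q\<bar> \<le> B" using Supp_BV_bounded_measurable(2)[OF h] by blast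
  have "(\<lambda>q. indicator (origin_box p) q * h q) \<in> L2fun S T"
    by (rule L2fun_bounded_mult[OF origin_box_L2[OF p] Supp_BV_bounded_measurable(1)[OF h] B])
  from pwz_wiener_process(2)[OF wiener_process_id this]
  have r: "rep (\<lambda>x. pwz S T \<phi> (\<lambda>q. indicator (origin_box p) q * h q) x) (\<lambda>q. indicator (origin_box p) q * h q)"
    by simp
  have "AE x in m. pwz S T \<phi> (\<lambda>q. indicator (origin_box p) q * h q) x = Y h x p"
    using ae by eventually_elim (rule sym)
  then show "rep (\<lambda>x. Y h x p) (\<lambda>q. indicator (origin_box p) q * h q)" by (rule rep_cong_AE[OF r])
qed

end

end

section \<open>Complex measures\<close>

locale signed_measure =
  fixes M :: "'a measure" and \<nu> :: "'a set \<Rightarrow> real"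
  assumes countably_additive_real:
    "\<And>A :: nat \<Rightarrow> 'a set. range A \<subseteq> sets M \<Longrightarrow> disjoint_family A \<Longrightarrow> (\<lambda>n. \<nu> (A n)) sums \<nu> (\<Union>n. A n)"
begin

text \<open>The set function inside \<open>upper_variation\<close>. \<open>measure_of\<close>
  reproduces it only after it is known to be countably additive, so it is studied under its own name
  first.\<close>

definition pos_var :: "'a set \<Rightarrow> ennreal" where
  "pos_var A = (SUP B \<in> {B \<in> sets M. B \<subseteq> A}. ennreal (\<nu> B))"

lemma empty: "\<nu> {} = 0"
proof -
  have "(\<lambda>n::nat. \<nu> {}) sums \<nu> (\<Union>n::nat. {})"
    by (rule countably_additive_real) (auto simp: disjoint_family_on_def)
  then have "(\<lambda>n::nat. \<nu> {}) \<longlonglongrightarrow> 0" by (intro summable_LIMSEQ_zero sums_summable)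
  then show ?thesis by (simp add: LIMSEQ_const_iff)
qed

lemma additive:
  assumes "A \<in> sets M" "B \<in> sets M" "A \<inter> B = {}"
  shows "\<nu> (A \<union> B) = \<nu> A + \<nu> B"
proof -
  have "(\<lambda>n. \<nu> (binaryset A B n)) sums \<nu> (\<Union>n. binaryset A B n)"
    using assms
    by (intro countably_additive_real) (auto simp: disjoint_family_on_def binaryset_def)
  moreover have "(\<lambda>n. \<nu> (binaryset A B n)) sums (\<nu> A + \<nu> B)" by (rule binaryset_sums) (rule empty)
  ultimately show ?thesis by (simp add: UN_binaryset_eq sums_unique2)
qed

lemma pos_var_ge: "B \<in> sets M \<Longrightarrow> B \<subseteq> A \<Longrightarrow> ennreal (\<nu> B) \<le> pos_var A"
  unfolding pos_var_def by (rule SUP_upper) simp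

lemma pos_var_leI: "(\<And>B. B \<in> sets M \<Longrightarrow> B \<subseteq> A \<Longrightarrow> ennreal (\<nu> B) \<le> c) \<Longrightarrow> pos_var A \<le> c"
  unfolding pos_var_def by (rule SUP_least) simp

lemma pos_var_mono: "A \<subseteq> B \<Longrightarrow> pos_var A \<le> pos_var B"
  by (rule pos_var_leI) (auto intro: pos_var_ge)

lemma pos_var_superadditive:
  assumes "A \<in> sets M" "B \<in> sets M" "A \<inter> B = {}"
  shows "pos_var A + pos_var B \<le> pos_var (A \<union> B)"
proof -
  have *: "ennreal (\<nu> X) + ennreal (\<nu> Y) \<le> pos_var (A \<union> B)"
    if "X \<in> sets M" "X \<subseteq> A" "Y \<in> sets M" "Y \<subseteq> B" for X Y
  proof -
    have 1: "ennreal (\<nu> (X \<union> Y)) \<le> pos_var (A \<union> B)" "ennreal (\<nu> X) \<le> pos_var (A \<union> B)"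
      "ennreal (\<nu> Y) \<le> pos_var (A \<union> B)"
      using that by (auto intro!: pos_var_ge)
    have 2: "\<nu> (X \<union> Y) = \<nu> X + \<nu> Y" using that assms(3) by (intro additive) auto
    show ?thesis
    proof (cases "0 \<le> \<nu> X \<and> 0 \<le> \<nu> Y")
      case True
      then show ?thesis using 1(1) 2 by (simp add: ennreal_plus)
    next
      case False
      then show ?thesis using 1(2,3) by (auto simp: ennreal_neg not_le)
    qed
  qed
  have ne: "{B \<in> sets M. B \<subseteq> C} \<noteq> {}" for C by (auto intro!: exI[of _ "{}"])
  show ?thesis
    unfolding pos_var_def[of A] ennreal_SUP_add_left[OF ne, symmetric]
  proof (rule SUP_least)
    fix X assume X: "X \<in> {B \<in> sets M. B \<subseteq> A}"
    show "ennreal (\<nu> X) + pos_var B \<le> pos_var (A \<union> B)"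
      unfolding pos_var_def[of B] ennreal_SUP_add_right[OF ne]
      by (rule SUP_least) (use X * in auto)
  qed
qed

text \<open>One inequality is superadditivity on finite unions, passed to the limit by monotonicity.
  For the other, a set \<open>B\<close> inside the union is cut into the pieces
  \<open>B \<inter> A n\<close>, on which \<open>\<nu>\<close> adds up.\<close>

lemma pos_var_countably_additive: "countably_additive (sets M) pos_var"
  unfolding countably_additive_def
proof (intro allI impI)
  fix A :: "nat \<Rightarrow> 'a set" assume A: "range A \<subseteq> sets M" and disj: "disjoint_family A" and U: "(\<Union>n. A n) \<in> sets M"
  show "(\<Sum>n. pos_var (A n)) = pos_var (\<Union>n. A n)"
  proof (rule antisym)
    have "(\<Sum>n<N. pos_var (A n)) \<le> pos_var (\<Union>n<N. A n)" for N
    proof (induction N)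
      case (Suc N)
      have "(\<Sum>n<Suc N. pos_var (A n)) \<le> pos_var (\<Union>n<N. A n) + pos_var (A N)"
        using Suc by (simp add: add_right_mono)
      also have "\<dots> \<le> pos_var ((\<Union>n<N. A n) \<union> A N)"
      proof (rule pos_var_superadditive)
        have "A n \<inter> A N = {}" if "n < N" for n
          using disjoint_family_onD[OF disj, of n N] that by simp
        then show "(\<Union>n<N. A n) \<inter> A N = {}" by blast
      qed (use A in auto)
      also have "(\<Union>n<N. A n) \<union> A N = (\<Union>n<Suc N. A n)" by (auto simp: less_Suc_eq)
      finally show ?case .
    qed simp
    also have "pos_var (\<Union>n<N. A n) \<le> pos_var (\<Union>n. A n)" for N by (rule pos_var_mono) auto
    finally show "(\<Sum>n. pos_var (A n)) \<le> pos_var (\<Union>n. A n)" by (intro suminf_le_const) auto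
    show "pos_var (\<Union>n. A n) \<le> (\<Sum>n. pos_var (A n))"
    proof (rule pos_var_leI)
      fix B assume B: "B \<in> sets M" "B \<subseteq> (\<Union>n. A n)"
      have "(\<lambda>n. \<nu> (B \<inter> A n)) sums \<nu> (\<Union>n. B \<inter> A n)"
      proof (rule countably_additive_real)
        show "disjoint_family (\<lambda>n. B \<inter> A n)"
          unfolding disjoint_family_on_def using disjoint_family_onD[OF disj] by blast
      qed (use A B in auto)
      moreover have "(\<Union>n. B \<inter> A n) = B" using B by auto
      ultimately have s: "(\<lambda>n. \<nu> (B \<inter> A n)) sums \<nu> B" by simp
      \<comment> \<open>Pieces of negative measure are raised to 0, which agrees with the truncation
        by \<open>ennreal\<close> and makes the series one of nonnegative terms.\<close>
      have le: "(\<Sum>n. ennreal (max 0 (\<nu> (B \<inter> A n)))) \<le> (\<Sum>n. pos_var (A n))"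
      proof (rule suminf_le)
        fix n
        have "ennreal (\<nu> (B \<inter> A n)) \<le> pos_var (A n)" using A B by (intro pos_var_ge) auto
        then show "ennreal (max 0 (\<nu> (B \<inter> A n))) \<le> pos_var (A n)" by (simp add: max_def)
      qed auto
      show "ennreal (\<nu> B) \<le> (\<Sum>n. pos_var (A n))"
      proof (cases "(\<Sum>n. ennreal (max 0 (\<nu> (B \<inter> A n)))) = top")
        case True
        then show ?thesis using le by (simp add: top_unique)
      next
        case False
        then have sm: "summable (\<lambda>n. max 0 (\<nu> (B \<inter> A n)))" by (intro summable_suminf_not_top) auto
        have "\<nu> B \<le> (\<Sum>n. max 0 (\<nu> (B \<inter> A n)))"
          using suminf_le[OF _ sums_summable[OF s] sm] sums_unique[OF s] by simp
        then have "ennreal (\<nu> B) \<le> ennreal (\<Sum>n. max 0 (\<nu> (B \<inter> A n)))" by (rule ennreal_leI)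
        also have "\<dots> = (\<Sum>n. ennreal (max 0 (\<nu> (B \<inter> A n))))"
          using sm by (intro suminf_ennreal2[symmetric]) auto
        also note le
        finally show ?thesis .
      qed
    qed
  qed
qed

lemma pos_var_empty: "pos_var {} = 0"
  using pos_var_leI[of "{}" 0] by (simp add: empty)

lemma sets_upper_variation: "sets (upper_variation M \<nu>) = sets M"
  and space_upper_variation: "space (upper_variation M \<nu>) = space M"
  by (simp_all add: upper_variation_def)

lemma emeasure_upper_variation: "A \<in> sets M \<Longrightarrow> emeasure (upper_variation M \<nu>) A = pos_var A"
  unfolding upper_variation_def pos_var_def[symmetric]
  using pos_var_countably_additive pos_var_empty
  by (intro emeasure_measure_of_sigma sets.sigma_algebra_axioms) (auto simp: positive_def)

text \<open>A set of infinite variation splits into two parts of large measure, one of which again has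
  infinite variation. Iterating produces disjoint sets whose measures do not tend to zero.\<close>

lemma pos_var_finite: "pos_var (space M) < top"
proof (rule ccontr)
  assume "\<not> pos_var (space M) < top"
  then have top: "pos_var (space M) = top" by (simp add: less_top[symmetric])
  define bad where "bad E \<longleftrightarrow> E \<in> sets M \<and> pos_var E = top" for E
  have step: "\<exists>E'. bad E' \<and> (E' \<subseteq> E \<and> 1 \<le> \<bar>\<nu> (E - E')\<bar>)" if "bad E" for E
  proof -
    have E: "E \<in> sets M" "pos_var E = top" using that by (auto simp: bad_def)
    \<comment> \<open>The threshold \<open>1 + \<bar>\<nu> E\<bar>\<close> forces
      \<open>\<nu> (E - A) = \<nu> E - \<nu> A\<close> below -1. Hence both parts have measure at
      least 1 in absolute value, and either may be the one removed.\<close>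
    have "\<exists>A\<in>sets M. A \<subseteq> E \<and> 1 + \<bar>\<nu> E\<bar> < \<nu> A"
    proof (rule ccontr)
      assume "\<not> ?thesis"
      then have "pos_var E \<le> ennreal (1 + \<bar>\<nu> E\<bar>)"
        by (intro pos_var_leI ennreal_leI) (auto simp: not_less)
      then show False using E by (simp add: top_unique)
    qed
    then obtain A where A: "A \<in> sets M" "A \<subseteq> E" "1 + \<bar>\<nu> E\<bar> < \<nu> A" by blast
    have B: "E - A \<in> sets M" "A \<inter> (E - A) = {}" "A \<union> (E - A) = E" using A E by auto
    have nu: "\<nu> E = \<nu> A + \<nu> (E - A)" using additive[OF A(1) B(1,2)] B(3) by simp
    have big: "1 \<le> \<bar>\<nu> A\<bar>" "1 \<le> \<bar>\<nu> (E - A)\<bar>" using nu A(3) by linarith+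
    have "countably_additive (sets M) pos_var" "positive (sets M) pos_var"
      using pos_var_countably_additive pos_var_empty by (auto simp: positive_def)
    then have "pos_var A + pos_var (E - A) = pos_var E"
      using A(1) B sets.countably_additive_additive[of M pos_var] unfolding additive_def by metis
    then have "pos_var A = top \<or> pos_var (E - A) = top" using E(2) by (auto simp: ennreal_add_eq_top)
    then show ?thesis
    proof
      assume "pos_var A = top"
      then show ?thesis using A big by (intro exI[of _ A]) (auto simp: bad_def)
    next
      assume "pos_var (E - A) = top"
      moreover have "E - (E - A) = A" using A by auto
      ultimately show ?thesis using B big by (intro exI[of _ "E - A"]) (auto simp: bad_def)
    qed
  qed
  have "bad (space M)" using top by (simp add: bad_def)
  then have "\<exists>E. \<forall>n. bad (E n) \<and> (E (Suc n) \<subseteq> E n \<and> 1 \<le> \<bar>\<nu> (E n - E (Suc n))\<bar>)"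
    by (intro dependent_nat_choice step) auto
  then obtain E where E: "\<And>n. E n \<in> sets M" "\<And>n. E (Suc n) \<subseteq> E n" "\<And>n. 1 \<le> \<bar>\<nu> (E n - E (Suc n))\<bar>"
    by (auto simp: bad_def)
  have dec: "E n \<subseteq> E k" if "k \<le> n" for k n
    using that by (induction rule: dec_induct) (use E(2) in auto)
  have "disjoint_family (\<lambda>n. E n - E (Suc n))"
    unfolding disjoint_family_on_def
  proof (intro ballI impI)
    fix k n :: nat assume "k \<noteq> n"
    then consider "Suc k \<le> n" | "Suc n \<le> k" by linarith
    then show "(E k - E (Suc k)) \<inter> (E n - E (Suc n)) = {}"
      by cases (use dec[of "Suc k" n] dec[of "Suc n" k] in blast)+
  qed
  then have "(\<lambda>n. \<nu> (E n - E (Suc n))) sums \<nu> (\<Union>n. E n - E (Suc n))"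
    using E(1) by (intro countably_additive_real) auto
  then have "(\<lambda>n. \<nu> (E n - E (Suc n))) \<longlonglongrightarrow> 0" by (intro summable_LIMSEQ_zero sums_summable)
  then have "(\<lambda>n. \<bar>\<nu> (E n - E (Suc n))\<bar>) \<longlonglongrightarrow> 0" by (rule tendsto_rabs_zero)
  then have "1 \<le> (0::real)" by (rule LIMSEQ_le_const) (use E(3) in auto)
  then show False by simp
qed

lemma finite_measure_upper_variation: "finite_measure (upper_variation M \<nu>)"
  using pos_var_finite
  by (intro finite_measureI) (auto simp: space_upper_variation emeasure_upper_variation less_top)

end

section \<open>Reduction of a complex measure to four finite positive measures\<close>

definition cm_parts :: "'a measure \<Rightarrow> ('a set \<Rightarrow> complex) \<Rightarrow> 'a measure set" where
  "cm_parts M f = {upper_variation M (\<lambda>A. Re (f A)), upper_variation M (\<lambda>A. - Re (f A)),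
    upper_variation M (\<lambda>A. Im (f A)), upper_variation M (\<lambda>A. - Im (f A))}"

context
  fixes M :: "'a measure" and f :: "'a set \<Rightarrow> complex"
  assumes f: "f \<in> complex_measures M"
begin

lemma signed_measure_parts:
  "signed_measure M (\<lambda>A. Re (f A))" "signed_measure M (\<lambda>A. - Re (f A))"
  "signed_measure M (\<lambda>A. Im (f A))" "signed_measure M (\<lambda>A. - Im (f A))"
proof -
  have s: "(\<lambda>n. f (A n)) sums f (\<Union>n. A n)" if "range A \<subseteq> sets M" "disjoint_family A" for A :: "nat \<Rightarrow> 'a set"
    using f that by (simp add: complex_measures_def)
  show "signed_measure M (\<lambda>A. Re (f A))" "signed_measure M (\<lambda>A. - Re (f A))"
    "signed_measure M (\<lambda>A. Im (f A))" "signed_measure M (\<lambda>A. - Im (f A))"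
    by (rule signed_measure.intro; intro sums_minus sums_Re sums_Im s; assumption)+
qed

lemma cm_parts_measure:
  assumes "\<mu> \<in> cm_parts M f"
  shows "finite_measure \<mu>" "sets \<mu> = sets M" "space \<mu> = space M"
  using assms signed_measure_parts[THEN signed_measure.finite_measure_upper_variation]
    signed_measure_parts[THEN signed_measure.sets_upper_variation]
    signed_measure_parts[THEN signed_measure.space_upper_variation]
  by (auto simp: cm_parts_def)

text \<open>The bridge between null sets of a complex measure and ordinary almost everywhere
  statements, to which Fubini's theorem applies. If all four variations of a set vanish, the real
  and imaginary parts of \<open>f\<close> on each of its measurable subsets are at most 0 with
  either sign.\<close>

lemma cm_AE_iff:
  assumes P: "{u \<in> space M. \<not> P u} \<in> sets M"
  shows "cm_AE M f P \<longleftrightarrow> (\<forall>\<mu>\<in>cm_parts M f. AE u in \<mu>. P u)"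
proof
  assume "cm_AE M f P"
  then obtain N where N: "N \<in> sets M" "\<And>B. B \<in> sets M \<Longrightarrow> B \<subseteq> N \<Longrightarrow> f B = 0" "{u \<in> space M. \<not> P u} \<subseteq> N"
    unfolding cm_AE_def by blast
  have z: "emeasure (upper_variation M \<nu>) N = 0"
    if "signed_measure M \<nu>" "\<And>B. B \<in> sets M \<Longrightarrow> B \<subseteq> N \<Longrightarrow> \<nu> B = 0" for \<nu>
  proof -
    interpret signed_measure M \<nu> by (rule that(1))
    show ?thesis using emeasure_upper_variation[OF N(1)] pos_var_leI[of N 0] that(2) by simp
  qed
  have "emeasure \<mu> N = 0" if "\<mu> \<in> cm_parts M f" for \<mu>
    using that N(2) unfolding cm_parts_def by (auto intro!: z signed_measure_parts)
  then show "\<forall>\<mu>\<in>cm_parts M f. AE u in \<mu>. P u"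
    using N(1,3) by (auto intro!: AE_I[of _ _ N] simp: cm_parts_measure)
next
  assume ae: "\<forall>\<mu>\<in>cm_parts M f. AE u in \<mu>. P u"
  let ?D = "{u \<in> space M. \<not> P u}"
  have "emeasure \<mu> ?D = 0" if "\<mu> \<in> cm_parts M f" for \<mu>
    using ae that P AE_iff_measurable[of ?D \<mu> P] by (simp add: cm_parts_measure[OF that])
  then have pv: "emeasure (upper_variation M (\<lambda>A. Re (f A))) ?D = 0" "emeasure (upper_variation M (\<lambda>A. - Re (f A))) ?D = 0"
    "emeasure (upper_variation M (\<lambda>A. Im (f A))) ?D = 0" "emeasure (upper_variation M (\<lambda>A. - Im (f A))) ?D = 0"
    by (simp_all add: cm_parts_def)
  have "f B = 0" if "B \<in> sets M" "B \<subseteq> ?D" for B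
  proof -
    have "ennreal (Re (f B)) \<le> 0" "ennreal (- Re (f B)) \<le> 0" "ennreal (Im (f B)) \<le> 0" "ennreal (- Im (f B)) \<le> 0"
      using signed_measure_parts[THEN signed_measure.pos_var_ge, OF that] pv
      unfolding signed_measure_parts[THEN signed_measure.emeasure_upper_variation, OF P]
      by simp_all
    then show ?thesis by (simp add: complex_eq_iff ennreal_eq_0_iff)
  qed
  then show "cm_AE M f P" unfolding cm_AE_def using P by blast
qed

lemma cm_integral_cong:
  assumes "\<And>\<mu>. \<mu> \<in> cm_parts M f \<Longrightarrow> integral\<^sup>L \<mu> g = integral\<^sup>L \<mu> g'"
  shows "cm_integral M f g = cm_integral M f g'"
  using assms by (simp add: cm_integral_def cm_parts_def)

lemma cm_integral_cong_AE:
  assumes "{u \<in> space M. \<not> P u} \<in> sets M" "cm_AE M f P"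
    "g \<in> borel_measurable M" "g' \<in> borel_measurable M" "\<And>u. u \<in> space M \<Longrightarrow> P u \<Longrightarrow> g u = g' u"
  shows "cm_integral M f g = cm_integral M f g'"
proof (rule cm_integral_cong)
  fix \<mu> assume \<mu>: "\<mu> \<in> cm_parts M f"
  note m = cm_parts_measure[OF \<mu>]
  have "AE u in \<mu>. P u" using assms(1,2) \<mu> cm_AE_iff by blast
  then have "AE u in \<mu>. g u = g' u" using AE_space by eventually_elim (simp add: assms(5) m)
  then show "integral\<^sup>L \<mu> g = integral\<^sup>L \<mu> g'"
    using assms(3,4) by (intro integral_cong_AE) (auto simp: measurable_cong_sets[OF m(2) refl])
qed

end

section \<open>Laplace transforms of finite measures\<close>

lemma norm_exp_minus_le_1: "0 \<le> c \<Longrightarrow> 0 \<le> Re w \<Longrightarrow> norm (exp (- (of_real c * w))) \<le> 1"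
  by simp

text \<open>The derivative has modulus at most \<open>c * exp (- (c * d))\<close>, and this is at
  most \<open>1 / d\<close> because \<open>c * d \<le> exp (c * d)\<close>. The bound is uniform in
  \<open>c\<close>, so differentiation under the integral works for unbounded
  \<open>c\<close>.\<close>

lemma exp_difference_quotient_bound:
  assumes c: "0 \<le> c" and d: "0 < d" and w: "d \<le> Re w" and z: "d \<le> Re z"
  shows "norm (exp (- (of_real c * w)) - exp (- (of_real c * z))) \<le> 1 / d * norm (w - z)"
proof (rule field_differentiable_bound[where S="{w. d \<le> Re w}" and f'="\<lambda>w. - of_real c * exp (- (of_real c * w))"])
  show "convex {w. d \<le> Re w}" using convex_halfspace_Re_ge[of d] by simp
  fix v assume "v \<in> {w. d \<le> Re w}"
  then have v: "d \<le> Re v" by simp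
  show "((\<lambda>w. exp (- (of_real c * w))) has_field_derivative - of_real c * exp (- (of_real c * v)))
      (at v within {w. d \<le> Re w})"
    by (auto intro!: derivative_eq_intros)
  have "norm (- of_real c * exp (- (of_real c * v))) = c * exp (- (c * Re v))"
    using c by (simp add: norm_mult)
  also have "\<dots> \<le> c * exp (- (c * d))" using c v by (simp add: mult_left_mono)
  also have "\<dots> \<le> 1 / d"
  proof -
    have "c * d \<le> exp (c * d)" using exp_ge_add_one_self[of "c * d"] by linarith
    then have "c * d * exp (- (c * d)) \<le> exp (c * d) * exp (- (c * d))" by (intro mult_right_mono) auto
    then have "c * d * exp (- (c * d)) \<le> 1" by (simp add: exp_add[symmetric])
    then show ?thesis using d by (simp add: field_simps)
  qed
  finally show "norm (- of_real c * exp (- (of_real c * v))) \<le> 1 / d" .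
qed (use w z in auto)

text \<open>Differentiation under the integral gives analyticity in the open half-plane. In the
  second claim \<open>w\<close> may lie on the imaginary axis: the approach is from inside, where
  the exponential has modulus at most 1.\<close>

lemma (in finite_measure) Laplace_transform:
  fixes b :: "'a \<Rightarrow> complex" and c :: "'a \<Rightarrow> real"
  assumes b [measurable]: "b \<in> borel_measurable M" and B: "\<And>u. u \<in> space M \<Longrightarrow> norm (b u) \<le> B"
    and c [measurable]: "c \<in> borel_measurable M" and c0: "\<And>u. u \<in> space M \<Longrightarrow> 0 \<le> c u"
  shows "(\<lambda>w. LINT u|M. b u * exp (- (of_real (c u) * w))) holomorphic_on {w. 0 < Re w}"
    and "\<And>X w. (\<And>n. 0 < Re (X n)) \<Longrightarrow> X \<longlonglongrightarrow> w \<Longrightarrow>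
      (\<lambda>n. LINT u|M. b u * exp (- (of_real (c u) * X n))) \<longlonglongrightarrow> (LINT u|M. b u * exp (- (of_real (c u) * w)))"
proof -
  let ?g = "\<lambda>w u. b u * exp (- (of_real (c u) * w))"
  have gm [measurable]: "?g w \<in> borel_measurable M" for w by measurable
  have gB: "norm (?g w u) \<le> B" if "u \<in> space M" "0 \<le> Re w" for u w
    using mult_mono[OF B[OF that(1)] norm_exp_minus_le_1[OF c0[OF that(1)] that(2)]] norm_ge_zero[of "b u"] B[OF that(1)]
    by (simp add: norm_mult)
  have gi: "integrable M (?g w)" if "0 \<le> Re w" for w
    using gB that by (intro integrable_const_bound[where B=B]) auto
  show "(\<lambda>n. LINT u|M. ?g (X n) u) \<longlonglongrightarrow> (LINT u|M. ?g w u)" if X: "\<And>n. 0 < Re (X n)" "X \<longlonglongrightarrow> w" for X w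
  proof (rule integral_dominated_convergence[where w="\<lambda>_. B"])
    show "AE u in M. (\<lambda>n. ?g (X n) u) \<longlonglongrightarrow> ?g w u" using X by (intro AE_I2 tendsto_intros)
    show "AE u in M. norm (?g (X n) u) \<le> B" for n using gB less_imp_le[OF X(1)] by (intro AE_I2) auto
  qed auto
  show "(\<lambda>w. LINT u|M. ?g w u) holomorphic_on {w. 0 < Re w}"
  proof (subst holomorphic_on_open)
    show "open {w. 0 < Re w}" by (rule open_halfspace_Re_gt)
    show "\<forall>z\<in>{w. 0 < Re w}. \<exists>D. ((\<lambda>w. LINT u|M. ?g w u) has_field_derivative D) (at z)"
    proof
      fix z :: complex assume "z \<in> {w. 0 < Re w}"
      then have z: "0 < Re z" by simp
      define d where "d = Re z / 2"
      have d: "0 < d" "d < Re z" using z by (auto simp: d_def)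
      \<comment> \<open>A smaller open half-plane around \<open>z\<close> on which the difference
        quotients are dominated by \<open>B / d\<close>.\<close>
      let ?S = "{w. d < Re w}"
      let ?D = "\<lambda>u. b u * (- of_real (c u) * exp (- (of_real (c u) * z)))"
      have "((\<lambda>w. LINT u|M. ?g w u) has_field_derivative (LINT u|M. ?D u)) (at z within ?S)"
        unfolding has_field_derivative_iff tendsto_at_iff_sequentially
      proof (intro allI impI)
        fix X assume X: "\<forall>i. X i \<in> ?S - {z}" "X \<longlonglongrightarrow> z"
        let ?q = "\<lambda>n u. (?g (X n) u - ?g z u) / (X n - z)"
        have "(\<lambda>n. LINT u|M. ?q n u) \<longlonglongrightarrow> (LINT u|M. ?D u)"
        proof (rule integral_dominated_convergence[where w="\<lambda>_. B * (1 / d)"])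
          show "AE u in M. (\<lambda>n. ?q n u) \<longlonglongrightarrow> ?D u"
          proof (rule AE_I2)
            fix u
            have "((\<lambda>w. ?g w u) has_field_derivative ?D u) (at z within ?S)"
              by (auto intro!: derivative_eq_intros)
            then show "(\<lambda>n. ?q n u) \<longlonglongrightarrow> ?D u"
              unfolding has_field_derivative_iff tendsto_at_iff_sequentially using X by (auto simp: o_def)
          qed
          show "AE u in M. norm (?q n u) \<le> B * (1 / d)" for n
          proof (rule AE_I2)
            fix u assume u: "u \<in> space M"
            have X': "d < Re (X n)" "X n \<noteq> z" using X(1) by auto
            have "norm (?q n u) = norm (b u) * (norm (exp (- (of_real (c u) * X n)) - exp (- (of_real (c u) * z))) / norm (X n - z))"
              by (simp add: right_diff_distrib[symmetric] norm_mult norm_divide)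
            also have "\<dots> \<le> B * (1 / d)"
            proof (rule mult_mono[OF B[OF u]])
              show "norm (exp (- (of_real (c u) * X n)) - exp (- (of_real (c u) * z))) / norm (X n - z) \<le> 1 / d"
                using exp_difference_quotient_bound[OF c0[OF u] d(1) less_imp_le[OF X'(1)] less_imp_le[OF d(2)]] X'(2)
                by (simp add: pos_divide_le_eq)
              show "0 \<le> B" using B[OF u] norm_ge_zero[of "b u"] by linarith
            qed simp
            finally show "norm (?q n u) \<le> B * (1 / d)" .
          qed
        qed auto
        moreover have eq: "(LINT u|M. ?q n u) = ((LINT u|M. ?g (X n) u) - (LINT u|M. ?g z u)) / (X n - z)" for n
        proof -
          have "0 \<le> Re (X n)" using X(1) d by (auto intro: less_imp_le less_trans)
          then have "(LINT u|M. ?g (X n) u - ?g z u) = (LINT u|M. ?g (X n) u) - (LINT u|M. ?g z u)"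
            using z by (intro Bochner_Integration.integral_diff gi) auto
          then show ?thesis by (simp only: integral_divide_zero)
        qed
        ultimately show "((\<lambda>w. ((LINT u|M. ?g w u) - (LINT u|M. ?g z u)) / (w - z)) \<circ> X) \<longlonglongrightarrow> (LINT u|M. ?D u)"
          unfolding o_def eq[symmetric] by blast
      qed
      moreover have "at z within ?S = at z" using d(2) by (intro at_within_open open_halfspace_Re_gt) simp
      ultimately show "\<exists>D. ((\<lambda>w. LINT u|M. ?g w u) has_field_derivative D) (at z)" by auto
    qed
  qed
qed

section \<open>Analytic Feynman integrals of Fourier transforms\<close>

lemma islimpt_right_half_plane: "- \<i> * of_real q islimpt {z. 0 < Re z}"
  unfolding islimpt_approachable
proof (intro allI impI)
  fix e :: real assume "0 < e"
  then show "\<exists>x'\<in>{z. 0 < Re z}. x' \<noteq> - \<i> * of_real q \<and> dist x' (- \<i> * of_real q) < e"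
    by (intro bexI[of _ "- \<i> * of_real q + of_real (e / 2)"]) (auto simp: dist_norm)
qed

text \<open>Two analytic extensions agree on the positive axis, hence on the half-plane by the
  identity theorem. As \<open>- \<i> * of_real q\<close> is an accumulation point of the half-plane,
  the limits agree too. This gives the description operator in \<open>feynman\<close> its
  meaning.\<close>

lemma has_feynman_unique:
  assumes "has_feynman m Z q F w" "has_feynman m Z q F w'"
  shows "w = w'"
proof -
  let ?S = "{z. 0 < Re z}"
  obtain g g' where g: "g holomorphic_on ?S" "\<And>l. 0 < l \<Longrightarrow> g (of_real l) = J_fun m Z F l"
      "(g \<longlongrightarrow> w) (at (- \<i> * of_real q) within ?S)"
    and g': "g' holomorphic_on ?S" "\<And>l. 0 < l \<Longrightarrow> g' (of_real l) = J_fun m Z F l"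
      "(g' \<longlongrightarrow> w') (at (- \<i> * of_real q) within ?S)"
    using assms unfolding has_feynman_def analytic_extension_J_def by blast
  have "g z - g' z = 0" if "z \<in> ?S" for z
  proof (rule analytic_continuation[of "\<lambda>z. g z - g' z" ?S "of_real ` {0<..}" 1])
    show "(\<lambda>z. g z - g' z) holomorphic_on ?S" by (intro holomorphic_intros g g')
    show "open ?S" by (rule open_halfspace_Re_gt)
    show "connected ?S" by (intro convex_connected convex_halfspace_Re_gt)
    show "(1::complex) islimpt of_real ` {0<..}"
      unfolding islimpt_approachable
    proof (intro allI impI)
      fix e :: real assume "0 < e"
      then show "\<exists>x'\<in>of_real ` {0<..}. x' \<noteq> (1::complex) \<and> dist x' 1 < e"
        by (intro bexI[of _ "of_real (1 + e / 2)"]) (auto simp: dist_norm intro!: image_eqI[of _ _ "1 + e / 2"])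
    qed
  qed (use that g g' in auto)
  then have "\<forall>\<^sub>F z in at (- \<i> * of_real q) within ?S. g z = g' z"
    by (auto simp: eventually_at_filter)
  then have "(g' \<longlongrightarrow> w) (at (- \<i> * of_real q) within ?S)"
    using g(3) by (rule Lim_transform_eventually[rotated])
  moreover have "at (- \<i> * of_real q) within ?S \<noteq> bot"
    using islimpt_right_half_plane by (simp add: trivial_limit_within)
  ultimately show ?thesis using g'(3) tendsto_unique by blast
qed

lemma feynman_eq: "has_feynman m Z q F w \<Longrightarrow> feynman m Z q F = w"
  unfolding feynman_def by (rule the_equality) (auto intro: has_feynman_unique)

context yeh_wiener_space
begin

lemma L2norm_mult_sum_squares:
  assumes h: "h1 \<in> Supp_BV S T" "h2 \<in> Supp_BV S T" "s \<in> Supp_BV S T"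
    and eq: "AE p in leb_Q S T. (s p)\<^sup>2 = (h1 p)\<^sup>2 + (h2 p)\<^sup>2" and v: "v \<in> L2fun S T"
  shows "(L2norm S T (\<lambda>p. v p * s p))\<^sup>2 = (L2norm S T (\<lambda>p. v p * h1 p))\<^sup>2 + (L2norm S T (\<lambda>p. v p * h2 p))\<^sup>2"
proof -
  have m: "(\<lambda>p. v p * h p) \<in> L2fun S T" if "h \<in> Supp_BV S T" for h
    using Supp_BV_bounded_measurable[OF that] L2fun_bounded_mult[OF v] by blast
  note i = m[OF h(1), THEN L2fun_square_integrable] m[OF h(2), THEN L2fun_square_integrable]
    m[OF h(3), THEN L2fun_square_integrable]
  have "(LINT p|leb_Q S T. (v p * s p)\<^sup>2) = (LINT p|leb_Q S T. (v p * h1 p)\<^sup>2 + (v p * h2 p)\<^sup>2)"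
  proof (rule integral_cong_AE)
    show "AE p in leb_Q S T. (v p * s p)\<^sup>2 = (v p * h1 p)\<^sup>2 + (v p * h2 p)\<^sup>2"
      using eq by eventually_elim (simp add: power_mult_distrib distrib_left)
  qed (use i in auto)
  then show ?thesis using i by (simp add: L2norm_sq_eq)
qed

section \<open>Integrating Fourier functionals along Wiener processes\<close>

context
  fixes \<phi> :: "nat \<Rightarrow> pt \<Rightarrow> real"
  assumes onb: "complete_orthonormal_bv S T \<phi>"
begin

lemma rs_integral_measurable:
  "wiener_process Z h \<Longrightarrow> (\<lambda>x. rs_integral S T (\<phi> j) (Z x)) \<in> borel_measurable m"
  by (intro rep_measurable[OF rep_rs_integral] onb_bv[OF onb])

text \<open>Each partial sum is a finite sum of products of a function of \<open>u\<close> and a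
  function of \<open>x\<close>; joint measurability follows from that of the factors and passes to
  the limit.\<close>

lemma measurable_pwz_seq_joint:
  assumes Z: "wiener_process Z h"
  shows "(\<lambda>w. pwz_seq S T \<phi> (L2rep (fst w)) (Z (snd w)) n) \<in> borel_measurable (L2borel S T \<Otimes>\<^sub>M m)"
proof -
  note [measurable] = rs_integral_measurable[OF Z] measurable_L2inner_rep[OF onb_L2[OF onb]]
  have "(\<lambda>w. \<Sum>j<n. L2inner S T (L2rep (fst w)) (\<phi> j) * rs_integral S T (\<phi> j) (Z (snd w)))
      \<in> borel_measurable (L2borel S T \<Otimes>\<^sub>M m)"
    by measurable
  then show ?thesis
    by (rule measurable_cong[THEN iffD1, rotated])
      (auto simp: space_pair_measure space_m pwz_seq_eq[OF ST onb wiener_process_C0[OF Z]])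
qed

lemma measurable_pwz_joint:
  assumes Z: "wiener_process Z h"
  shows "(\<lambda>w. pwz S T \<phi> (L2rep (fst w)) (Z (snd w))) \<in> borel_measurable (L2borel S T \<Otimes>\<^sub>M m)"
  unfolding pwz_def by (intro borel_measurable_lim_metric measurable_pwz_seq_joint[OF Z])

lemma sets_pwz_exists:
  assumes "x \<in> C0 S T"
  shows "{u \<in> space (L2borel S T). \<not> pwz_exists S T \<phi> (L2rep u) x} \<in> sets (L2borel S T)"
proof -
  have "{u \<in> space (L2borel S T). Cauchy (\<lambda>n. pwz_seq S T \<phi> (L2rep u) x n)} \<in> sets (L2borel S T)"
    by (rule sets_Collect_Cauchy) (rule measurable_pwz_seq_rep[OF ST onb assms])
  then show ?thesis unfolding pwz_exists_def Cauchy_convergent_iff[symmetric]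
    by (rule sets.sets_Collect_neg)
qed

text \<open>For each \<open>u\<close> the limit exists for almost every \<open>x\<close>, with a
  null set depending on \<open>u\<close>. Fubini on each of the four positive parts of
  \<open>f\<close> exchanges the two quantifiers.\<close>

lemma AE_cm_AE_pwz_exists:
  assumes Z: "wiener_process Z h" and f: "f \<in> complex_measures (L2borel S T)"
  shows "AE x in m. cm_AE (L2borel S T) f (\<lambda>u. pwz_exists S T \<phi> (L2rep u) (Z x))"
proof -
  have "AE x in m. AE u in \<mu>. pwz_exists S T \<phi> (L2rep u) (Z x)" if \<mu>: "\<mu> \<in> cm_parts (L2borel S T) f" for \<mu>
  proof -
    note p = cm_parts_measure[OF f \<mu>]
    interpret \<mu>: finite_measure \<mu> by (rule p(1))
    interpret P: pair_sigma_finite \<mu> m ..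
    have sets: "sets (\<mu> \<Otimes>\<^sub>M m) = sets (L2borel S T \<Otimes>\<^sub>M m)" by (rule sets_pair_measure_cong[OF p(2) refl])
    have "{w \<in> space (L2borel S T \<Otimes>\<^sub>M m). Cauchy (\<lambda>n. pwz_seq S T \<phi> (L2rep (fst w)) (Z (snd w)) n)}
        \<in> sets (L2borel S T \<Otimes>\<^sub>M m)"
      by (rule sets_Collect_Cauchy) (rule measurable_pwz_seq_joint[OF Z])
    then have "{w \<in> space (\<mu> \<Otimes>\<^sub>M m). pwz_exists S T \<phi> (L2rep (fst w)) (Z (snd w))} \<in> sets (\<mu> \<Otimes>\<^sub>M m)"
      unfolding sets sets_eq_imp_space_eq[OF sets] pwz_exists_def Cauchy_convergent_iff[symmetric] .
    from P.AE_commute[OF this]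
    have "(AE x in m. AE u in \<mu>. pwz_exists S T \<phi> (L2rep u) (Z x)) \<longleftrightarrow>
        (AE u in \<mu>. AE x in m. pwz_exists S T \<phi> (L2rep u) (Z x))" by (rule sym)
    moreover have "AE u in \<mu>. AE x in m. pwz_exists S T \<phi> (L2rep u) (Z x)"
      by (rule AE_I2) (simp add: p(3) pwz_wiener_process(1)[OF onb Z L2rep_L2fun])
    ultimately show ?thesis by blast
  qed
  moreover have "finite (cm_parts (L2borel S T) f)" by (simp add: cm_parts_def)
  ultimately have "AE x in m. \<forall>\<mu>\<in>cm_parts (L2borel S T) f. AE u in \<mu>. pwz_exists S T \<phi> (L2rep u) (Z x)"
    by (intro AE_finite_allI) auto
  then show ?thesis
    using AE_space
  proof eventually_elim
    case (elim x)
    then have "Z x \<in> C0 S T" using wiener_process_C0[OF Z] by (simp add: space_m)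
    then show ?case using elim(1) cm_AE_iff[OF f sets_pwz_exists] by blast
  qed
qed

lemma Fubini_pwz:
  assumes Z: "wiener_process Z h" and \<mu>: "finite_measure \<mu>" "sets \<mu> = sets (L2borel S T)"
    and b: "b \<in> borel_measurable (L2borel S T)" "\<And>u. u \<in> L2 S T \<Longrightarrow> norm (b u) \<le> (1::real)"
  shows "integrable m (\<lambda>x. LINT u|\<mu>. b u * exp (\<i> * of_real (t * pwz S T \<phi> (L2rep u) (Z x))) :: complex)"
    and "(LINT x|m. (LINT u|\<mu>. b u * exp (\<i> * of_real (t * pwz S T \<phi> (L2rep u) (Z x))))) =
      (LINT u|\<mu>. b u * of_real (exp (- (t\<^sup>2 * (L2norm S T (\<lambda>p. L2rep u p * h p))\<^sup>2) / 2)))"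
proof -
  interpret \<mu>: finite_measure \<mu> by (rule \<mu>(1))
  interpret P: pair_sigma_finite \<mu> m ..
  interpret F: finite_measure "\<mu> \<Otimes>\<^sub>M m" by (rule finite_measure_pair_measure) unfold_locales
  have sp: "space \<mu> = L2 S T" using sets_eq_imp_space_eq[OF \<mu>(2)] by simp
  let ?g = "\<lambda>u x. b u * exp (\<i> * of_real (t * pwz S T \<phi> (L2rep u) (Z x)))"
  note [measurable] = measurable_pwz_joint[OF Z] b(1)
  have "(\<lambda>w. ?g (fst w) (snd w)) \<in> borel_measurable (L2borel S T \<Otimes>\<^sub>M m)" by measurable
  then have gm: "case_prod ?g \<in> borel_measurable (\<mu> \<Otimes>\<^sub>M m)"
    unfolding measurable_cong_sets[OF sets_pair_measure_cong[OF \<mu>(2) refl] refl] by (simp add: case_prod_beta')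
  have gi: "integrable (\<mu> \<Otimes>\<^sub>M m) (case_prod ?g)"
    using gm b(2) by (intro F.integrable_const_bound[where B=1])
      (auto simp: space_pair_measure sp norm_mult intro!: AE_I2)
  show "integrable m (\<lambda>x. LINT u|\<mu>. ?g u x)" by (rule P.integrable_snd[OF gi])
  have "(LINT x|m. (LINT u|\<mu>. ?g u x)) = (LINT u|\<mu>. (LINT x|m. ?g u x))" by (rule P.Fubini_integral[OF gi])
  also have "\<dots> = (LINT u|\<mu>. b u * of_real (exp (- (t\<^sup>2 * (L2norm S T (\<lambda>p. L2rep u p * h p))\<^sup>2) / 2)))"
  proof (rule Bochner_Integration.integral_cong[OF refl])
    fix u assume "u \<in> space \<mu>"
    then have u: "L2rep u \<in> L2fun S T" using L2rep_L2fun sp by simp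
    show "(LINT x|m. ?g u x) = b u * of_real (exp (- (t\<^sup>2 * (L2norm S T (\<lambda>p. L2rep u p * h p))\<^sup>2) / 2))"
      using rep_char[OF pwz_wiener_process(2)[OF onb Z u], of t] by simp
  qed
  finally show "(LINT x|m. (LINT u|\<mu>. ?g u x)) =
      (LINT u|\<mu>. b u * of_real (exp (- (t\<^sup>2 * (L2norm S T (\<lambda>p. L2rep u p * h p))\<^sup>2) / 2)))" .
qed

lemma measurable_L2norm_process:
  assumes "wiener_process Z h"
  shows "(\<lambda>u. L2norm S T (\<lambda>p. L2rep u p * h p)) \<in> borel_measurable (L2borel S T)"
  using assms measurable_L2norm_mult unfolding wiener_process_def by blast

lemma has_feynman_fourier:
  assumes Z: "wiener_process Z h" and f: "f \<in> complex_measures (L2borel S T)" and q: "q \<noteq> 0"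
    and b: "b \<in> borel_measurable (L2borel S T)" "\<And>u. u \<in> L2 S T \<Longrightarrow> norm (b u) \<le> 1"
    and \<Phi>: "\<And>l. 0 < l \<Longrightarrow> AE x in m. \<Phi> (\<lambda>p. Z x p / sqrt l) =
      cm_integral (L2borel S T) f (\<lambda>u. b u * exp (\<i> * of_real (1 / sqrt l * pwz S T \<phi> (L2rep u) (Z x))))"
  shows "has_feynman m Z q \<Phi> (cm_integral (L2borel S T) f
    (\<lambda>u. b u * exp (- (\<i> / (2 * of_real q)) * of_real ((L2norm S T (\<lambda>p. L2rep u p * h p))\<^sup>2))))"
proof -
  let ?L = "L2borel S T" and ?S = "{z. 0 < Re z}"
  define c where "c u = (L2norm S T (\<lambda>p. L2rep u p * h p))\<^sup>2 / 2" for u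
  have cm: "c \<in> borel_measurable ?L"
    unfolding c_def[abs_def] using measurable_L2norm_process[OF Z] by measurable
  define g where "g z = cm_integral ?L f (\<lambda>u. b u * exp (- (of_real (c u) * (1 / z))))" for z
  let ?\<mu>1 = "upper_variation ?L (\<lambda>A. Re (f A))" and ?\<mu>2 = "upper_variation ?L (\<lambda>A. - Re (f A))"
  let ?\<mu>3 = "upper_variation ?L (\<lambda>A. Im (f A))" and ?\<mu>4 = "upper_variation ?L (\<lambda>A. - Im (f A))"
  have parts: "?\<mu>1 \<in> cm_parts ?L f" "?\<mu>2 \<in> cm_parts ?L f" "?\<mu>3 \<in> cm_parts ?L f" "?\<mu>4 \<in> cm_parts ?L f"
    by (simp_all add: cm_parts_def)
  note pm = cm_parts_measure[OF f]
  \<comment> \<open>Inversion maps the right half-plane into itself, so the Laplace transform may be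
    evaluated at \<open>1 / z\<close>.\<close>
  have inv: "0 < Re (1 / z)" if "0 < Re z" for z :: complex
  proof -
    have "z \<noteq> 0" using that by auto
    then show ?thesis using that by (simp add: Re_divide' zero_less_divide_iff)
  qed
  have lap: "(\<lambda>w. LINT u|\<mu>. b u * exp (- (of_real (c u) * w))) holomorphic_on ?S"
    "\<And>X w. (\<And>n. 0 < Re (X n)) \<Longrightarrow> X \<longlonglongrightarrow> w \<Longrightarrow>
      (\<lambda>n. LINT u|\<mu>. b u * exp (- (of_real (c u) * X n))) \<longlonglongrightarrow> (LINT u|\<mu>. b u * exp (- (of_real (c u) * w)))"
    if \<mu>: "\<mu> \<in> cm_parts ?L f" for \<mu>
  proof -
    interpret \<mu>: finite_measure \<mu> by (rule pm(1)[OF \<mu>])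
    have bc: "b \<in> borel_measurable \<mu>" "c \<in> borel_measurable \<mu>"
      using b(1) cm by (simp_all add: measurable_cong_sets[OF pm(2)[OF \<mu>] refl])
    have b1: "norm (b u) \<le> 1" if "u \<in> space \<mu>" for u using b(2) that pm(3)[OF \<mu>] by simp
    have c0: "0 \<le> c u" if "u \<in> space \<mu>" for u by (simp add: c_def)
    note L = \<mu>.Laplace_transform[OF bc(1) b1 bc(2) c0]
    show "(\<lambda>w. LINT u|\<mu>. b u * exp (- (of_real (c u) * w))) holomorphic_on ?S" by (rule L(1))
    show "(\<lambda>n. LINT u|\<mu>. b u * exp (- (of_real (c u) * X n))) \<longlonglongrightarrow> (LINT u|\<mu>. b u * exp (- (of_real (c u) * w)))"
      if "\<And>n. 0 < Re (X n)" "X \<longlonglongrightarrow> w" for X w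
      by (rule L(2)[OF _ _ that]) assumption+
  qed
  have hol: "(\<lambda>z. LINT u|\<mu>. b u * exp (- (of_real (c u) * (1 / z)))) holomorphic_on ?S"
    if "\<mu> \<in> cm_parts ?L f" for \<mu>
  proof -
    have "(\<lambda>z::complex. 1 / z) holomorphic_on ?S"
      by (intro holomorphic_intros) (metis (mono_tags, lifting) less_irrefl mem_Collect_eq zero_complex.sel(1))
    from holomorphic_on_compose_gen[OF this lap(1)[OF that]] show ?thesis
      using inv by (auto simp: o_def image_subset_iff)
  qed
  have "analytic_extension_J m Z \<Phi> g"
    unfolding analytic_extension_J_def
  proof (intro conjI allI impI)
    show "g holomorphic_on {z. 0 < Re z}"
      unfolding g_def cm_integral_def by (intro holomorphic_intros hol parts)
    fix l :: real assume l: "0 < l"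
    let ?t = "1 / sqrt l"
    let ?I = "\<lambda>\<mu> x. LINT u|\<mu>. b u * exp (\<i> * of_real (?t * pwz S T \<phi> (L2rep u) (Z x)))"
    let ?K = "\<lambda>\<mu>. LINT u|\<mu>. b u * exp (- (of_real (c u) * (1 / of_real l)))"
    have int: "integrable m (?I \<mu>)" and val: "(LINT x|m. ?I \<mu> x) = ?K \<mu>" if "\<mu> \<in> cm_parts ?L f" for \<mu>
    proof -
      note F = Fubini_pwz[OF Z pm(1)[OF that] pm(2)[OF that] b, of ?t]
      show "integrable m (?I \<mu>)" by (rule F(1))
      have "?t\<^sup>2 = 1 / l" using l by (simp add: power_divide)
      then have "of_real (exp (- (?t\<^sup>2 * (L2norm S T (\<lambda>p. L2rep u p * h p))\<^sup>2) / 2)) =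
          exp (- (of_real (c u) * (1 / of_real l)) :: complex)" for u
        by (simp add: c_def exp_of_real[symmetric] field_simps)
      then show "(LINT x|m. ?I \<mu> x) = ?K \<mu>" using F(2) by simp
    qed
    have ci: "integrable m (\<lambda>x. (?I ?\<mu>1 x - ?I ?\<mu>2 x) + \<i> * (?I ?\<mu>3 x - ?I ?\<mu>4 x))"
      by (intro Bochner_Integration.integrable_add Bochner_Integration.integrable_diff integrable_mult_right int parts)
    have ae: "AE x in m. (?I ?\<mu>1 x - ?I ?\<mu>2 x) + \<i> * (?I ?\<mu>3 x - ?I ?\<mu>4 x) = \<Phi> (\<lambda>p. Z x p / sqrt l)"
      using \<Phi>[OF l] by eventually_elim (simp add: cm_integral_def)
    \<comment> \<open>\<open>\<Phi>\<close> is known only almost everywhere along the process;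
      completeness of \<open>m\<close> turns this into measurability.\<close>
    have \<Phi>m: "(\<lambda>x. \<Phi> (\<lambda>p. Z x p / sqrt l)) \<in> borel_measurable m"
      by (rule borel_measurable_AE_eq[OF borel_measurable_integrable[OF ci] ae])
    show "integrable m (\<lambda>x. \<Phi> (\<lambda>p. Z x p / sqrt l))"
      using ci integrable_cong_AE[OF borel_measurable_integrable[OF ci] \<Phi>m ae] by blast
    have "J_fun m Z \<Phi> l = (LINT x|m. (?I ?\<mu>1 x - ?I ?\<mu>2 x) + \<i> * (?I ?\<mu>3 x - ?I ?\<mu>4 x))"
      unfolding J_fun_def by (rule integral_cong_AE[OF borel_measurable_integrable[OF ci] \<Phi>m ae, symmetric])
    also have "\<dots> = (?K ?\<mu>1 - ?K ?\<mu>2) + \<i> * (?K ?\<mu>3 - ?K ?\<mu>4)"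
    proof -
      have d: "integrable m (\<lambda>x. ?I ?\<mu>1 x - ?I ?\<mu>2 x)" "integrable m (\<lambda>x. ?I ?\<mu>3 x - ?I ?\<mu>4 x)"
        by (intro Bochner_Integration.integrable_diff int parts)+
      have d': "(LINT x|m. ?I ?\<mu>1 x - ?I ?\<mu>2 x) = ?K ?\<mu>1 - ?K ?\<mu>2" "(LINT x|m. ?I ?\<mu>3 x - ?I ?\<mu>4 x) = ?K ?\<mu>3 - ?K ?\<mu>4"
        by (simp_all only: Bochner_Integration.integral_diff[OF int int] parts val)
      show ?thesis
        using Bochner_Integration.integral_add[OF d(1) integrable_mult_right[OF d(2), of \<i>]] d'
        by (simp only: integral_mult_right_zero)
    qed
    finally show "g (of_real l) = J_fun m Z \<Phi> l" by (simp only: g_def cm_integral_def)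
  qed
  moreover have "(g \<longlongrightarrow> cm_integral ?L f
      (\<lambda>u. b u * exp (- (\<i> / (2 * of_real q)) * of_real ((L2norm S T (\<lambda>p. L2rep u p * h p))\<^sup>2))))
    (at (- \<i> * of_real q) within {z. 0 < Re z})"
    unfolding tendsto_at_iff_sequentially
  proof (intro allI impI)
    fix X assume X: "\<forall>i. X i \<in> {z. 0 < Re z} - {- \<i> * of_real q}" "X \<longlonglongrightarrow> - \<i> * of_real q"
    have X1: "0 < Re (1 / X n)" for n using X(1) by (intro inv) auto
    \<comment> \<open>The limit is \<open>\<i> / q\<close>, a boundary point of the half-plane,
      where the exponential has modulus 1.\<close>
    have X2: "(\<lambda>n. 1 / X n) \<longlonglongrightarrow> 1 / (- \<i> * of_real q)" using X(2) q by (intro tendsto_intros) auto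
    have "(\<lambda>n. g (X n)) \<longlonglongrightarrow> cm_integral ?L f (\<lambda>u. b u * exp (- (of_real (c u) * (1 / (- \<i> * of_real q)))))"
      unfolding g_def cm_integral_def by (intro tendsto_intros lap(2) parts X1 X2)
    moreover have "- (of_real (c u) * (1 / (- \<i> * of_real q))) =
        - (\<i> / (2 * of_real q)) * of_real ((L2norm S T (\<lambda>p. L2rep u p * h p))\<^sup>2)" for u
      using q by (simp add: c_def field_simps)
    ultimately show "(g \<circ> X) \<longlonglongrightarrow> cm_integral ?L f
        (\<lambda>u. b u * exp (- (\<i> / (2 * of_real q)) * of_real ((L2norm S T (\<lambda>p. L2rep u p * h p))\<^sup>2)))"
      by (simp only: o_def)
  qed
  ultimately show ?thesis unfolding has_feynman_def by blast
qed

text \<open>Off one set that is null for \<open>f\<close> both PWZ integrals exist, hence so does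
  that of the combination. This is the premise of \<open>given_by\<close>, and linearity then
  factors the exponential.\<close>

lemma fourier_functional_shift:
  assumes f: "f \<in> complex_measures (L2borel S T)" and F: "given_by S T \<phi> f F"
    and y: "y \<in> C0 S T" "cm_AE (L2borel S T) f (\<lambda>u. pwz_exists S T \<phi> (L2rep u) y)"
    and z: "z \<in> C0 S T" "cm_AE (L2borel S T) f (\<lambda>u. pwz_exists S T \<phi> (L2rep u) z)"
  shows "F (\<lambda>p. a * y p + c * z p) = cm_integral (L2borel S T) f
    (\<lambda>u. exp (\<i> * of_real (c * pwz S T \<phi> (L2rep u) z)) * exp (\<i> * of_real (a * pwz S T \<phi> (L2rep u) y)))"
proof -
  let ?L = "L2borel S T"
  let ?P = "\<lambda>u. pwz_exists S T \<phi> (L2rep u) y \<and> pwz_exists S T \<phi> (L2rep u) z"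
  have yz: "(\<lambda>p. a * y p + c * z p) \<in> C0 S T" by (intro C0_add C0_scale y z)
  have sets: "{u \<in> space ?L. \<not> ?P u} \<in> sets ?L"
  proof -
    have "{u \<in> space ?L. \<not> ?P u} = {u \<in> space ?L. \<not> pwz_exists S T \<phi> (L2rep u) y} \<union> {u \<in> space ?L. \<not> pwz_exists S T \<phi> (L2rep u) z}"
      by auto
    then show ?thesis using sets.Un[OF sets_pwz_exists[OF y(1)] sets_pwz_exists[OF z(1)]] by (simp only:)
  qed
  have "\<forall>\<mu>\<in>cm_parts ?L f. AE u in \<mu>. ?P u"
    using y(2) z(2) unfolding cm_AE_iff[OF f sets_pwz_exists[OF y(1)]] cm_AE_iff[OF f sets_pwz_exists[OF z(1)]]
    by auto
  then have ae: "cm_AE ?L f ?P" using cm_AE_iff[OF f sets] by blast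
  then have "cm_AE ?L f (\<lambda>u. pwz_exists S T \<phi> (L2rep u) (\<lambda>p. a * y p + c * z p))"
    unfolding cm_AE_def using pwz_linear(1)[OF ST onb y(1) z(1)] by (elim bexE) (intro bexI, auto)
  then have "F (\<lambda>p. a * y p + c * z p) = fourier_functional S T \<phi> f (\<lambda>p. a * y p + c * z p)"
    using F yz unfolding given_by_def by blast
  also have "\<dots> = cm_integral ?L f
    (\<lambda>u. exp (\<i> * of_real (c * pwz S T \<phi> (L2rep u) z)) * exp (\<i> * of_real (a * pwz S T \<phi> (L2rep u) y)))"
    unfolding fourier_functional_def
  proof (rule cm_integral_cong_AE[OF f sets ae])
    note [measurable] = measurable_pwz_rep[OF ST onb yz] measurable_pwz_rep[OF ST onb y(1)] measurable_pwz_rep[OF ST onb z(1)]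
    show "(\<lambda>u. exp (\<i> * of_real (pwz S T \<phi> (L2rep u) (\<lambda>p. a * y p + c * z p)))) \<in> borel_measurable ?L"
      "(\<lambda>u. exp (\<i> * of_real (c * pwz S T \<phi> (L2rep u) z)) * exp (\<i> * of_real (a * pwz S T \<phi> (L2rep u) y)))
        \<in> borel_measurable ?L" by measurable
    fix u assume "?P u"
    then show "exp (\<i> * of_real (pwz S T \<phi> (L2rep u) (\<lambda>p. a * y p + c * z p))) =
        exp (\<i> * of_real (c * pwz S T \<phi> (L2rep u) z)) * exp (\<i> * of_real (a * pwz S T \<phi> (L2rep u) y))"
      by (simp add: pwz_linear(2)[OF ST onb y(1) z(1)] exp_add[symmetric] algebra_simps)
  qed
  finally show ?thesis .
qed

text \<open>The inner integral with the outer path frozen at \<open>z\<close>; the scalar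
  \<open>c\<close> will be \<open>1 / sqrt \<lambda>\<close> for the outer parameter.\<close>

lemma has_feynman_shift:
  assumes Z: "wiener_process Z h" and f: "f \<in> complex_measures (L2borel S T)" and F: "given_by S T \<phi> f F"
    and q: "q \<noteq> 0"
    and z: "z \<in> C0 S T" "cm_AE (L2borel S T) f (\<lambda>u. pwz_exists S T \<phi> (L2rep u) z)"
  shows "has_feynman m Z q (\<lambda>y. F (\<lambda>p. y p + c * z p)) (cm_integral (L2borel S T) f
    (\<lambda>u. exp (\<i> * of_real (c * pwz S T \<phi> (L2rep u) z)) *
      exp (- (\<i> / (2 * of_real q)) * of_real ((L2norm S T (\<lambda>p. L2rep u p * h p))\<^sup>2))))"
proof (rule has_feynman_fourier[OF Z f q])
  note [measurable] = measurable_pwz_rep[OF ST onb z(1)]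
  show "(\<lambda>u. exp (\<i> * of_real (c * pwz S T \<phi> (L2rep u) z))) \<in> borel_measurable (L2borel S T)" by measurable
  fix l :: real assume "0 < l"
  show "AE x in m. F (\<lambda>p. Z x p / sqrt l + c * z p) = cm_integral (L2borel S T) f
      (\<lambda>u. exp (\<i> * of_real (c * pwz S T \<phi> (L2rep u) z)) *
        exp (\<i> * of_real (1 / sqrt l * pwz S T \<phi> (L2rep u) (Z x))))"
    using AE_cm_AE_pwz_exists[OF Z f] AE_space
  proof eventually_elim
    case (elim x)
    then have "Z x \<in> C0 S T" using wiener_process_C0[OF Z] by (simp add: space_m)
    from fourier_functional_shift[OF f F this elim(1) z, of "1 / sqrt l" c] show ?case by simp
  qed
qed simp

lemma has_feynman_given_by:
  assumes Z: "wiener_process Z h" and f: "f \<in> complex_measures (L2borel S T)" and F: "given_by S T \<phi> f F"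
    and q: "q \<noteq> 0"
  shows "has_feynman m Z q F (cm_integral (L2borel S T) f
    (\<lambda>u. exp (- (\<i> / (2 * of_real q)) * of_real ((L2norm S T (\<lambda>p. L2rep u p * h p))\<^sup>2))))"
proof -
  \<comment> \<open>The unshifted case is the shift by \<open>0 * z\<close>, which still asks for an
    admissible path \<open>z\<close>; almost every path of the process is one.\<close>
  have "AE x in m. Z x \<in> C0 S T \<and> cm_AE (L2borel S T) f (\<lambda>u. pwz_exists S T \<phi> (L2rep u) (Z x))"
    using AE_cm_AE_pwz_exists[OF Z f] AE_space
    by eventually_elim (use wiener_process_C0[OF Z] in \<open>simp add: space_m\<close>)
  then obtain z where "z \<in> C0 S T" "cm_AE (L2borel S T) f (\<lambda>u. pwz_exists S T \<phi> (L2rep u) z)"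
    using eventually_happens'[OF ae_filter_bot] by blast
  from has_feynman_shift[OF Z f F q this, of 0] show ?thesis by simp
qed

lemma has_iterated_feynman_given_by:
  assumes Z1: "wiener_process Z1 h1" and Z2: "wiener_process Z2 h2"
    and f: "f \<in> complex_measures (L2borel S T)" and F: "given_by S T \<phi> f F" and q: "q \<noteq> 0"
  shows "has_iterated_feynman m Z1 Z2 q F (cm_integral (L2borel S T) f (\<lambda>u. exp (- (\<i> / (2 * of_real q)) *
    of_real ((L2norm S T (\<lambda>p. L2rep u p * h1 p))\<^sup>2 + (L2norm S T (\<lambda>p. L2rep u p * h2 p))\<^sup>2))))"
  unfolding has_iterated_feynman_def
proof (intro conjI allI impI)
  let ?E = "\<lambda>h u. exp (- (\<i> / (2 * of_real q)) * of_real ((L2norm S T (\<lambda>p. L2rep u p * h p))\<^sup>2))"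
  have inner: "AE x in m. has_feynman m Z1 q (\<lambda>y. F (\<lambda>p. y p + Z2 x p / sqrt l)) (cm_integral (L2borel S T) f
      (\<lambda>u. exp (\<i> * of_real (1 / sqrt l * pwz S T \<phi> (L2rep u) (Z2 x))) * ?E h1 u))" for l
    using AE_cm_AE_pwz_exists[OF Z2 f] AE_space
  proof eventually_elim
    case (elim x)
    then have "Z2 x \<in> C0 S T" using wiener_process_C0[OF Z2] by (simp add: space_m)
    from has_feynman_shift[OF Z1 f F q this elim(1), of "1 / sqrt l"] show ?case by simp
  qed
  show "AE x in m. \<exists>v. has_feynman m Z1 q (\<lambda>y. F (\<lambda>p. y p + Z2 x p / sqrt l)) v" for l
    using inner[of l] by eventually_elim blast
  \<comment> \<open>The outer integral sees \<open>inner_feynman\<close> only along almost every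
    scaled path, and there uniqueness replaces it by the value found in
    \<open>inner\<close>.\<close>
  have "has_feynman m Z2 q (inner_feynman m Z1 q F) (cm_integral (L2borel S T) f (\<lambda>u. ?E h1 u * ?E h2 u))"
  proof (rule has_feynman_fourier[OF Z2 f q])
    note [measurable] = measurable_L2norm_process[OF Z1]
    show "?E h1 \<in> borel_measurable (L2borel S T)" by measurable
    show "norm (?E h1 u) \<le> 1" for u by (simp add: Re_divide)
    fix l :: real assume "0 < l"
    show "AE x in m. inner_feynman m Z1 q F (\<lambda>p. Z2 x p / sqrt l) = cm_integral (L2borel S T) f
        (\<lambda>u. ?E h1 u * exp (\<i> * of_real (1 / sqrt l * pwz S T \<phi> (L2rep u) (Z2 x))))"
      using inner[of l] by eventually_elim (simp add: inner_feynman_def feynman_eq mult.commute)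
  qed
  then show "has_feynman m Z2 q (inner_feynman m Z1 q F) (cm_integral (L2borel S T) f
      (\<lambda>u. exp (- (\<i> / (2 * of_real q)) * of_real ((L2norm S T (\<lambda>p. L2rep u p * h1 p))\<^sup>2 +
        (L2norm S T (\<lambda>p. L2rep u p * h2 p))\<^sup>2))))"
    by (simp only: exp_add[symmetric] distrib_left[symmetric] of_real_add[symmetric])
qed

end

end

theorem theorem4p3:
  fixes S T q :: real
    and m :: "(pt \<Rightarrow> real) measure"
    and \<phi> :: "nat \<Rightarrow> pt \<Rightarrow> real"
    and Y :: "(pt \<Rightarrow> real) \<Rightarrow> (pt \<Rightarrow> real) \<Rightarrow> (pt \<Rightarrow> real)"
    and h1 h2 :: "pt \<Rightarrow> real"
    and F :: "(pt \<Rightarrow> real) \<Rightarrow> complex"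
    and f :: "(pt \<Rightarrow> real) set set \<Rightarrow> complex"
  assumes "S > 0" and "T > 0"
    and "yeh_wiener S T m"
    and "complete_orthonormal_bv S T \<phi>"
    and "gaussian_paths S T \<phi> m Y"
    and "h1 \<in> Supp_BV S T" and "h2 \<in> Supp_BV S T"
    and "F \<in> S_class S T \<phi> m"
    and "f \<in> complex_measures (L2borel S T)"
    and "given_by S T \<phi> f F"
    and "q \<noteq> 0"
  shows "has_iterated_feynman m (Y h1) (Y h2) q F
           (cm_integral (L2borel S T) f (\<lambda>u. exp (- (\<i> / (2 * of_real q)) *
              of_real ((L2norm S T (\<lambda>p. L2rep u p * h1 p))\<^sup>2 + (L2norm S T (\<lambda>p. L2rep u p * h2 p))\<^sup>2))))
       \<and> iterated_feynman m (Y h1) (Y h2) q F =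
           cm_integral (L2borel S T) f (\<lambda>u. exp (- (\<i> / (2 * of_real q)) *
              of_real ((L2norm S T (\<lambda>p. L2rep u p * h1 p))\<^sup>2 + (L2norm S T (\<lambda>p. L2rep u p * h2 p))\<^sup>2)))
       \<and> (\<forall>s\<in>Supp_BV S T. (AE p in leb_Q S T. (s p)\<^sup>2 = (h1 p)\<^sup>2 + (h2 p)\<^sup>2) \<longrightarrow>
            (\<exists>w. has_feynman m (Y s) q F w) \<and>
            iterated_feynman m (Y h1) (Y h2) q F = feynman m (Y s) q F)"
proof -
  interpret yeh_wiener_space S T m by (rule yeh_wiener_space.intro) fact+
  note onb = assms(4) and f = assms(9) and F = assms(10) and q = assms(11)
  note wp = wiener_process_gaussian_paths[OF onb assms(5)]
  let ?E = "\<lambda>u. exp (- (\<i> / (2 * of_real q)) *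
    of_real ((L2norm S T (\<lambda>p. L2rep u p * h1 p))\<^sup>2 + (L2norm S T (\<lambda>p. L2rep u p * h2 p))\<^sup>2))"
  have iter: "has_iterated_feynman m (Y h1) (Y h2) q F (cm_integral (L2borel S T) f ?E)"
    by (rule has_iterated_feynman_given_by[OF onb wp[OF assms(6)] wp[OF assms(7)] f F q])
  then have val: "iterated_feynman m (Y h1) (Y h2) q F = cm_integral (L2borel S T) f ?E"
    unfolding iterated_feynman_def has_iterated_feynman_def by (intro feynman_eq) blast
  \<comment> \<open>The weight \<open>s\<close> enters the value only through the squared norms of
    \<open>u s\<close>, and these are the sums of the two squared norms for \<open>h1\<close> and
    \<open>h2\<close>.\<close>
  have single: "has_feynman m (Y s) q F (cm_integral (L2borel S T) f ?E)"
    if s: "s \<in> Supp_BV S T" "AE p in leb_Q S T. (s p)\<^sup>2 = (h1 p)\<^sup>2 + (h2 p)\<^sup>2" for s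
  proof -
    have "cm_integral (L2borel S T) f (\<lambda>u. exp (- (\<i> / (2 * of_real q)) * of_real ((L2norm S T (\<lambda>p. L2rep u p * s p))\<^sup>2)))
        = cm_integral (L2borel S T) f ?E"
    proof (rule cm_integral_cong[OF f], rule Bochner_Integration.integral_cong[OF refl])
      fix \<mu> u assume "\<mu> \<in> cm_parts (L2borel S T) f" "u \<in> space \<mu>"
      then have "L2rep u \<in> L2fun S T" using cm_parts_measure(3)[OF f] L2rep_L2fun by auto
      from L2norm_mult_sum_squares[OF assms(6,7) s this]
      show "exp (- (\<i> / (2 * of_real q)) * of_real ((L2norm S T (\<lambda>p. L2rep u p * s p))\<^sup>2)) = ?E u" by simp
    qed
    then show ?thesis using has_feynman_given_by[OF onb wp[OF s(1)] f F q] by simp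
  qed
  show ?thesis using iter val single feynman_eq[OF single] by auto
qed

end
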